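(* Let $\Delta=\{\delta_1,\dots,\delta_m\}$ and let $(K,\Delta\cup\{D\})$ be a differential field of characteristic zero equipped with $m+1$ pairwise commuting derivations $\delta_1,\dots,\delta_m,D$. Then $(K,\Delta\cup\{D\})\models DCF_{0,m+1}$ if and only if both of the following hold: (1) $(K,\Delta)\models DCF_{0,m}$; (2) for every $n$, whenever $\Lambda$ is a characteristic set of a prime $\Delta$-ideal of $K\{x_1,\dots,x_n\}$, $O$ is a nonempty $\Delta$-open subset of $\mathcal V(\Lambda)$ with $O\cap\mathcal V(H_\Lambda)=\emptyset$, and $W\subseteq \mathcal V(f,\tau f:\ f\in\Lambda)\subseteq K^{2n}$ is a $\Delta$-closed set whose image under the projection $K^{2n}\to K^n$ onto the first $n$ coordinates contains $O$, there exists $\bar a\in O$ such that $(\bar a, D\bar a)\in W$, where $D\bar a=(Da_1,\dots,Da_n)$.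
   Context: $DCF_{0,k}$ denotes the theory of differentially closed fields of characteristic zero with $k$ commuting derivations. $K\{x_1,\dots,x_n\}$ is the ring of $\Delta$-polynomials over $K$ (polynomials in the variables $\theta x_i$, $\theta$ ranging over the monoid $\Theta$ of operators $\delta_1^{e_1}\cdots\delta_m^{e_m}$). For a set $S$ of $\Delta$-polynomials, $\mathcal V(S)$ denotes its common zero set in the appropriate power of $K$; $\Delta$-closed sets are sets of this form (Kolchin topology with respect to $\Delta$), and $\Delta$-open sets are their complements relative to a given $\Delta$-closed set. A characteristic set is taken with respect to a fixed ranking of the $\Delta$-variables; for a characteristic set $\Lambda$, $H_\Lambda$ is the product of the separants and initials of the elements of $\Lambda$. For $f\in K\{x_1,\dots,x_n\}$, $\tau f\in K\{x_1,\dots,x_n,y_1,\dots,y_n\}$ is the $\Delta$-polynomial $\tau f(\bar x,\bar y)=f^{D}(\bar x)+\sum_{i=1}^n\sum_{\theta\in\Theta}\frac{\partial f}{\partial(\theta x_i)}(\bar x)\,\theta y_i$, where $f^D$ is obtained from $f$ by applying $D$ to its coefficients; thus $D(f(\bar a))=\tau f(\bar a,D\bar a)$ for $\bar a\in K^n$. *)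

theory Defs
  imports "HOL-Library.Poly_Mapping"
begin

text \<open>A derivative theta x_i (theta = delta_0^(e 0) ... delta_(m-1)^(e (m-1))) is the pair (i, e),
  with e j = 0 for j >= m. A Delta-polynomial over K is a finitely supported map from
  monomials (finitely supported maps from derivatives to exponents) to coefficients in K.\<close>

type_synonym dvar = "nat \<times> (nat \<Rightarrow> nat)"
type_synonym 'a dpoly = "(dvar \<Rightarrow>\<^sub>0 nat) \<Rightarrow>\<^sub>0 'a"

definition is_derivation :: "('a::comm_ring_1 \<Rightarrow> 'a) \<Rightarrow> bool" where
  "is_derivation d \<longleftrightarrow> (\<forall>x y. d (x + y) = d x + d y \<and> d (x * y) = x * d y + d x * y)"

definition commuting_derivations :: "nat \<Rightarrow> (nat \<Rightarrow> 'a::field \<Rightarrow> 'a) \<Rightarrow> bool" where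
  "commuting_derivations m \<delta> \<longleftrightarrow>
     (\<forall>j<m. is_derivation (\<delta> j)) \<and> (\<forall>i<m. \<forall>j<m. \<delta> i \<circ> \<delta> j = \<delta> j \<circ> \<delta> i)"

definition dvars :: "nat \<Rightarrow> nat \<Rightarrow> dvar set" where
  "dvars m n = {(i, e). i < n \<and> (\<forall>j\<ge>m. e j = 0)}"

definition dv :: "nat \<Rightarrow> dvar \<Rightarrow> dvar" where
  "dv j u = (fst u, (snd u)(j := Suc (snd u j)))"

definition Xv :: "dvar \<Rightarrow> ('a::comm_ring_1) dpoly" where
  "Xv v = Poly_Mapping.single (Poly_Mapping.single v 1) 1"

definition vars :: "('a::comm_ring_1) dpoly \<Rightarrow> dvar set" where
  "vars p = (\<Union>mono\<in>Poly_Mapping.keys p. Poly_Mapping.keys mono)"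

definition dpolys :: "nat \<Rightarrow> nat \<Rightarrow> ('a::comm_ring_1) dpoly set" where
  "dpolys m n = {p. vars p \<subseteq> dvars m n}"

definition theta :: "nat \<Rightarrow> (nat \<Rightarrow> 'a \<Rightarrow> 'a) \<Rightarrow> (nat \<Rightarrow> nat) \<Rightarrow> 'a \<Rightarrow> 'a" where
  "theta m \<delta> e x = foldr (\<lambda>j y. (\<delta> j ^^ e j) y) [0..<m] x"

definition deval :: "nat \<Rightarrow> (nat \<Rightarrow> 'a::field \<Rightarrow> 'a) \<Rightarrow> 'a list \<Rightarrow> 'a dpoly \<Rightarrow> 'a" where
  "deval m \<delta> a p = (\<Sum>mono\<in>Poly_Mapping.keys p. Poly_Mapping.lookup p mono *
       (\<Prod>v\<in>Poly_Mapping.keys mono. theta m \<delta> (snd v) (a ! fst v) ^ Poly_Mapping.lookup mono v))"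

definition pdiff :: "dvar \<Rightarrow> ('a::comm_ring_1) dpoly \<Rightarrow> 'a dpoly" where
  "pdiff v p = (\<Sum>mono\<in>Poly_Mapping.keys p.
       Poly_Mapping.single (mono - Poly_Mapping.single v 1) (of_nat (Poly_Mapping.lookup mono v) * Poly_Mapping.lookup p mono))"

definition coeff_map :: "('a::comm_ring_1 \<Rightarrow> 'a) \<Rightarrow> 'a dpoly \<Rightarrow> 'a dpoly" where
  "coeff_map d p = Poly_Mapping.map d p"

definition dderiv :: "(nat \<Rightarrow> 'a::comm_ring_1 \<Rightarrow> 'a) \<Rightarrow> nat \<Rightarrow> 'a dpoly \<Rightarrow> 'a dpoly" where
  "dderiv \<delta> j p = coeff_map (\<delta> j) p + (\<Sum>v\<in>vars p. pdiff v p * Xv (dv j v))"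

text \<open>tau f (x, y) in K{x_0..x_(n-1), y_0..y_(n-1)}, where y_i is the variable x_(n+i).\<close>
definition tau :: "('a::comm_ring_1 \<Rightarrow> 'a) \<Rightarrow> nat \<Rightarrow> 'a dpoly \<Rightarrow> 'a dpoly" where
  "tau D n p = coeff_map D p + (\<Sum>v\<in>vars p. pdiff v p * Xv (fst v + n, snd v))"

definition dV :: "nat \<Rightarrow> (nat \<Rightarrow> 'a::field \<Rightarrow> 'a) \<Rightarrow> nat \<Rightarrow> 'a dpoly set \<Rightarrow> 'a list set" where
  "dV m \<delta> n S = {a. length a = n \<and> (\<forall>f\<in>S. deval m \<delta> a f = 0)}"

definition dclosed :: "nat \<Rightarrow> (nat \<Rightarrow> 'a::field \<Rightarrow> 'a) \<Rightarrow> nat \<Rightarrow> 'a list set \<Rightarrow> bool" where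
  "dclosed m \<delta> n X \<longleftrightarrow> (\<exists>S. S \<subseteq> dpolys m n \<and> X = dV m \<delta> n S)"

definition dopen_in :: "nat \<Rightarrow> (nat \<Rightarrow> 'a::field \<Rightarrow> 'a) \<Rightarrow> nat \<Rightarrow> 'a list set \<Rightarrow> 'a list set \<Rightarrow> bool" where
  "dopen_in m \<delta> n X Y \<longleftrightarrow> (\<exists>C. dclosed m \<delta> n C \<and> Y = X - C)"

definition prime_dideal :: "nat \<Rightarrow> (nat \<Rightarrow> 'a::field \<Rightarrow> 'a) \<Rightarrow> nat \<Rightarrow> 'a dpoly set \<Rightarrow> bool" where
  "prime_dideal m \<delta> n P \<longleftrightarrow>
     P \<subseteq> dpolys m n \<and> 0 \<in> P \<and> (\<forall>p\<in>P. \<forall>q\<in>P. p + q \<in> P) \<and>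
     (\<forall>p\<in>P. \<forall>q\<in>dpolys m n. q * p \<in> P) \<and> 1 \<notin> P \<and>
     (\<forall>p\<in>dpolys m n. \<forall>q\<in>dpolys m n. p * q \<in> P \<longrightarrow> p \<in> P \<or> q \<in> P) \<and>
     (\<forall>p\<in>P. \<forall>j<m. dderiv \<delta> j p \<in> P)"

text \<open>(K, delta_0..delta_(m-1)) |= DCF_(0,m) (characteristic 0 is given by the type class):
  a differential field with m commuting derivations in which every finite system of
  Delta-equations and a Delta-inequation that has a solution in some Delta-field extension
  has a solution in K. Solvability in an extension is expressed by the existence of a prime
  Delta-ideal of K{x} containing the equations but not the inequation.\<close>
definition is_DCF0 :: "nat \<Rightarrow> (nat \<Rightarrow> 'a::field_char_0 \<Rightarrow> 'a) \<Rightarrow> bool" where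
  "is_DCF0 m \<delta> \<longleftrightarrow> commuting_derivations m \<delta> \<and>
     (\<forall>n F g. finite F \<and> F \<subseteq> dpolys m n \<and> g \<in> dpolys m n \<and>
        (\<exists>P. prime_dideal m \<delta> n P \<and> F \<subseteq> P \<and> g \<notin> P) \<longrightarrow>
        (\<exists>a. length a = n \<and> (\<forall>f\<in>F. deval m \<delta> a f = 0) \<and> deval m \<delta> a g \<noteq> 0))"

definition is_ranking :: "nat \<Rightarrow> nat \<Rightarrow> (dvar \<Rightarrow> dvar \<Rightarrow> bool) \<Rightarrow> bool" where
  "is_ranking m n lt \<longleftrightarrow>
     (\<forall>u\<in>dvars m n. \<not> lt u u) \<and>
     (\<forall>u\<in>dvars m n. \<forall>v\<in>dvars m n. \<forall>w\<in>dvars m n. lt u v \<and> lt v w \<longrightarrow> lt u w) \<and>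
     (\<forall>u\<in>dvars m n. \<forall>v\<in>dvars m n. u \<noteq> v \<longrightarrow> lt u v \<or> lt v u) \<and>
     (\<forall>u\<in>dvars m n. \<forall>j<m. lt u (dv j u)) \<and>
     (\<forall>u\<in>dvars m n. \<forall>v\<in>dvars m n. lt u v \<longrightarrow> (\<forall>j<m. lt (dv j u) (dv j v)))"

definition leader :: "(dvar \<Rightarrow> dvar \<Rightarrow> bool) \<Rightarrow> ('a::comm_ring_1) dpoly \<Rightarrow> dvar" where
  "leader lt p = (THE u. u \<in> vars p \<and> (\<forall>v\<in>vars p. v \<noteq> u \<longrightarrow> lt v u))"

definition vdeg :: "dvar \<Rightarrow> ('a::comm_ring_1) dpoly \<Rightarrow> nat" where
  "vdeg v p = Max (insert 0 ((\<lambda>mono. Poly_Mapping.lookup mono v) ` Poly_Mapping.keys p))"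

definition vcoeff :: "dvar \<Rightarrow> nat \<Rightarrow> ('a::comm_ring_1) dpoly \<Rightarrow> 'a dpoly" where
  "vcoeff v k p = (\<Sum>mono\<in>{mono\<in>Poly_Mapping.keys p. Poly_Mapping.lookup mono v = k}.
       Poly_Mapping.single (mono - Poly_Mapping.single v k) (Poly_Mapping.lookup p mono))"

definition initial :: "(dvar \<Rightarrow> dvar \<Rightarrow> bool) \<Rightarrow> ('a::comm_ring_1) dpoly \<Rightarrow> 'a dpoly" where
  "initial lt p = vcoeff (leader lt p) (vdeg (leader lt p) p) p"

definition separant :: "(dvar \<Rightarrow> dvar \<Rightarrow> bool) \<Rightarrow> ('a::comm_ring_1) dpoly \<Rightarrow> 'a dpoly" where
  "separant lt p = pdiff (leader lt p) p"

definition proper_derivative :: "dvar \<Rightarrow> dvar \<Rightarrow> bool" where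
  "proper_derivative v u \<longleftrightarrow> fst v = fst u \<and> (\<forall>j. snd u j \<le> snd v j) \<and> snd v \<noteq> snd u"

definition reduced :: "(dvar \<Rightarrow> dvar \<Rightarrow> bool) \<Rightarrow> ('a::comm_ring_1) dpoly \<Rightarrow> 'a dpoly \<Rightarrow> bool" where
  "reduced lt g f \<longleftrightarrow>
     (\<forall>v\<in>vars g. \<not> proper_derivative v (leader lt f)) \<and> vdeg (leader lt f) g < vdeg (leader lt f) f"

definition autoreduced :: "(dvar \<Rightarrow> dvar \<Rightarrow> bool) \<Rightarrow> ('a::comm_ring_1) dpoly set \<Rightarrow> bool" where
  "autoreduced lt A \<longleftrightarrow> finite A \<and> (\<forall>f\<in>A. vars f \<noteq> {}) \<and>
     (\<forall>f\<in>A. \<forall>g\<in>A. f \<noteq> g \<longrightarrow> reduced lt g f)"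

definition rank_lt :: "(dvar \<Rightarrow> dvar \<Rightarrow> bool) \<Rightarrow> ('a::comm_ring_1) dpoly \<Rightarrow> 'a dpoly \<Rightarrow> bool" where
  "rank_lt lt f g \<longleftrightarrow> lt (leader lt f) (leader lt g) \<or>
     (leader lt f = leader lt g \<and> vdeg (leader lt f) f < vdeg (leader lt g) g)"

definition rank_eq :: "(dvar \<Rightarrow> dvar \<Rightarrow> bool) \<Rightarrow> ('a::comm_ring_1) dpoly \<Rightarrow> 'a dpoly \<Rightarrow> bool" where
  "rank_eq lt f g \<longleftrightarrow> leader lt f = leader lt g \<and> vdeg (leader lt f) f = vdeg (leader lt g) g"

definition ar_lower :: "(dvar \<Rightarrow> dvar \<Rightarrow> bool) \<Rightarrow> ('a::comm_ring_1) dpoly set \<Rightarrow> 'a dpoly set \<Rightarrow> bool" where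
  "ar_lower lt A B \<longleftrightarrow> (\<exists>As Bs. set As = A \<and> sorted_wrt (rank_lt lt) As \<and>
      set Bs = B \<and> sorted_wrt (rank_lt lt) Bs \<and>
      ((\<exists>k. k < length As \<and> k < length Bs \<and> (\<forall>i<k. rank_eq lt (As ! i) (Bs ! i)) \<and>
            rank_lt lt (As ! k) (Bs ! k)) \<or>
       (length Bs < length As \<and> (\<forall>i<length Bs. rank_eq lt (As ! i) (Bs ! i)))))"

definition char_set :: "(dvar \<Rightarrow> dvar \<Rightarrow> bool) \<Rightarrow> ('a::comm_ring_1) dpoly set \<Rightarrow> 'a dpoly set \<Rightarrow> bool" where
  "char_set lt P \<Lambda> \<longleftrightarrow> \<Lambda> \<subseteq> P \<and> autoreduced lt \<Lambda> \<and>
     \<not> (\<exists>B. B \<subseteq> P \<and> autoreduced lt B \<and> ar_lower lt B \<Lambda>)"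

definition H :: "(dvar \<Rightarrow> dvar \<Rightarrow> bool) \<Rightarrow> ('a::comm_ring_1) dpoly set \<Rightarrow> 'a dpoly" where
  "H lt \<Lambda> = (\<Prod>f\<in>\<Lambda>. separant lt f * initial lt f)"

end

(*
  Two facts carry the proof. First, the derivation D extends from (K, Delta) to every Delta-extension:
  if Q is a prime Delta-ideal in the variables of D-order at most k and D maps its part of order less
  than k into Q, then Q and D(Q) generate a Delta-ideal that meets the ring of order at most k in Q only,
  because in characteristic 0 a derivation of a field extends to any larger field. A prime Delta-ideal
  over it exists by Zorn's lemma, and the union of the resulting chain is a prime ideal for Delta and D
  lying over Q. Second, a differential Chevalley theorem: if K is differentially closed, then the
  projection of V(Q) contains a nonempty open subset of the zero set of the contraction of Q.

  If K is differentially closed for Delta and D, the polynomials vanishing on the part of W above O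
  lie in a prime Delta-ideal Q of K{x,y} that contracts to P, and Q contains tau f for all f in P; by
  the first fact it extends to a prime ideal for Delta and D, and a point of it with y = Dx is the one
  sought. Conversely, a system of D-order less than r becomes a Delta-system in the variables
  x, Dx, ..., D^(r-1)x. Its prime ideal Q in these variables and their D-images defines W, the second
  fact supplies O, and the axiom gives a solution.
*)
theory Submission
  imports Defs "HOL-Computational_Algebra.Polynomial"
begin

section \<open>Differential polynomials\<close>

text \<open>No extension field or fraction field is formed. A generated extension is a prime ideal
  of a polynomial ring, and adjoining an element means passing from \<open>polys Y\<close> to
  \<open>polys (insert v Y)\<close>. Pseudo-division replaces division: powers of leading
  coefficients stand in for their inverses. The obstacle is finiteness. There are infinitely many
  derivatives, and \<open>is_DCF0\<close> solves finite systems only, while the primes at hand are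
  infinite sets. A characteristic set \<Lambda> of a prime P repairs this: where H does not vanish,
  the zeros of \<Lambda> are zeros of all of P, so finitely many equations and one inequation stand
  for P (\<open>char_set_vanishing\<close>). This is also why O must avoid V(H): a point of
  V(\<Lambda>) at which some element of P is nonzero lies in V(H). In the differential Chevalley
  theorem a characteristic set leaves finitely many algebraic variables to eliminate; in the
  extension of D, each ideal membership involves finitely many values of D.\<close>

abbreviation lk where "lk \<equiv> Poly_Mapping.lookup"
abbreviation ks where "ks \<equiv> Poly_Mapping.keys"

definition cst :: "'a::comm_ring_1 \<Rightarrow> 'a dpoly" where
  "cst c = Poly_Mapping.single 0 c"

text \<open>\<open>dpolys\<close> is not general enough: the proof also uses rings of bounded order
  in \<open>D\<close> and intermediate rings that gain one derivative at a time, which need not be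
  closed under the derivations.\<close>

definition polys :: "dvar set \<Rightarrow> ('a::comm_ring_1) dpoly set" where
  "polys Y = {p. vars p \<subseteq> Y}"

lemma cst_0 [simp]: "cst 0 = 0" and cst_1 [simp]: "cst 1 = 1"
  and cst_add: "cst (x + y) = cst x + cst y" and cst_mult: "cst (x * y) = cst x * cst y"
  by (simp_all add: cst_def single_add mult_single)

lemma cst_inj [simp]: "cst x = cst y \<longleftrightarrow> x = y"
  unfolding cst_def by (metis lookup_single_eq)

lemma cst_eq_0 [simp]: "cst x = 0 \<longleftrightarrow> x = 0"
  using cst_inj[of x 0] by simp

lemma cst_of_nat: "cst (of_nat k) = of_nat k"
  by (simp add: cst_def)

lemma dpoly_sum_single: "(p :: 'b \<Rightarrow>\<^sub>0 'c::comm_monoid_add) = (\<Sum>\<mu>\<in>ks p. Poly_Mapping.single \<mu> (lk p \<mu>))"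
  by (rule poly_mapping_eqI)
    (auto simp: lookup_sum lookup_single when_def in_keys_iff)

lemma dpoly_additive_induct:
  fixes p :: "'b::zero \<Rightarrow>\<^sub>0 'c::comm_monoid_add"
  assumes "\<And>\<mu> c. P (Poly_Mapping.single \<mu> c)" "\<And>p q. P p \<Longrightarrow> P q \<Longrightarrow> P (p + q)"
  shows "P p"
proof -
  have "P (\<Sum>\<mu>\<in>S. Poly_Mapping.single \<mu> (lk p \<mu>))" if "finite S" for S
    using that by (induction S) (use assms(1)[of 0 0] assms in auto)
  from this[of "ks p"] show ?thesis using dpoly_sum_single[of p] by simp
qed

lemma Xv_power: "Xv v ^ k = Poly_Mapping.single (Poly_Mapping.single v k) 1"
  by (induction k) (auto simp: Xv_def mult_single simp flip: single_add)

lemma prod_single: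
  "finite S \<Longrightarrow> (\<Prod>v\<in>S. Poly_Mapping.single (f v) (1::'a::comm_ring_1)) = Poly_Mapping.single (\<Sum>v\<in>S. f v) 1"
  by (induction S rule: finite_induct) (auto simp: mult_single)

lemma single_eq_prod:
  "Poly_Mapping.single \<mu> c = cst c * (\<Prod>v\<in>ks \<mu>. Xv v ^ lk \<mu> v)"
proof -
  have "\<mu> = (\<Sum>v\<in>ks \<mu>. Poly_Mapping.single v (lk \<mu> v))"
    by (rule poly_mapping_eqI) (auto simp: lookup_sum lookup_single when_def in_keys_iff)
  then show ?thesis
    by (simp add: Xv_power prod_single cst_def mult_single)
qed

lemma vars_single: "vars (Poly_Mapping.single \<mu> c) = (if c = 0 then {} else ks \<mu>)"
  by (simp add: vars_def)

lemma vars_cst [simp]: "vars (cst c) = {}"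
  by (simp add: cst_def vars_single)

lemma vars_Xv [simp]: "vars (Xv v :: 'a::comm_ring_1 dpoly) = {v}"
  by (simp add: Xv_def vars_single)

lemma vars_0 [simp]: "vars 0 = {}" and vars_1 [simp]: "vars 1 = {}"
  by (simp_all add: vars_def)

lemma vars_uminus [simp]: "vars (- p) = vars p"
proof -
  have "ks (- p) = ks p" by (auto simp: in_keys_iff)
  then show ?thesis by (simp add: vars_def)
qed

lemma vars_add: "vars (p + q) \<subseteq> vars p \<union> vars q"
  using keys_add[of p q] unfolding vars_def by blast

lemma vars_mult: "vars (p * q) \<subseteq> vars p \<union> vars q"
proof
  fix v assume "v \<in> vars (p * q)"
  then obtain \<mu> where "\<mu> \<in> ks (p * q)" "v \<in> ks \<mu>" by (auto simp: vars_def)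
  then obtain a b where "\<mu> = a + b" "a \<in> ks p" "b \<in> ks q" using keys_mult[of p q] by blast
  then show "v \<in> vars p \<union> vars q"
    using \<open>v \<in> ks \<mu>\<close> keys_add[of a b] by (auto simp: vars_def)
qed

lemma finite_vars [simp]: "finite (vars p)"
  by (simp add: vars_def)

lemma polys_cst [simp]: "cst c \<in> polys Y" and polys_0 [simp]: "0 \<in> polys Y"
  and polys_1 [simp]: "1 \<in> polys Y" and polys_Xv [simp]: "Xv v \<in> polys Y \<longleftrightarrow> v \<in> Y"
  by (simp_all add: polys_def)

lemma polys_add [intro]: "p \<in> polys Y \<Longrightarrow> q \<in> polys Y \<Longrightarrow> p + q \<in> polys Y"
  using vars_add[of p q] by (auto simp: polys_def)

lemma polys_mult [intro]: "p \<in> polys Y \<Longrightarrow> q \<in> polys Y \<Longrightarrow> p * q \<in> polys Y"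
  using vars_mult[of p q] by (auto simp: polys_def)

lemma polys_uminus [simp]: "- p \<in> polys Y \<longleftrightarrow> p \<in> polys Y"
  by (simp add: polys_def)

lemma polys_diff [intro]: "p \<in> polys Y \<Longrightarrow> q \<in> polys Y \<Longrightarrow> p - q \<in> polys Y"
  using polys_add[of p Y "- q"] by simp

lemma polys_sum [intro]: "(\<And>i. i \<in> S \<Longrightarrow> f i \<in> polys Y) \<Longrightarrow> sum f S \<in> polys Y"
  by (induction S rule: infinite_finite_induct) auto

lemma polys_prod [intro]: "(\<And>i. i \<in> S \<Longrightarrow> f i \<in> polys Y) \<Longrightarrow> prod f S \<in> polys Y"
  by (induction S rule: infinite_finite_induct) auto

lemma polys_power [intro]: "p \<in> polys Y \<Longrightarrow> p ^ k \<in> polys Y"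
  by (induction k) auto

lemma polys_mono: "p \<in> polys Y \<Longrightarrow> Y \<subseteq> Z \<Longrightarrow> p \<in> polys Z"
  by (auto simp: polys_def)

lemma polys_vars [simp]: "p \<in> polys (vars p)"
  by (simp add: polys_def)

lemma dpolys_eq: "dpolys m n = polys (dvars m n)"
  by (simp add: dpolys_def polys_def)

lemma vars_empty: "vars p = {} \<Longrightarrow> \<exists>c. p = cst c"
proof -
  assume "vars p = {}"
  then have "ks p \<subseteq> {0}" by (auto simp: vars_def)
  then have "p = Poly_Mapping.single 0 (lk p 0)"
    by (intro poly_mapping_eqI) (auto simp: lookup_single when_def in_keys_iff)
  then show ?thesis unfolding cst_def by blast
qed

lemma polys_induct [consumes 1, case_names cst Xv add mult]:
  fixes p :: "'a::comm_ring_1 dpoly"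
  assumes "p \<in> polys Y" "\<And>c. P (cst c)" "\<And>v. v \<in> Y \<Longrightarrow> P (Xv v)"
    "\<And>p q. p \<in> polys Y \<Longrightarrow> q \<in> polys Y \<Longrightarrow> P p \<Longrightarrow> P q \<Longrightarrow> P (p + q)"
    "\<And>p q. p \<in> polys Y \<Longrightarrow> q \<in> polys Y \<Longrightarrow> P p \<Longrightarrow> P q \<Longrightarrow> P (p * q)"
  shows "P p"
proof -
  have pw: "(Xv v ^ k :: 'a dpoly) \<in> polys Y \<and> P (Xv v ^ k)" if "v \<in> Y" for v k
  proof (induction k)
    case (Suc k)
    with that show ?case using assms(5)[of "Xv v" "Xv v ^ k"] assms(3)[of v] by auto
  qed (use assms(2)[of 1] in auto)
  have pr: "(\<Prod>v\<in>S. Xv v ^ f v :: 'a dpoly) \<in> polys Y \<and> P (\<Prod>v\<in>S. Xv v ^ f v)"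
    if "finite S" "S \<subseteq> Y" for S f
    using that by (induction S) (use assms(2)[of 1] assms(5) pw in auto)
  have sg: "P (Poly_Mapping.single \<mu> (lk p \<mu>))" "Poly_Mapping.single \<mu> (lk p \<mu>) \<in> polys Y"
    if "\<mu> \<in> ks p" for \<mu>
  proof -
    have "ks \<mu> \<subseteq> Y" using that assms(1) by (auto simp: polys_def vars_def)
    then show "P (Poly_Mapping.single \<mu> (lk p \<mu>))" "Poly_Mapping.single \<mu> (lk p \<mu>) \<in> polys Y"
      unfolding single_eq_prod using assms(2,5) pr[of "ks \<mu>" "lk \<mu>"] by auto
  qed
  have "(\<Sum>\<mu>\<in>S. Poly_Mapping.single \<mu> (lk p \<mu>)) \<in> polys Y \<and>
      P (\<Sum>\<mu>\<in>S. Poly_Mapping.single \<mu> (lk p \<mu>))"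
    if "finite S" "S \<subseteq> ks p" for S
    using that by (induction S) (use assms(2)[of 0] assms(4) sg in auto)
  then show ?thesis using dpoly_sum_single[of p] by (metis finite_keys order_refl)
qed

lemma dpoly_induct [case_names cst Xv add mult]:
  assumes "\<And>c. P (cst c)" "\<And>v. P (Xv v)"
    "\<And>p q. P p \<Longrightarrow> P q \<Longrightarrow> P (p + q)" "\<And>p q. P p \<Longrightarrow> P q \<Longrightarrow> P (p * q)"
  shows "P p"
  by (rule polys_induct[of p UNIV]) (use assms in \<open>auto simp: polys_def\<close>)


section \<open>Substitution homomorphisms\<close>

definition rhom :: "('a::comm_ring_1 \<Rightarrow> 'b::comm_ring_1) \<Rightarrow> bool" where
  "rhom c \<longleftrightarrow> c 1 = 1 \<and> (\<forall>x y. c (x + y) = c x + c y \<and> c (x * y) = c x * c y)"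

lemma rhom_0: "rhom c \<Longrightarrow> c 0 = 0"
  unfolding rhom_def by (metis add_cancel_right_right)

lemma rhom_id [simp]: "rhom (\<lambda>x. x)" and rhom_cst [simp]: "rhom cst"
  by (auto simp: rhom_def cst_add cst_mult)

text \<open>One substitution map for several purposes: evaluation at a point
  (\<open>deval_ev\<close>), the view of \<open>p\<close> as a polynomial in one variable
  (\<open>U\<close>), renaming of variables, and partial evaluation
  (\<open>subst_x\<close>).\<close>

definition ev :: "('a::comm_ring_1 \<Rightarrow> 'b::comm_ring_1) \<Rightarrow> (dvar \<Rightarrow> 'b) \<Rightarrow> 'a dpoly \<Rightarrow> 'b" where
  "ev c g p = (\<Sum>\<mu>\<in>ks p. c (lk p \<mu>) * (\<Prod>v\<in>ks \<mu>. g v ^ lk \<mu> v))"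

lemma prod_keys_superset:
  "finite V \<Longrightarrow> ks \<mu> \<subseteq> V \<Longrightarrow> (\<Prod>v\<in>ks \<mu>. (g v::'b::comm_ring_1) ^ lk \<mu> v) = (\<Prod>v\<in>V. g v ^ lk \<mu> v)"
  by (rule prod.mono_neutral_left) (auto simp: in_keys_iff)

lemma prod_keys_add:
  "(\<Prod>v\<in>ks (\<mu> + \<nu>). (g v::'b::comm_ring_1) ^ lk (\<mu> + \<nu>) v) =
    (\<Prod>v\<in>ks \<mu>. g v ^ lk \<mu> v) * (\<Prod>v\<in>ks \<nu>. g v ^ lk \<nu> v)"
proof -
  let ?V = "ks \<mu> \<union> ks \<nu>"
  have "(\<Prod>v\<in>ks \<kappa>. g v ^ lk \<kappa> v) = (\<Prod>v\<in>?V. g v ^ lk \<kappa> v)" if "ks \<kappa> \<subseteq> ?V" for \<kappa>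
    using that by (intro prod_keys_superset) auto
  from this[OF keys_add] this[of \<mu>] this[of \<nu>] show ?thesis
    by (simp add: lookup_add power_add prod.distrib)
qed

context
  fixes c :: "'a::comm_ring_1 \<Rightarrow> 'b::comm_ring_1"
  assumes c: "rhom c"
begin

lemma ev_single: "ev c g (Poly_Mapping.single \<mu> x) = c x * (\<Prod>v\<in>ks \<mu>. g v ^ lk \<mu> v)"
  using rhom_0[OF c] by (auto simp: ev_def)

lemma ev_superset:
  "finite S \<Longrightarrow> ks p \<subseteq> S \<Longrightarrow> ev c g p = (\<Sum>\<mu>\<in>S. c (lk p \<mu>) * (\<Prod>v\<in>ks \<mu>. g v ^ lk \<mu> v))"
  unfolding ev_def by (rule sum.mono_neutral_left) (auto simp: in_keys_iff rhom_0[OF c])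

lemma ev_add: "ev c g (p + q) = ev c g p + ev c g q"
  using keys_add[of p q] c
  by (simp add: ev_superset[of "ks p \<union> ks q"] lookup_add rhom_def sum.distrib algebra_simps)

lemma ev_mult: "ev c g (p * q) = ev c g p * ev c g q"
proof (induction p rule: dpoly_additive_induct)
  case (1 \<mu> x)
  show ?case
    by (induction q rule: dpoly_additive_induct)
      (use c in \<open>auto simp: mult_single ev_single ev_add prod_keys_add algebra_simps rhom_def\<close>)
qed (simp add: ev_add algebra_simps)

lemma ev_cst [simp]: "ev c g (cst x) = c x"
  by (simp add: cst_def ev_single)

lemma ev_Xv [simp]: "ev c g (Xv v) = g v"
  using c by (simp add: Xv_def ev_single rhom_def)

lemma ev_0 [simp]: "ev c g 0 = 0" and ev_1 [simp]: "ev c g 1 = 1"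
  using ev_cst[of g 0] ev_cst[of g 1] c by (simp_all add: rhom_0 rhom_def)

lemma ev_uminus: "ev c g (- p) = - ev c g p"
  using ev_add[of g p "- p"] by (simp add: minus_unique)

lemma ev_diff: "ev c g (p - q) = ev c g p - ev c g q"
  using ev_add[of g p "- q"] by (simp add: ev_uminus)

lemma ev_power: "ev c g (p ^ k) = ev c g p ^ k"
  by (induction k) (simp_all add: ev_mult)

lemma ev_sum: "ev c g (sum f S) = (\<Sum>i\<in>S. ev c g (f i))"
  by (induction S rule: infinite_finite_induct) (simp_all add: ev_add)

lemma ev_cong: "p \<in> polys Y \<Longrightarrow> (\<And>v. v \<in> Y \<Longrightarrow> g v = g' v) \<Longrightarrow> ev c g p = ev c g' p"
  by (induction p rule: polys_induct) (simp_all add: ev_add ev_mult)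

end

lemma ev_polys:
  assumes "p \<in> polys Y" "\<And>v. v \<in> Y \<Longrightarrow> g v \<in> polys Z"
  shows "ev cst g p \<in> polys Z"
  using assms by (induction p rule: polys_induct) (auto simp: ev_add ev_mult)

lemma ev_cst_id: "p \<in> polys Y \<Longrightarrow> (\<And>v. v \<in> Y \<Longrightarrow> g v = Xv v) \<Longrightarrow> ev cst g p = p"
  by (induction p rule: polys_induct) (simp_all add: ev_add ev_mult)

lemma ev_ev:
  assumes "rhom c"
  shows "ev c g (ev cst f p) = ev c (\<lambda>v. ev c g (f v)) p"
  using assms by (induction p rule: dpoly_induct) (simp_all add: ev_add ev_mult)

lemma deval_ev: "deval m \<delta> a p = ev (\<lambda>x. x) (\<lambda>v. theta m \<delta> (snd v) (a ! fst v)) p"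
  by (simp add: deval_def ev_def)


section \<open>Derivations\<close>

text \<open>Common form of \<open>dderiv\<close> and \<open>tau\<close>, which differ only in the
  values \<open>w\<close> on the variables. Leibniz rule and commutation are thus proved once for
  both.\<close>

definition der :: "('a::comm_ring_1 \<Rightarrow> 'a) \<Rightarrow> (dvar \<Rightarrow> 'a dpoly) \<Rightarrow> 'a dpoly \<Rightarrow> 'a dpoly" where
  "der d w p = coeff_map d p + (\<Sum>v\<in>vars p. pdiff v p * w v)"

lemma dderiv_der: "dderiv \<delta> j = der (\<delta> j) (\<lambda>v. Xv (dv j v))"
  by (rule ext) (simp add: dderiv_def der_def)

lemma tau_der: "tau D n = der D (\<lambda>v. Xv (fst v + n, snd v))"
  by (rule ext) (simp add: tau_def der_def)

lemma pdiff_superset: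
  assumes "finite S" "ks p \<subseteq> S"
  shows "pdiff v p = (\<Sum>\<mu>\<in>S. Poly_Mapping.single (\<mu> - Poly_Mapping.single v 1) (of_nat (lk \<mu> v) * lk p \<mu>))"
  unfolding pdiff_def by (rule sum.mono_neutral_left) (use assms in \<open>auto simp: in_keys_iff\<close>)

lemma pdiff_add: "pdiff v (p + q) = pdiff v p + pdiff v q"
  using keys_add[of p q]
  by (simp add: pdiff_superset[of "ks p \<union> ks q"] lookup_add algebra_simps sum.distrib single_add)

lemma pdiff_single:
  "pdiff v (Poly_Mapping.single \<mu> c) = Poly_Mapping.single (\<mu> - Poly_Mapping.single v 1) (of_nat (lk \<mu> v) * c)"
  by (simp add: pdiff_def)

lemma minus_single_add:
  "0 < lk \<nu> v \<Longrightarrow> (\<mu> + \<nu>) - Poly_Mapping.single v (1::nat) = \<mu> + (\<nu> - Poly_Mapping.single v 1)"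
  by (rule poly_mapping_eqI) (auto simp: lookup_add lookup_minus lookup_single when_def)

lemma pdiff_mult: "pdiff v (p * q) = p * pdiff v q + pdiff v p * q"
proof (induction p rule: dpoly_additive_induct)
  case (1 \<mu> x)
  show ?case
  proof (induction q rule: dpoly_additive_induct)
    case (1 \<nu> y)
    have *: "Poly_Mapping.single (a + b - Poly_Mapping.single v 1) (of_nat (lk b v) * (x * y)) =
        Poly_Mapping.single (a + (b - Poly_Mapping.single v 1)) (of_nat (lk b v) * (x * y))" for a b
      by (cases "lk b v = 0") (simp_all add: minus_single_add[simplified])
    show ?case
      using *[of \<mu> \<nu>] *[of \<nu> \<mu>]
      by (simp add: pdiff_single mult_single lookup_add algebra_simps single_add)
  qed (simp add: pdiff_add algebra_simps)
qed (simp add: pdiff_add algebra_simps)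

lemma pdiff_cst [simp]: "pdiff v (cst c) = 0"
  by (simp add: cst_def pdiff_single)

lemma pdiff_Xv: "pdiff v (Xv u) = (if u = v then 1 else 0)"
  by (auto simp: Xv_def pdiff_single lookup_single)

lemma pdiff_not_in: "v \<notin> vars p \<Longrightarrow> pdiff v p = 0"
proof -
  have "pdiff v p = 0" if "p \<in> polys Y" "v \<notin> Y" for Y
    using that by (induction p rule: polys_induct) (auto simp: pdiff_Xv pdiff_add pdiff_mult)
  then show "v \<notin> vars p \<Longrightarrow> pdiff v p = 0" by (metis polys_vars)
qed

context
  fixes d :: "'a::comm_ring_1 \<Rightarrow> 'a"
  assumes d: "is_derivation d"
begin

lemma is_derivation_0: "d 0 = 0" and is_derivation_1: "d 1 = 0"
proof -
  show "d 0 = 0" using d unfolding is_derivation_def by (metis add_cancel_right_right)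
  have "d (1 * 1) = 1 * d 1 + d 1 * 1" using d unfolding is_derivation_def by blast
  then show "d 1 = 0" by simp
qed

lemma lookup_coeff_map: "lk (coeff_map d p) \<mu> = d (lk p \<mu>)"
  unfolding coeff_map_def by (simp add: Poly_Mapping.map.rep_eq when_def is_derivation_0)

lemma coeff_map_add: "coeff_map d (p + q) = coeff_map d p + coeff_map d q"
  using d by (intro poly_mapping_eqI) (simp add: lookup_coeff_map lookup_add is_derivation_def)

lemma coeff_map_single: "coeff_map d (Poly_Mapping.single \<mu> x) = Poly_Mapping.single \<mu> (d x)"
  by (intro poly_mapping_eqI) (simp add: lookup_coeff_map lookup_single when_def is_derivation_0)

lemma coeff_map_mult: "coeff_map d (p * q) = p * coeff_map d q + coeff_map d p * q"
proof (induction p rule: dpoly_additive_induct)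
  case (1 \<mu> x)
  show ?case
    by (induction q rule: dpoly_additive_induct)
      (use d in \<open>auto simp: mult_single coeff_map_single coeff_map_add algebra_simps is_derivation_def single_add\<close>)
qed (simp add: coeff_map_add algebra_simps)

lemma der_superset:
  "finite V \<Longrightarrow> vars p \<subseteq> V \<Longrightarrow> der d w p = coeff_map d p + (\<Sum>v\<in>V. pdiff v p * w v)"
  unfolding der_def
  by (intro arg_cong2[where f="(+)"] refl sum.mono_neutral_left) (auto simp: pdiff_not_in)

lemma der_add: "der d w (p + q) = der d w p + der d w q"
  using vars_add[of p q]
  by (simp add: der_superset[of "vars p \<union> vars q"] coeff_map_add pdiff_add sum.distrib algebra_simps)

lemma der_mult: "der d w (p * q) = p * der d w q + der d w p * q"
  using vars_mult[of p q]
  by (simp add: der_superset[of "vars p \<union> vars q"] coeff_map_mult pdiff_mult sum.distrib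
      algebra_simps sum_distrib_left sum_distrib_right)

lemma der_cst [simp]: "der d w (cst c) = cst (d c)"
  by (simp add: der_def) (simp add: cst_def coeff_map_single)

lemma der_Xv [simp]: "der d w (Xv v) = w v"
  by (simp add: der_def pdiff_Xv) (simp add: Xv_def coeff_map_single is_derivation_1)

lemma der_0 [simp]: "der d w 0 = 0"
  using der_cst[of w 0] is_derivation_0 by simp

lemma der_polys:
  assumes "p \<in> polys Y" "Y \<subseteq> Z" "\<And>v. v \<in> Y \<Longrightarrow> w v \<in> polys Z"
  shows "der d w p \<in> polys Z"
  using assms(1)
proof (induction p rule: polys_induct)
  case (mult p q)
  then show ?case using polys_mono[OF mult(1) assms(2)] polys_mono[OF mult(2) assms(2)]
    by (auto simp: der_mult)
qed (use assms(2,3) in \<open>auto simp: der_add\<close>)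

text \<open>Isolates one variable: the derivative is linear in \<open>w v\<close> with coefficient
  \<open>pdiff v p\<close>. For \<open>v\<close> the leader of \<open>p\<close> this coefficient is
  the separant.\<close>

lemma der_split: "der d w p = der d (w(v := 0)) p + pdiff v p * w v"
  by (induction p rule: dpoly_induct)
    (auto simp: der_add der_mult pdiff_Xv pdiff_add pdiff_mult algebra_simps)

end

text \<open>Both sides are derivations along the homomorphism \<open>ev c g\<close>, so agreement on
  constants and on the variables in \<open>Y\<close> suffices.\<close>

lemma ev_der:
  assumes "is_derivation d" "rhom c" "p \<in> polys Y"
    "\<And>x y. E (x + y) = E x + E y" "\<And>x y. E (x * y) = x * E y + E x * y"
    "\<And>x. E (c x) = c (d x)" "\<And>v. v \<in> Y \<Longrightarrow> ev c g (w v) = E (g v)"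
  shows "ev c g (der d w p) = E (ev c g p)"
  using assms(3) by (induction p rule: polys_induct)
    (use assms in \<open>simp_all add: ev_add ev_mult der_add der_mult\<close>)

text \<open>The commutator of two derivations is a derivation, so it vanishes once it does so on
  constants and variables.\<close>

lemma der_der_commute:
  assumes "is_derivation d" "is_derivation d'" "p \<in> polys Y" "\<And>x. d (d' x) = d' (d x)"
    "\<And>v. v \<in> Y \<Longrightarrow> der d w (w' v) = der d' w' (w v)"
  shows "der d w (der d' w' p) = der d' w' (der d w p)"
  using assms(3) by (induction p rule: polys_induct)
    (use assms in \<open>simp_all add: der_add der_mult algebra_simps\<close>)


section \<open>Polynomials in one distinguished variable\<close>

text \<open>The coefficients keep the type \<open>dpoly\<close> and merely avoid \<open>v\<close>
  (\<open>coeff_U_polys\<close>); hence they can be compared with ideals of the original ring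
  without a change of type.\<close>

definition U :: "dvar \<Rightarrow> ('a::comm_ring_1) dpoly \<Rightarrow> 'a dpoly poly" where
  "U v p = ev (\<lambda>c. [:cst c:]) (\<lambda>u. if u = v then [:0, 1:] else [:Xv u:]) p"

lemma rhom_pcst: "rhom (\<lambda>c. [:cst c:])"
  by (auto simp: rhom_def cst_add cst_mult one_pCons)

lemma U_add: "U v (p + q) = U v p + U v q" and U_mult: "U v (p * q) = U v p * U v q"
  and U_diff: "U v (p - q) = U v p - U v q"
  and U_power: "U v (p ^ k) = U v p ^ k" and U_sum: "U v (sum f S) = (\<Sum>i\<in>S. U v (f i))"
  and U_cst: "U v (cst c) = [:cst c:]" and U_Xv: "U v (Xv u) = (if u = v then [:0, 1:] else [:Xv u:])"
  and U_0 [simp]: "U v 0 = 0" and U_1 [simp]: "U v 1 = 1"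
  by (simp_all add: U_def ev_add[OF rhom_pcst] ev_mult[OF rhom_pcst] ev_diff[OF rhom_pcst]
      ev_power[OF rhom_pcst] ev_sum[OF rhom_pcst] ev_cst[OF rhom_pcst]
      ev_Xv[OF rhom_pcst] ev_0[OF rhom_pcst] ev_1[OF rhom_pcst])

lemma poly_U: "poly (U v p) (Xv v) = p"
  by (induction p rule: dpoly_induct) (auto simp: U_add U_mult U_cst U_Xv)

lemma U_expand: "p = (\<Sum>k\<le>degree (U v p). coeff (U v p) k * Xv v ^ k)"
  using poly_U[of v p] by (simp add: poly_altdef)

lemma U_eq_0 [simp]: "U v p = 0 \<longleftrightarrow> p = 0"
  by (metis poly_U U_0 poly_0)

lemma U_const: "p \<in> polys Y \<Longrightarrow> v \<notin> Y \<Longrightarrow> U v p = [:p:]"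
  by (induction p rule: polys_induct) (auto simp: U_add U_mult U_cst U_Xv)

lemma coeff_U_polys: "p \<in> polys Y \<Longrightarrow> coeff (U v p) k \<in> polys (Y - {v})"
proof (induction p arbitrary: k rule: polys_induct)
  case (Xv u)
  then show ?case by (auto simp: U_Xv coeff_pCons split: nat.split)
qed (auto simp: U_cst U_add U_mult coeff_mult coeff_pCons split: nat.split)

lemma coeff_U_polys': "p \<in> polys (insert v Y) \<Longrightarrow> coeff (U v p) k \<in> polys Y"
  using coeff_U_polys[of p "insert v Y" v k] by (rule polys_mono) auto

lemma U_Xv_power: "U v (Xv v ^ k) = monom 1 k"
  by (simp add: U_power U_Xv monom_altdef)

lemma U_monomial: "c \<in> polys Y \<Longrightarrow> v \<notin> Y \<Longrightarrow> U v (c * Xv v ^ k) = monom c k"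
  by (simp add: U_mult U_const U_Xv_power smult_monom)

section \<open>Comparison of \<open>vdeg\<close> and \<open>vcoeff\<close> with univariate degrees
  and coefficients\<close>

lemma U_single:
  "U v (Poly_Mapping.single \<mu> c) =
    monom (Poly_Mapping.single (\<mu> - Poly_Mapping.single v (lk \<mu> v)) c) (lk \<mu> v)"
proof -
  let ?\<nu> = "\<mu> - Poly_Mapping.single v (lk \<mu> v)"
  have "\<mu> = ?\<nu> + Poly_Mapping.single v (lk \<mu> v)"
    by (intro poly_mapping_eqI) (auto simp: lookup_add lookup_minus lookup_single when_def)
  then have "Poly_Mapping.single \<mu> c = Poly_Mapping.single ?\<nu> c * Xv v ^ lk \<mu> v"
    by (simp add: Xv_power mult_single)
  moreover have "Poly_Mapping.single ?\<nu> c \<in> polys (- {v})"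
    by (auto simp: polys_def vars_single in_keys_iff lookup_minus)
  ultimately show ?thesis using U_monomial[of _ "- {v}" v] by simp
qed

lemma lookup_coeff_U:
  "lk (coeff (U v p) k) \<nu> = (lk p (\<nu> + Poly_Mapping.single v k) when lk \<nu> v = 0)"
proof (induction p rule: dpoly_additive_induct)
  case (1 \<mu> c)
  have "(lk \<mu> v = k \<and> \<mu> - Poly_Mapping.single v (lk \<mu> v) = \<nu>) \<longleftrightarrow>
      (\<mu> = \<nu> + Poly_Mapping.single v k \<and> lk \<nu> v = 0)"
    by (auto simp: poly_mapping_eq_iff fun_eq_iff lookup_add lookup_minus lookup_single when_def
        simp del: split_paired_All split: if_splits)
  then show ?case
    by (auto simp: U_single coeff_monom lookup_single when_def)
qed (simp add: U_add lookup_add when_add_distrib)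

lemma vcoeff_U: "vcoeff v k p = coeff (U v p) k"
proof -
  have "coeff (U v p) k = (\<Sum>\<mu>\<in>ks p. coeff (U v (Poly_Mapping.single \<mu> (lk p \<mu>))) k)"
    by (subst dpoly_sum_single[of p]) (simp add: U_sum coeff_sum)
  also have "\<dots> = (\<Sum>\<mu>\<in>ks p. if lk \<mu> v = k
      then Poly_Mapping.single (\<mu> - Poly_Mapping.single v k) (lk p \<mu>) else 0)"
    by (intro sum.cong) (auto simp: U_single)
  finally show ?thesis by (simp add: vcoeff_def sum.inter_filter)
qed

lemma vdeg_le_iff: "vdeg v p \<le> b \<longleftrightarrow> (\<forall>\<mu>\<in>ks p. lk \<mu> v \<le> b)"
  by (auto simp: vdeg_def)

lemma vdeg_U: "vdeg v p = degree (U v p)"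
proof (rule antisym)
  show "vdeg v p \<le> degree (U v p)"
    unfolding vdeg_le_iff
  proof
    fix \<mu> assume \<mu>: "\<mu> \<in> ks p"
    let ?\<nu> = "\<mu> - Poly_Mapping.single v (lk \<mu> v)"
    have "?\<nu> + Poly_Mapping.single v (lk \<mu> v) = \<mu>"
      by (intro poly_mapping_eqI) (auto simp: lookup_add lookup_minus lookup_single when_def)
    then have "lk (coeff (U v p) (lk \<mu> v)) ?\<nu> \<noteq> 0"
      using \<mu> by (simp add: lookup_coeff_U lookup_minus in_keys_iff)
    then show "lk \<mu> v \<le> degree (U v p)" by (intro le_degree) auto
  qed
  show "degree (U v p) \<le> vdeg v p"
  proof (intro degree_le allI impI poly_mapping_eqI)
    fix k \<nu> assume k: "vdeg v p < k"
    have "lk p (\<nu> + Poly_Mapping.single v k) = 0"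
    proof (rule ccontr)
      assume "lk p (\<nu> + Poly_Mapping.single v k) \<noteq> 0"
      then have "lk (\<nu> + Poly_Mapping.single v k) v \<le> vdeg v p"
        using vdeg_le_iff[of v p "vdeg v p"] by (auto simp: in_keys_iff)
      with k show False by (simp add: lookup_add)
    qed
    then show "lk (coeff (U v p) k) \<nu> = lk 0 \<nu>" by (simp add: lookup_coeff_U)
  qed
qed

lemma vdeg_coeff_U_le: "vdeg w (coeff (U v p) k) \<le> vdeg w p"
  unfolding vdeg_le_iff
proof
  fix \<nu> assume "\<nu> \<in> ks (coeff (U v p) k)"
  then have "\<nu> + Poly_Mapping.single v k \<in> ks p"
    by (auto simp: in_keys_iff lookup_coeff_U)
  then have "lk (\<nu> + Poly_Mapping.single v k) w \<le> vdeg w p"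
    using vdeg_le_iff[of w p "vdeg w p"] by blast
  then show "lk \<nu> w \<le> vdeg w p" by (simp add: lookup_add)
qed

lemma vdeg_0_iff: "vdeg v p = 0 \<longleftrightarrow> v \<notin> vars p"
  using vdeg_le_iff[of v p 0] by (auto simp: vars_def in_keys_iff)

lemma vdeg_mult_le: "vdeg v (p * q) \<le> vdeg v p + vdeg v q"
  by (simp add: vdeg_U U_mult degree_mult_le)

lemma vdeg_diff_le: "vdeg v p \<le> b \<Longrightarrow> vdeg v q \<le> b \<Longrightarrow> vdeg v (p - q) \<le> b"
  by (simp add: vdeg_U U_diff degree_diff_le)

lemma coeff_U_pdiff: "coeff (U v (pdiff v p)) k = of_nat (Suc k) * coeff (U v p) (Suc k)"
proof (induction p rule: dpoly_additive_induct)
  case (1 \<mu> c)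
  show ?case
  proof (cases "lk \<mu> v")
    case (Suc l)
    have "\<mu> - Poly_Mapping.single v (Suc 0) - Poly_Mapping.single v l = \<mu> - Poly_Mapping.single v (Suc l)"
      by (intro poly_mapping_eqI) (auto simp: lookup_minus lookup_single when_def)
    then show ?thesis
      using Suc by (auto simp: pdiff_single U_single lookup_minus mult_single coeff_monom
          simp del: of_nat_Suc simp flip: single_of_nat)
  qed (simp add: pdiff_single U_single)
qed (simp add: pdiff_add U_add distrib_left)

lemma pdiff_polys: "p \<in> polys Y \<Longrightarrow> pdiff v p \<in> polys Y"
  by (induction p rule: polys_induct) (auto simp: pdiff_Xv pdiff_add pdiff_mult)

text \<open>Multiplication by \<open>l\<close> replaces division by the leading coefficient; each
  round cancels the leading term of \<open>p\<close> in \<open>v\<close>. The last clause serves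
  \<open>reduction\<close>, where the remainder must not gain degree in derivatives that
  \<open>g\<close> does not contain.\<close>

lemma pseudo_division:
  fixes g :: "'a::comm_ring_1 dpoly" and v :: dvar
  defines "l \<equiv> coeff (U v g) (vdeg v g)"
  assumes "0 < vdeg v g" "p \<in> polys Y" "g \<in> polys Y"
  obtains k c r where "l ^ k * p = c * g + r" "vdeg v r < vdeg v g" "c \<in> polys Y" "r \<in> polys Y"
    "\<And>w. w \<notin> vars g \<Longrightarrow> vdeg w r \<le> vdeg w p"
proof -
  have lv: "l \<in> polys (vars g - {v})" unfolding l_def by (intro coeff_U_polys) simp
  have lY: "l \<in> polys Y" unfolding l_def using coeff_U_polys[OF assms(4)] by (rule polys_mono) auto
  have "\<exists>k c r. l ^ k * p = c * g + r \<and> vdeg v r < vdeg v g \<and> c \<in> polys Y \<and> r \<in> polys Y \<and>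
      (\<forall>w. w \<notin> vars g \<longrightarrow> vdeg w r \<le> vdeg w p)"
    using assms(3)
  proof (induction "vdeg v p" arbitrary: p rule: less_induct)
    case less
    show ?case
    proof (cases "vdeg v p < vdeg v g")
      case True
      then show ?thesis using less.prems by (intro exI[of _ 0] exI[of _ p]) auto
    next
      case False
      define n where "n = vdeg v p"
      define a where "a = coeff (U v p) n"
      define t where "t = a * Xv v ^ (n - vdeg v g)"
      define q where "q = l * p - t * g"
      have a: "a \<in> polys (vars p - {v})" unfolding a_def by (intro coeff_U_polys) simp
      have aY: "a \<in> polys Y" unfolding a_def using coeff_U_polys[OF less.prems] by (rule polys_mono) auto
      have "v \<in> vars g" using assms(2) vdeg_0_iff[of v g] by auto
      then have "v \<in> Y" using assms(4) by (auto simp: polys_def)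
      then have tY: "t \<in> polys Y" unfolding t_def using aY by (intro polys_mult polys_power) auto
      have qY: "q \<in> polys Y" unfolding q_def using lY less.prems tY assms(4) by auto
      have Uq: "U v q = smult l (U v p) - monom a (n - vdeg v g) * U v g"
        using U_const[OF lv] U_monomial[OF a] by (simp add: q_def t_def U_diff U_mult)
      have "coeff (U v q) j = 0" if "n \<le> j" for j
      proof (cases "j = n")
        case True
        then have "coeff (U v q) j = l * a - a * l"
          using False by (simp add: Uq coeff_monom_mult a_def l_def n_def)
        then show ?thesis by (simp add: mult.commute)
      next
        case False
        with that show ?thesis using \<open>\<not> vdeg v p < vdeg v g\<close>
          by (auto simp: Uq coeff_monom_mult n_def vdeg_U coeff_eq_0)
      qed
      moreover have "0 < n" using False assms(2) by (simp add: n_def)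
      ultimately have deg: "vdeg v q < n"
        unfolding vdeg_U by (metis degree_0 leading_coeff_0_iff linorder_not_less)
      obtain k c r where r: "l ^ k * q = c * g + r" "vdeg v r < vdeg v g" "c \<in> polys Y" "r \<in> polys Y"
        "\<forall>w. w \<notin> vars g \<longrightarrow> vdeg w r \<le> vdeg w q"
        using less.hyps[of q] deg qY unfolding n_def by blast
      have "vdeg w q \<le> vdeg w p" if w: "w \<notin> vars g" for w
        unfolding q_def
      proof (rule vdeg_diff_le)
        have "w \<notin> vars l" using lv w by (auto simp: polys_def)
        then show "vdeg w (l * p) \<le> vdeg w p" using vdeg_mult_le[of w l p] vdeg_0_iff[of w l] by simp
        have "w \<noteq> v" using \<open>v \<in> vars g\<close> w by auto
        then have "w \<notin> vars (Xv v ^ (n - vdeg v g) :: 'a dpoly)"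
          by (auto simp: Xv_power vars_single)
        then have "vdeg w (Xv v ^ (n - vdeg v g) :: 'a dpoly) = 0" by (simp add: vdeg_0_iff)
        moreover have "vdeg w g = 0" using w by (simp add: vdeg_0_iff)
        ultimately show "vdeg w (t * g) \<le> vdeg w p"
          using vdeg_mult_le[of w t g] vdeg_mult_le[of w a "Xv v ^ (n - vdeg v g)"]
            vdeg_coeff_U_le[of w v p n] unfolding t_def a_def by linarith
      qed
      moreover have "l ^ Suc k * p = (l ^ k * t + c) * g + r"
      proof -
        have "l ^ Suc k * p = l ^ k * q + l ^ k * t * g" by (simp add: q_def algebra_simps)
        then show ?thesis using r(1) by (simp add: algebra_simps)
      qed
      moreover have "l ^ k * t + c \<in> polys Y" using lY tY r(3) by (intro polys_add polys_mult polys_power)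
      ultimately show ?thesis using r by (meson order_trans)
    qed
  qed
  then show ?thesis using that by blast
qed

text \<open>Passing to leading coefficients, one variable at a time, reduces the claim to constants,
  which form a field.\<close>

lemma dpoly_mult_eq_0:
  fixes p q :: "'a::field dpoly"
  assumes "p * q = 0"
  shows "p = 0 \<or> q = 0"
proof -
  have "p = 0 \<or> q = 0" if "finite Y" "p \<in> polys Y" "q \<in> polys Y" "p * q = 0" for Y and p q :: "'a dpoly"
    using that
  proof (induction Y arbitrary: p q rule: finite_induct)
    case empty
    then obtain a b where "p = cst a" "q = cst b" using vars_empty[of p] vars_empty[of q]
      by (auto simp: polys_def)
    then show ?case using empty by (simp flip: cst_mult)
  next
    case (insert v Y)
    have "coeff (U v p * U v q) (degree (U v p) + degree (U v q)) = 0"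
      using insert.prems by (simp flip: U_mult)
    then have "lead_coeff (U v p) * lead_coeff (U v q) = 0" by (simp add: coeff_mult_degree_sum)
    then show ?case using insert.IH coeff_U_polys' insert.prems by (metis U_eq_0 leading_coeff_0_iff)
  qed
  from this[of "vars p \<union> vars q" p q] show ?thesis using assms by (auto simp: polys_def)
qed


section \<open>Differential ideals and primes avoiding a multiplicative set\<close>

definition subring :: "'r::comm_ring_1 set \<Rightarrow> bool" where
  "subring A \<longleftrightarrow> 0 \<in> A \<and> 1 \<in> A \<and> (\<forall>x\<in>A. - x \<in> A) \<and> (\<forall>x\<in>A. \<forall>y\<in>A. x + y \<in> A \<and> x * y \<in> A)"

text \<open>The carrier \<open>A\<close> and the operators \<open>E\<close> are parameters because
  one type hosts all the rings of the proof; with \<open>E = {}\<close> this is an ordinary ideal of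
  \<open>A\<close>.\<close>

definition ideal_of :: "'r::comm_ring_1 set \<Rightarrow> ('r \<Rightarrow> 'r) set \<Rightarrow> 'r set \<Rightarrow> bool" where
  "ideal_of A E I \<longleftrightarrow> I \<subseteq> A \<and> 0 \<in> I \<and> (\<forall>x\<in>I. \<forall>y\<in>I. x + y \<in> I) \<and> (\<forall>a\<in>A. \<forall>x\<in>I. a * x \<in> I) \<and>
    (\<forall>d\<in>E. \<forall>x\<in>I. d x \<in> I)"

definition prime_of :: "'r::comm_ring_1 set \<Rightarrow> ('r \<Rightarrow> 'r) set \<Rightarrow> 'r set \<Rightarrow> bool" where
  "prime_of A E I \<longleftrightarrow> ideal_of A E I \<and> 1 \<notin> I \<and> (\<forall>x\<in>A. \<forall>y\<in>A. x * y \<in> I \<longrightarrow> x \<in> I \<or> y \<in> I)"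

text \<open>Positive integers are required to be invertible so that radicals of differential ideals
  are differential (\<open>radical_diff\<close>).\<close>

definition diffring :: "'r::comm_ring_1 set \<Rightarrow> ('r \<Rightarrow> 'r) set \<Rightarrow> bool" where
  "diffring A E \<longleftrightarrow> subring A \<and> (\<forall>k>0. \<exists>u\<in>A. u * of_nat k = 1) \<and>
    (\<forall>d\<in>E. \<forall>x\<in>A. d x \<in> A) \<and>
    (\<forall>d\<in>E. \<forall>x y. d (x + y) = d x + d y \<and> d (x * y) = x * d y + d x * y)"

lemma subring_power: "subring A \<Longrightarrow> x \<in> A \<Longrightarrow> x ^ k \<in> A"
  by (induction k) (auto simp: subring_def)

lemma subring_of_nat: "subring A \<Longrightarrow> of_nat k \<in> A"
  by (induction k) (auto simp: subring_def)

lemma prime_of_subset: "prime_of A E I \<Longrightarrow> E' \<subseteq> E \<Longrightarrow> prime_of A E' I"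
  by (auto simp: prime_of_def ideal_of_def)

lemma prime_of_Int: "prime_of A E I \<Longrightarrow> subring B \<Longrightarrow> B \<subseteq> A \<Longrightarrow>
    (\<And>d x. d \<in> E' \<Longrightarrow> x \<in> B \<Longrightarrow> x \<in> I \<Longrightarrow> d x \<in> I \<inter> B) \<Longrightarrow> prime_of B E' (I \<inter> B)"
  by (auto simp: prime_of_def ideal_of_def subring_def subset_iff)

context
  fixes A :: "'r::comm_ring_1 set" and E I
  assumes sub: "subring A" and I: "ideal_of A E I"
begin

lemma ideal_0: "0 \<in> I" using I by (simp add: ideal_of_def)
lemma ideal_add: "x \<in> I \<Longrightarrow> y \<in> I \<Longrightarrow> x + y \<in> I" using I by (simp add: ideal_of_def)
lemma ideal_mult: "a \<in> A \<Longrightarrow> x \<in> I \<Longrightarrow> a * x \<in> I" using I by (simp add: ideal_of_def)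
lemma ideal_mult2: "a \<in> A \<Longrightarrow> x \<in> I \<Longrightarrow> x * a \<in> I" using ideal_mult by (simp add: mult.commute)
lemma ideal_carrier: "x \<in> I \<Longrightarrow> x \<in> A" using I by (auto simp: ideal_of_def)
lemma ideal_uminus: "x \<in> I \<Longrightarrow> - x \<in> I"
  using ideal_mult[of "- 1" x] sub by (auto simp: subring_def)
lemma ideal_diff: "x \<in> I \<Longrightarrow> y \<in> I \<Longrightarrow> x - y \<in> I"
  using ideal_add[of x "- y"] ideal_uminus by simp
lemma ideal_sum: "(\<And>i. i \<in> S \<Longrightarrow> f i \<in> I) \<Longrightarrow> sum f S \<in> I"
  by (induction S rule: infinite_finite_induct) (auto simp: ideal_0 ideal_add)
lemma ideal_cong: "x - y \<in> I \<Longrightarrow> x \<in> I \<longleftrightarrow> y \<in> I"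
  using ideal_add[of "x - y" y] ideal_diff[of x "x - y"] by auto

end

lemma prime_ideal: "prime_of A E I \<Longrightarrow> ideal_of A E I" by (simp add: prime_of_def)

lemma prime_mult: "prime_of A E I \<Longrightarrow> x \<in> A \<Longrightarrow> y \<in> A \<Longrightarrow> x * y \<in> I \<longleftrightarrow> x \<in> I \<or> y \<in> I"
  by (auto simp: prime_of_def ideal_of_def) (metis mult.commute)

lemma prime_power: "prime_of A E I \<Longrightarrow> subring A \<Longrightarrow> x \<in> A \<Longrightarrow> x ^ k \<in> I \<Longrightarrow> x \<in> I"
  by (induction k) (auto simp: prime_mult subring_power prime_of_def)

lemma prime_prod:
  assumes "prime_of A E I" "subring A" "finite S" "\<And>i. i \<in> S \<Longrightarrow> f i \<in> A - I"
  shows "prod f S \<in> A - I"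
  using assms(3,4)
proof (induction S rule: finite_induct)
  case (insert i S)
  then have "f i \<in> A - I" "prod f S \<in> A - I" by auto
  then show ?case using insert prime_mult[of A E I "f i" "prod f S"] assms(1,2) by (auto simp: subring_def)
qed (use assms(1,2) in \<open>auto simp: prime_of_def subring_def\<close>)

text \<open>The ordinary ideal; the operators are dealt with by \<open>ideal_gen\<close>. The
  inductive form allows normal forms of the elements to be proved by rule induction.\<close>

inductive_set gen :: "'r::comm_ring_1 set \<Rightarrow> 'r set \<Rightarrow> 'r set" for A G where
  zero: "0 \<in> gen A G"
| base: "g \<in> G \<Longrightarrow> g \<in> gen A G"
| add: "x \<in> gen A G \<Longrightarrow> y \<in> gen A G \<Longrightarrow> x + y \<in> gen A G"
| mult: "a \<in> A \<Longrightarrow> x \<in> gen A G \<Longrightarrow> a * x \<in> gen A G"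

lemma ideal_gen:
  assumes "diffring A E" "G \<subseteq> A" "\<And>d g. d \<in> E \<Longrightarrow> g \<in> G \<Longrightarrow> d g \<in> gen A G"
  shows "ideal_of A E (gen A G)"
proof -
  have d0: "d 0 = 0" if "d \<in> E" for d
    using assms(1) that unfolding diffring_def by (metis add_cancel_right_right)
  have "x \<in> A \<and> (\<forall>d\<in>E. d x \<in> gen A G)" if "x \<in> gen A G" for x
    using that
  proof induction
    case (add x y)
    have "d (x + y) \<in> gen A G" if d: "d \<in> E" for d
    proof -
      have "d (x + y) = d x + d y" using assms(1) d by (simp add: diffring_def)
      then show ?thesis using add d by (auto intro: gen.add)
    qed
    then show ?case using add assms(1) by (auto simp: diffring_def subring_def)
  next
    case (mult a x)
    have "d (a * x) \<in> gen A G" if d: "d \<in> E" for d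
    proof -
      have "d (a * x) = a * d x + d a * x" "d a \<in> A"
        using assms(1) mult.hyps(1) d by (simp_all add: diffring_def)
      then show ?thesis using mult d by (auto intro: gen.add gen.mult)
    qed
    then show ?case using mult assms(1) by (auto simp: diffring_def subring_def)
  next
    case zero
    have "d 0 \<in> gen A G" if "d \<in> E" for d unfolding d0[OF that] by (rule gen.zero)
    then show ?case using assms(1) by (auto simp: diffring_def subring_def)
  qed (use assms(2,3) in auto)
  then show ?thesis by (auto simp: ideal_of_def intro: gen.intros)
qed

lemma gen_subset: "ideal_of A E I \<Longrightarrow> G \<subseteq> I \<Longrightarrow> gen A G \<subseteq> I"
proof
  fix x assume "x \<in> gen A G" "ideal_of A E I" "G \<subseteq> I"
  then show "x \<in> I" by (induction) (auto simp: ideal_of_def)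
qed

text \<open>Differentiating \<open>x ^ (n - k) * d x ^ (2 * k)\<close> and multiplying by
  \<open>d x\<close> trades one factor \<open>x\<close> for two factors \<open>d x\<close>, at the
  cost of an invertible integer factor. After \<open>n\<close> rounds no \<open>x\<close> is
  left.\<close>

lemma radical_diff:
  assumes A: "diffring A E" and I: "ideal_of A E I" and x: "x \<in> A" "x ^ n \<in> I" and d: "d \<in> E"
  shows "d x ^ (2 * n) \<in> I"
proof -
  have sub: "subring A" using A by (simp add: diffring_def)
  have dA: "d x \<in> A" "d (d x) \<in> A" using A d x by (auto simp: diffring_def)
  have add: "d (y + z) = d y + d z" and mul: "d (y * z) = y * d z + d y * z" for y z
    using A d by (auto simp: diffring_def)
  have d1: "d 1 = 0" using mul[of 1 1] by simp
  have pow: "d (y ^ Suc k) = of_nat (Suc k) * y ^ k * d y" for y k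
    by (induction k) (simp_all add: mul d1 algebra_simps)
  note pA = subring_power[OF sub]
  have "x ^ (n - k) * d x ^ (2 * k) \<in> I" if "k \<le> n" for k
    using that
  proof (induction k)
    case (Suc k)
    define j where "j = n - Suc k"
    have nk: "n - k = Suc j" using Suc by (simp add: j_def)
    let ?y = "d x"
    have IH: "x ^ Suc j * ?y ^ (2 * k) \<in> I" using Suc nk by simp
    then have "d (x ^ Suc j * ?y ^ (2 * k)) * ?y \<in> I"
      using I d ideal_mult2[OF sub I dA(1)] by (auto simp: ideal_of_def)
    \<comment> \<open>The summand with the second derivative is a multiple of the previous element
      \<open>x ^ Suc j * ?y ^ (2 * k)\<close>, or zero if \<open>k = 0\<close>.\<close>
    moreover have "x ^ Suc j * d (?y ^ (2 * k)) * ?y \<in> I"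
    proof (cases "2 * k")
      case 0
      then show ?thesis using d1 ideal_0[OF sub I] by simp
    next
      case (Suc i)
      have "x ^ Suc j * d (?y ^ (2 * k)) * ?y = (of_nat (Suc i) * d ?y) * (x ^ Suc j * ?y ^ (2 * k))"
        unfolding Suc pow by (simp add: algebra_simps)
      moreover have "of_nat (Suc i) * d ?y \<in> A"
        using dA subring_of_nat[OF sub] sub by (simp add: subring_def)
      ultimately show ?thesis using ideal_mult[OF sub I _ IH] by simp
    qed
    ultimately have "d (x ^ Suc j * ?y ^ (2 * k)) * ?y - x ^ Suc j * d (?y ^ (2 * k)) * ?y \<in> I"
      by (rule ideal_diff[OF sub I])
    also have "d (x ^ Suc j * ?y ^ (2 * k)) * ?y - x ^ Suc j * d (?y ^ (2 * k)) * ?y =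
        of_nat (Suc j) * (x ^ j * ?y ^ (2 * Suc k))"
      unfolding mul pow by (simp add: algebra_simps)
    finally have *: "of_nat (Suc j) * (x ^ j * ?y ^ (2 * Suc k)) \<in> I" .
    obtain u where u: "u \<in> A" "u * of_nat (Suc j) = 1"
      using A unfolding diffring_def by (metis zero_less_Suc)
    have "u * (of_nat (Suc j) * (x ^ j * ?y ^ (2 * Suc k))) \<in> I"
      using ideal_mult[OF sub I u(1) *] .
    then have "x ^ j * ?y ^ (2 * Suc k) \<in> I"
      using u(2) by (metis mult.assoc mult_1)
    then show ?case by (simp add: j_def)
  qed (use x in simp)
  from this[of n] show ?thesis by simp
qed

text \<open>In characteristic 0 a differential ideal maximal among those missing \<open>S\<close> is radical,
  and its colon ideals are differential ideals; hence it is prime.\<close>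
lemma prime_avoiding:
  assumes A: "diffring A E" and J: "ideal_of A E J"
    and S: "S \<subseteq> A" "1 \<in> S" "\<And>x y. x \<in> S \<Longrightarrow> y \<in> S \<Longrightarrow> x * y \<in> S" and JS: "J \<inter> S = {}"
  obtains P where "prime_of A E P" "J \<subseteq> P" "P \<inter> S = {}"
proof -
  have sub: "subring A" using A by (simp add: diffring_def)
  define F where "F = {I. ideal_of A E I \<and> J \<subseteq> I \<and> I \<inter> S = {}}"
  have "\<exists>M\<in>F. \<forall>X\<in>F. M \<subseteq> X \<longrightarrow> X = M"
  proof (rule subset_Zorn_nonempty)
    show "F \<noteq> {}" using J JS by (auto simp: F_def)
    fix C assume C: "C \<noteq> {}" "subset.chain F C"
    then have CF: "\<And>I. I \<in> C \<Longrightarrow> ideal_of A E I \<and> J \<subseteq> I \<and> I \<inter> S = {}"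
      by (auto simp: F_def subset_chain_def)
    have un: "x + y \<in> \<Union> C" if "x \<in> X" "X \<in> C" "y \<in> Y" "Y \<in> C" for x y X Y
    proof -
      have "X \<subseteq> Y \<or> Y \<subseteq> X" using C that by (auto simp: subset_chain_def)
      then have "x + y \<in> X \<or> x + y \<in> Y"
        using that CF[of X] CF[of Y] by (auto simp: ideal_of_def subset_iff)
      then show ?thesis using that by blast
    qed
    have "ideal_of A E (\<Union> C)"
      unfolding ideal_of_def
    proof (intro conjI ballI)
      have "I \<subseteq> A" if "I \<in> C" for I using CF[OF that] by (simp add: ideal_of_def)
      then show "\<Union> C \<subseteq> A" by blast
      obtain X where "X \<in> C" using C(1) by blast
      then show "0 \<in> \<Union> C" using CF[of X] by (auto simp: ideal_of_def)
      fix x assume "x \<in> \<Union> C"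
      then obtain X where X: "X \<in> C" "x \<in> X" by blast
      then have I: "ideal_of A E X" using CF by blast
      show "a * x \<in> \<Union> C" if "a \<in> A" for a using I X that unfolding ideal_of_def by blast
      show "d x \<in> \<Union> C" if "d \<in> E" for d using I X that unfolding ideal_of_def by blast
      fix y assume "y \<in> \<Union> C"
      then show "x + y \<in> \<Union> C" using un X by blast
    qed
    moreover have "J \<subseteq> \<Union> C" "\<Union> C \<inter> S = {}" using C(1) CF by blast+
    ultimately show "\<Union> C \<in> F" by (simp add: F_def)
  qed
  then obtain M where M: "ideal_of A E M" "J \<subseteq> M" "M \<inter> S = {}"
    and max: "\<And>I. ideal_of A E I \<Longrightarrow> M \<subseteq> I \<Longrightarrow> I \<inter> S = {} \<Longrightarrow> I = M"
    by (auto simp: F_def)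
  note MA = ideal_carrier[OF sub M(1)]
  have cl: "\<And>x y. x \<in> A \<Longrightarrow> y \<in> A \<Longrightarrow> x + y \<in> A \<and> x * y \<in> A" using sub by (auto simp: subring_def)
  have dA: "d x \<in> A" if "d \<in> E" "x \<in> A" for d x using A that by (auto simp: diffring_def)
  have Spow: "x ^ k \<in> S" if "x \<in> S" for x k using that S by (induction k) auto
  \<comment> \<open>The radical is a differential ideal that still misses \<open>S\<close>, since
    \<open>S\<close> is closed under powers; maximality identifies it with \<open>M\<close>.\<close>
  have rad: "x \<in> M" if "x \<in> A" "x ^ n \<in> M" for x n
  proof -
    let ?R = "{x \<in> A. \<exists>n. x ^ n \<in> M}"
    have addR: "\<exists>n. (x + y) ^ n \<in> M" if "x \<in> A" "y \<in> A" "x ^ i \<in> M" "y ^ j \<in> M" for x y i j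
    proof -
      have "(x + y) ^ (i + j) = (\<Sum>k\<le>i + j. of_nat (i + j choose k) * x ^ k * y ^ (i + j - k))"
        by (rule binomial_ring)
      also have "\<dots> \<in> M"
      proof (rule ideal_sum[OF sub M(1)])
        fix k assume "k \<in> {..i + j}"
        show "of_nat (i + j choose k) * x ^ k * y ^ (i + j - k) \<in> M"
        proof (cases "i \<le> k")
          case True
          have "of_nat (i + j choose k) * x ^ k * y ^ (i + j - k) =
              (of_nat (i + j choose k) * x ^ (k - i) * y ^ (i + j - k)) * x ^ i"
          proof -
            have "x ^ k = x ^ (k - i) * x ^ i" using True by (simp flip: power_add)
            then show ?thesis by (simp only: mult_ac)
          qed
          then show ?thesis using that cl subring_power[OF sub] subring_of_nat[OF sub]
            by (auto intro!: ideal_mult[OF sub M(1)])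
        next
          case False
          have "of_nat (i + j choose k) * x ^ k * y ^ (i + j - k) =
              (of_nat (i + j choose k) * x ^ k * y ^ (i - k)) * y ^ j"
          proof -
            have "y ^ (i + j - k) = y ^ (i - k) * y ^ j" using False by (simp flip: power_add)
            then show ?thesis by (simp only: mult_ac)
          qed
          then show ?thesis using that cl subring_power[OF sub] subring_of_nat[OF sub]
            by (auto intro!: ideal_mult[OF sub M(1)])
        qed
      qed
      finally show ?thesis by blast
    qed
    have "ideal_of A E ?R"
      unfolding ideal_of_def
    proof (intro conjI ballI)
      show "0 \<in> ?R" using ideal_0[OF sub M(1)] sub by (auto simp: subring_def intro!: exI[of _ 1])
      fix x assume x: "x \<in> ?R"
      then obtain n where n: "x \<in> A" "x ^ n \<in> M" by blast
      { fix y assume "y \<in> ?R" then show "x + y \<in> ?R" using x addR cl by blast }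
      { fix a assume "a \<in> A"
        then show "a * x \<in> ?R" using n cl subring_power[OF sub]
          by (auto simp: power_mult_distrib intro!: exI[of _ n] ideal_mult[OF sub M(1)]) }
      { fix d assume "d \<in> E"
        then show "d x \<in> ?R" using radical_diff[OF A M(1) n] dA n by blast }
    qed auto
    moreover have "M \<subseteq> ?R" using MA by (auto intro!: exI[of _ 1])
    moreover have "?R \<inter> S = {}" using Spow M(3) by blast
    ultimately have "?R = M" by (rule max)
    then show ?thesis using that by blast
  qed
  have colon: "ideal_of A E {x \<in> A. a * x \<in> M}" if a: "a \<in> A" for a
    unfolding ideal_of_def
  proof (intro conjI ballI)
    show "0 \<in> {x \<in> A. a * x \<in> M}" using ideal_0[OF sub M(1)] sub by (auto simp: subring_def)
    fix x assume x: "x \<in> {x \<in> A. a * x \<in> M}"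
    { fix y assume "y \<in> {x \<in> A. a * x \<in> M}"
      then show "x + y \<in> {x \<in> A. a * x \<in> M}" using x cl ideal_add[OF sub M(1)] by (auto simp: distrib_left) }
    { fix b assume "b \<in> A"
      then show "b * x \<in> {x \<in> A. a * x \<in> M}"
        using x cl ideal_mult[OF sub M(1), of b "a * x"] by (auto simp: mult.left_commute) }
    { fix d assume d: "d \<in> E"
      have "d (a * x) = a * d x + d a * x" using A d by (auto simp: diffring_def)
      moreover have "d (a * x) \<in> M" using x d M(1) by (auto simp: ideal_of_def)
      ultimately have "(a * d x) * (a * d x + d a * x) \<in> M"
        using ideal_mult[OF sub M(1)] cl a x dA[OF d] by auto
      moreover have "d x * d a * (a * x) \<in> M"
        using ideal_mult[OF sub M(1)] cl a x dA[OF d] by auto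
      \<comment> \<open>The square of \<open>a * d x\<close> differs from
        \<open>a * d x * d (a * x)\<close> by a multiple of \<open>a * x\<close>. So it lies in
        \<open>M\<close>, and radicality applies.\<close>
      ultimately have "(a * d x) * (a * d x + d a * x) - d x * d a * (a * x) \<in> M"
        by (rule ideal_diff[OF sub M(1)])
      then have "(a * d x) ^ 2 \<in> M" by (simp add: algebra_simps power2_eq_square)
      then show "d x \<in> {x \<in> A. a * x \<in> M}" using rad[of "a * d x" 2] cl a x dA[OF d] by auto }
  qed auto
  have "x \<in> M \<or> y \<in> M" if xy: "x \<in> A" "y \<in> A" "x * y \<in> M" for x y
  proof (rule ccontr)
    assume n: "\<not> (x \<in> M \<or> y \<in> M)"
    let ?C = "\<lambda>a. {x \<in> A. a * x \<in> M}"
    have sub': "M \<subseteq> ?C a" if "a \<in> A" for a using MA ideal_mult[OF sub M(1) that] by auto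
    \<comment> \<open>\<open>?C x\<close> contains \<open>y\<close>, so it is larger than
      \<open>M\<close> and meets \<open>S\<close> in some \<open>s\<close>; then \<open>?C s\<close>
      contains \<open>x\<close> and meets \<open>S\<close> in some \<open>t\<close>, which puts
      \<open>s * t\<close> into both \<open>M\<close> and \<open>S\<close>.\<close>
    have "?C x \<noteq> M" using xy n by blast
    then obtain s where s: "s \<in> S" "x * s \<in> M" using max[OF colon sub'] xy(1) by blast
    have "?C s \<noteq> M" using xy n s S by (auto simp: mult.commute)
    moreover have "s \<in> A" using s S by auto
    ultimately obtain t where "t \<in> S" "s * t \<in> M" using max[OF colon sub'] by blast
    then show False using S(3)[OF s(1)] M(3) by blast
  qed
  moreover have "1 \<notin> M" using M(3) S(2) by blast
  ultimately have "prime_of A E M" using M(1) by (simp add: prime_of_def)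
  then show ?thesis using that M(2,3) by blast
qed

lemma subring_polys [simp]: "subring (polys Y)"
  by (auto simp: subring_def)

lemma of_nat_inverse_dpoly:
  "0 < k \<Longrightarrow> \<exists>u\<in>polys Y. u * of_nat k = (1::'a::field_char_0 dpoly)"
  by (intro bexI[of _ "cst (inverse (of_nat k))"]) (simp_all flip: cst_of_nat cst_mult)

lemma diffring_polys:
  fixes Y :: "dvar set"
  assumes "\<And>d. d \<in> E \<Longrightarrow> \<exists>d0 w. is_derivation d0 \<and> d = der d0 w \<and> (\<forall>v\<in>Y. w v \<in> polys Y)"
  shows "diffring (polys Y :: 'a::field_char_0 dpoly set) E"
  unfolding diffring_def
proof (intro conjI ballI allI impI)
  fix d assume "d \<in> E"
  then obtain d0 w where d: "is_derivation d0" "d = der d0 w" "\<forall>v\<in>Y. w v \<in> polys Y" using assms by blast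
  fix x y
  show "d (x + y) = d x + d y" "d (x * y) = x * d y + d x * y"
    using d by (simp_all add: der_add der_mult)
  show "x \<in> polys Y \<Longrightarrow> d x \<in> polys Y" using d by (auto intro: der_polys)
qed (auto simp: of_nat_inverse_dpoly)

lemma diffring_polys_empty [simp]: "diffring (polys Y :: 'a::field_char_0 dpoly set) {}"
  by (rule diffring_polys) simp


section \<open>Extending primes by one variable\<close>

text \<open>Polynomials whose coefficients in \<open>v\<close> all lie in \<open>I\<close> form the
  extension of \<open>I\<close> to \<open>polys (insert v Y)\<close>. Congruence modulo this
  extension replaces the quotient ring from here on.\<close>

lemma coeff_U_mult_in:
  assumes I: "ideal_of (polys Y) E I" and x: "x \<in> polys (insert v Y)" and "\<And>j. coeff (U v y) j \<in> I"
  shows "coeff (U v (x * y)) k \<in> I"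
  unfolding U_mult coeff_mult
  by (rule ideal_sum[OF subring_polys I])
    (use assms(3) ideal_mult[OF subring_polys I] coeff_U_polys'[OF x] in auto)

text \<open>Dropping top terms with coefficient in \<open>I\<close> leaves a representative that
  shows the true degree and leading coefficient of \<open>x\<close> modulo \<open>I\<close>.\<close>

lemma trim:
  assumes "0 \<in> I" "v \<notin> Y" "x \<in> polys (insert v Y)" "coeff (U v x) k \<notin> I"
  obtains y where "y \<in> polys (insert v Y)" "\<And>j. coeff (U v (x - y)) j \<in> I"
    "lead_coeff (U v y) \<notin> I" "degree (U v y) \<le> degree (U v x)"
proof -
  have "\<exists>y\<in>polys (insert v Y). (\<forall>j. coeff (U v (x - y)) j \<in> I) \<and> lead_coeff (U v y) \<notin> I \<and>
      degree (U v y) \<le> degree (U v x)"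
    using assms(3,4)
  proof (induction "degree (U v x)" arbitrary: x rule: less_induct)
    case less
    define n where "n = degree (U v x)"
    define a where "a = coeff (U v x) n"
    show ?case
    proof (cases "a \<in> I")
      case False
      then show ?thesis using less.prems assms(1) by (intro bexI[of _ x]) (auto simp: a_def n_def)
    next
      case True
      have aY: "a \<in> polys Y" unfolding a_def by (rule coeff_U_polys'[OF less.prems(1)])
      define x' where "x' = x - a * Xv v ^ n"
      have x': "x' \<in> polys (insert v Y)" unfolding x'_def
        using less.prems(1) polys_mono[OF aY, of "insert v Y"] by (intro polys_diff polys_mult polys_power) auto
      have Ux': "U v x' = U v x - monom a n"
        unfolding x'_def U_diff using U_monomial[OF aY assms(2)] by simp
      have kn: "k \<noteq> n" using less.prems(2) True by (auto simp: a_def)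
      then have nz: "U v x' \<noteq> 0" "coeff (U v x') k \<notin> I"
        using less.prems(2) assms(1) unfolding Ux' by (auto simp: poly_eq_iff)
      have "degree (U v x') \<le> n" unfolding Ux' n_def
        by (intro degree_diff_le) (auto simp: degree_monom_le)
      moreover have "coeff (U v x') n = 0" by (simp add: Ux' a_def)
      ultimately have "degree (U v x') < n" using nz(1)
        by (metis le_neq_implies_less leading_coeff_0_iff)
      then obtain y where y: "y \<in> polys (insert v Y)" "\<forall>j. coeff (U v (x' - y)) j \<in> I"
        "lead_coeff (U v y) \<notin> I" "degree (U v y) \<le> degree (U v x')"
        using less.hyps[of x'] x' nz(2) unfolding n_def by blast
      have "coeff (U v (x - y)) j \<in> I" for j
      proof (cases "j = n")
        case True
        then have "coeff (U v y) j = 0"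
          using y(4) \<open>degree (U v x') < n\<close> by (intro coeff_eq_0) simp
        then show ?thesis using True \<open>a \<in> I\<close> by (simp add: U_diff a_def)
      next
        case False
        then show ?thesis using y(2)[rule_format, of j] by (simp add: U_diff Ux')
      qed
      then show ?thesis using y \<open>degree (U v x') < n\<close> by (intro bexI[of _ y]) (auto simp: n_def)
    qed
  qed
  then show ?thesis using that by blast
qed

text \<open>Degrees add over the domain modulo \<open>I\<close>; here \<open>y\<close> comes from
  \<open>x\<close> by \<open>trim\<close>, so \<open>degree (U v y)\<close> is the degree of
  \<open>x\<close> modulo \<open>I\<close>.\<close>

lemma coeff_U_lead_mult:
  assumes I: "prime_of (polys Y) E I"
    and x: "x \<in> polys (insert v Y)" "y \<in> polys (insert v Y)" "\<And>j. coeff (U v (x - y)) j \<in> I"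
    and g: "g \<in> polys (insert v Y)" "lead_coeff (U v y) \<notin> I" "lead_coeff (U v g) \<notin> I"
  shows "coeff (U v (x * g)) (degree (U v y) + degree (U v g)) \<notin> I"
proof -
  note id = prime_ideal[OF I]
  have "x * g = y * g + g * (x - y)" by (simp add: algebra_simps)
  then have "coeff (U v (x * g)) (degree (U v y) + degree (U v g)) =
      lead_coeff (U v y) * lead_coeff (U v g) + coeff (U v (g * (x - y))) (degree (U v y) + degree (U v g))"
    by (simp only: U_add coeff_add U_mult[of v y] coeff_mult_degree_sum)
  moreover have "coeff (U v (g * (x - y))) (degree (U v y) + degree (U v g)) \<in> I"
    by (rule coeff_U_mult_in[OF id g(1) x(3)])
  moreover have "lead_coeff (U v y) * lead_coeff (U v g) \<notin> I"
    using g prime_mult[OF I coeff_U_polys'[OF x(2)] coeff_U_polys'[OF g(1)]] by auto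
  ultimately show ?thesis using ideal_cong[OF subring_polys id, of _ "lead_coeff (U v y) * lead_coeff (U v g)"]
    by auto
qed

text \<open>Modulo \<open>I\<close>, a multiple of a polynomial of positive degree in
  \<open>v\<close> can be free of \<open>v\<close> only if it is zero.\<close>

lemma lead_eliminate:
  assumes I: "prime_of (polys Y) E I" and v: "v \<notin> Y"
    and x: "x \<in> polys Y" "x = p + c * g" "\<And>j. coeff (U v p) j \<in> I" "c \<in> polys (insert v Y)"
    and g: "g \<in> polys (insert v Y)" "0 < degree (U v g)" "lead_coeff (U v g) \<notin> I"
  shows "x \<in> I"
proof -
  note id = prime_ideal[OF I]
  have cf: "coeff (U v x) k = coeff (U v p) k + coeff (U v (c * g)) k" for k
    using x(2) by (simp add: U_add)
  show ?thesis
  proof (cases "\<forall>j. coeff (U v c) j \<in> I")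
    case True
    have "coeff (U v (g * c)) 0 \<in> I" by (rule coeff_U_mult_in[OF id g(1)]) (use True in auto)
    then have "coeff (U v x) 0 \<in> I" using cf[of 0] x(3) ideal_add[OF subring_polys id]
      by (simp add: mult.commute)
    then show ?thesis using U_const[OF x(1) v] by simp
  next
    case False
    then obtain y where y: "y \<in> polys (insert v Y)" "\<And>j. coeff (U v (c - y)) j \<in> I" "lead_coeff (U v y) \<notin> I"
      using trim[OF ideal_0[OF subring_polys id] v x(4)] by blast
    let ?k = "degree (U v y) + degree (U v g)"
    have "coeff (U v (c * g)) ?k \<notin> I"
      by (rule coeff_U_lead_mult[OF I x(4) y(1,2) g(1) y(3) g(3)])
    moreover have "coeff (U v x) ?k = 0" using U_const[OF x(1) v] g(2)
      by (simp add: coeff_pCons split: nat.split)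
    then have "coeff (U v (c * g)) ?k = - coeff (U v p) ?k"
      using cf[of ?k] by (simp add: eq_neg_iff_add_eq_0 add.commute)
    ultimately show ?thesis using ideal_uminus[OF subring_polys id x(3)] by metis
  qed
qed

text \<open>\<open>f\<close> plays the minimal polynomial of \<open>v\<close> over the residue field
  of \<open>Q \<inter> polys Y\<close>, and \<open>ex\<close> says that \<open>v\<close> is
  algebraic over that field. The last clause is minimality.\<close>

lemma minimal_in_prime:
  fixes Q :: "'a::field_char_0 dpoly set"
  assumes Q: "prime_of (polys (insert v Y)) {} Q" and v: "v \<notin> Y" and ex: "f0 \<in> Q" "coeff (U v f0) k \<notin> Q"
  shows "\<exists>f\<in>Q. lead_coeff (U v f) \<notin> Q \<and> 0 < degree (U v f) \<and> pdiff v f \<notin> Q \<and>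
    (\<forall>q\<in>Q. degree (U v q) < degree (U v f) \<longrightarrow> (\<forall>j. coeff (U v q) j \<in> Q))"
proof -
  note id = prime_ideal[OF Q] and sub = subring_polys[of "insert v Y"]
  note Qc = ideal_carrier[OF sub id]
  have Q0: "0 \<in> Q" by (rule ideal_0[OF sub id])
  have small: "\<exists>y\<in>Q. lead_coeff (U v y) \<notin> Q \<and> degree (U v y) \<le> degree (U v q)"
    if q: "q \<in> Q" "coeff (U v q) j \<notin> Q" for q j
  proof -
    obtain y where y: "y \<in> polys (insert v Y)" "\<And>j. coeff (U v (q - y)) j \<in> Q"
      "lead_coeff (U v y) \<notin> Q" "degree (U v y) \<le> degree (U v q)"
      using trim[OF Q0 v Qc[OF q(1)] q(2)] by blast
    have "q - y = (\<Sum>k\<le>degree (U v (q - y)). coeff (U v (q - y)) k * Xv v ^ k)" by (rule U_expand)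
    also have "\<dots> \<in> Q"
      using y(2) by (intro ideal_sum[OF sub id] ideal_mult2[OF sub id] polys_power) auto
    finally have "y \<in> Q" using q(1) ideal_cong[OF sub id] by blast
    then show ?thesis using y by blast
  qed
  define S where "S = {f \<in> Q. lead_coeff (U v f) \<notin> Q}"
  have "\<exists>f. f \<in> S" using small[OF ex] by (auto simp: S_def)
  then obtain f where f: "f \<in> S" "\<And>q. q \<in> S \<Longrightarrow> degree (U v f) \<le> degree (U v q)"
    using exists_least_iff[of "\<lambda>d. \<exists>f\<in>S. degree (U v f) = d"] by (metis not_le_imp_less)
  have min: "coeff (U v q) j \<in> Q" if "q \<in> Q" "degree (U v q) < degree (U v f)" for q j
    using small[OF that(1)] f(2) that(2) unfolding S_def by fastforce
  have fQ: "f \<in> Q" "lead_coeff (U v f) \<notin> Q" using f by (auto simp: S_def)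
  have pos: "0 < degree (U v f)"
  proof (rule ccontr)
    assume "\<not> 0 < degree (U v f)"
    then have "f = lead_coeff (U v f)" using U_expand[of f v] by simp
    then show False using fQ by simp
  qed
  \<comment> \<open>Characteristic 0 enters: the derivative has smaller degree, so by minimality its
    coefficients lie in \<open>Q\<close>, yet its top coefficient is an invertible integer times the
    leading coefficient of \<open>f\<close>.\<close>
  have "pdiff v f \<notin> Q"
  proof
    assume s: "pdiff v f \<in> Q"
    obtain d where d: "degree (U v f) = Suc d" using pos gr0_conv_Suc by blast
    have "degree (U v (pdiff v f)) \<le> d"
      by (rule degree_le) (use d in \<open>auto simp: coeff_U_pdiff coeff_eq_0\<close>)
    then have "coeff (U v (pdiff v f)) d \<in> Q" using min[OF s] d by simp
    then have *: "of_nat (Suc d) * lead_coeff (U v f) \<in> Q" by (simp add: coeff_U_pdiff d)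
    obtain u where u: "u \<in> polys (insert v Y)" "u * of_nat (Suc d) = (1::'a dpoly)"
      using of_nat_inverse_dpoly[of "Suc d"] by auto
    have "u * (of_nat (Suc d) * lead_coeff (U v f)) \<in> Q"
      by (rule ideal_mult[OF sub id u(1) *])
    then show False using fQ(2) unfolding mult.assoc[symmetric] u(2) by simp
  qed
  then show ?thesis using fQ pos min by (intro bexI[of _ f]) auto
qed

text \<open>Adjoins \<open>v\<close> with the value \<open>- e / s\<close> from the fraction field
  modulo \<open>I\<close>, where \<open>s\<close> is invertible. It serves to assign a value to a
  new derivative.\<close>

lemma prime_linear_extension:
  fixes I :: "'a::field_char_0 dpoly set"
  assumes I: "prime_of (polys Y) {} I" and v: "v \<notin> Y" and se: "s \<in> polys Y" "e \<in> polys Y" "s \<notin> I"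
  obtains I' where "prime_of (polys (insert v Y)) {} I'" "I' \<inter> polys Y = I" "s * Xv v + e \<in> I'"
proof -
  let ?A = "polys (insert v Y) :: 'a dpoly set"
  note id = prime_ideal[OF I]
  define l where "l = s * Xv v + e"
  have "s \<in> ?A" "e \<in> ?A" using polys_mono[OF _ subset_insertI] se(1,2) by blast+
  then have l: "l \<in> ?A" unfolding l_def by (intro polys_add polys_mult) auto
  have Ul: "U v l = [:e, s:]" using U_const[OF se(1) v] U_const[OF se(2) v] by (simp add: l_def U_add U_mult U_Xv)
  have "s \<noteq> 0" using ideal_0[OF subring_polys id] se(3) by auto
  then have degl: "degree (U v l) = 1" "lead_coeff (U v l) = s" by (simp_all add: Ul)
  have IA: "I \<subseteq> ?A" using id polys_mono[of _ Y "insert v Y"] by (auto simp: ideal_of_def)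
  have J: "ideal_of ?A {} (gen ?A (insert l I))" using l IA by (intro ideal_gen) auto
  have rep: "\<exists>p c. x = p + c * l \<and> (\<forall>j. coeff (U v p) j \<in> I) \<and> c \<in> ?A" if "x \<in> gen ?A (insert l I)" for x
    using that
  proof induction
    case zero
    then show ?case using ideal_0[OF subring_polys id] by (intro exI[of _ 0]) auto
  next
    case (base g)
    show ?case
    proof (cases "g = l")
      case True
      show ?thesis
      proof (intro exI conjI)
        show "g = 0 + 1 * l" using True by simp
        show "\<forall>j. coeff (U v 0) j \<in> I" using ideal_0[OF subring_polys id] by simp
      qed simp
    next
      case False
      then have "g \<in> I" using base by simp
      then have "coeff (U v g) j \<in> I" for j
        using U_const[OF ideal_carrier[OF subring_polys id] v] ideal_0[OF subring_polys id]
        by (simp add: coeff_pCons split: nat.split)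
      then have "\<forall>j. coeff (U v g) j \<in> I" by simp
      moreover have "g = g + 0 * l" by simp
      ultimately show ?thesis using polys_0 by blast
    qed
  next
    case (add x y)
    then obtain p c p' c' where "x = p + c * l" "y = p' + c' * l" "c \<in> ?A" "c' \<in> ?A"
      "\<forall>j. coeff (U v p) j \<in> I" "\<forall>j. coeff (U v p') j \<in> I" by blast
    then have "x + y = (p + p') + (c + c') * l" "\<forall>j. coeff (U v (p + p')) j \<in> I" "c + c' \<in> ?A"
      by (auto simp: algebra_simps U_add intro: ideal_add[OF subring_polys id])
    then show ?case by blast
  next
    case (mult a x)
    then obtain p c where "x = p + c * l" "c \<in> ?A" "\<And>j. coeff (U v p) j \<in> I" by blast
    then have "a * x = a * p + (a * c) * l" "\<forall>j. coeff (U v (a * p)) j \<in> I" "a * c \<in> ?A"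
      using mult.hyps(1) by (auto simp: algebra_simps intro: coeff_U_mult_in[OF id])
    then show ?case by blast
  qed
  have JS: "x \<in> I" if x: "x \<in> polys Y" "x \<in> gen ?A (insert l I)" for x
  proof -
    obtain p c where p: "x = p + c * l" "\<And>j. coeff (U v p) j \<in> I" "c \<in> ?A"
      using rep[OF x(2)] by (elim exE conjE) auto
    show ?thesis using lead_eliminate[OF I v x(1) p l] degl se(3) by simp
  qed
  \<comment> \<open>The prime must contract to exactly \<open>I\<close>, so it has to avoid
    \<open>polys Y - I\<close>, which is multiplicative because \<open>I\<close> is prime.\<close>
  obtain P where P: "prime_of ?A {} P" "gen ?A (insert l I) \<subseteq> P" "P \<inter> (polys Y - I) = {}"
  proof (rule prime_avoiding[OF diffring_polys_empty J, of "polys Y - I"])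
    show "polys Y - I \<subseteq> ?A" using polys_mono[of _ Y "insert v Y"] by auto
    show "1 \<in> polys Y - I" using I by (auto simp: prime_of_def)
    show "x * y \<in> polys Y - I" if "x \<in> polys Y - I" "y \<in> polys Y - I" for x y
      using that prime_mult[OF I] by auto
  qed (use JS in auto)
  have "P \<inter> polys Y = I" using P(2,3) gen.base[of _ "insert l I" ?A] ideal_carrier[OF subring_polys id] by blast
  moreover have "l \<in> P" using P(2) gen.base[of l "insert l I" ?A] by blast
  ultimately show ?thesis using that P(1) l_def by blast
qed

text \<open>\<open>G'\<close> is the leading coefficient of a minimal \<open>f \<in> Q\<close> times an element of \<open>(G) + Q\<close> that is free
  of \<open>v\<close>; such an element exists because \<open>v\<close> is algebraic modulo \<open>Q\<close>. If \<open>q\<close> did not exist, \<open>G'\<close> would be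
  a multiple of \<open>f\<close> modulo \<open>p\<close>, which degrees in \<open>v\<close> exclude.\<close>
lemma chevalley_step:
  fixes Q :: "'a::field_char_0 dpoly set"
  assumes Q: "prime_of (polys (insert v Y)) {} Q" and v: "v \<notin> Y" and ex: "f0 \<in> Q" "coeff (U v f0) k \<notin> Q"
    and G: "G \<in> polys (insert v Y)" "G \<notin> Q"
  shows "\<exists>G'\<in>polys Y. G' \<notin> Q \<and> (\<forall>p. prime_of (polys Y) {} p \<longrightarrow> Q \<inter> polys Y \<subseteq> p \<longrightarrow> G' \<notin> p \<longrightarrow>
      (\<exists>q. prime_of (polys (insert v Y)) {} q \<and> p \<subseteq> q \<and> Q \<subseteq> q \<and> G \<notin> q))"
proof -
  let ?A = "polys (insert v Y) :: 'a dpoly set"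
  have YA: "polys Y \<subseteq> ?A" using polys_mono[of _ Y "insert v Y"] by auto
  note id = prime_ideal[OF Q] and sub = subring_polys[of "insert v Y"]
  note Qc = ideal_carrier[OF sub id]
  have Q0: "0 \<in> Q" by (rule ideal_0[OF sub id])
  obtain f where f: "f \<in> Q" "lead_coeff (U v f) \<notin> Q" "0 < degree (U v f)"
    and min': "\<forall>q\<in>Q. degree (U v q) < degree (U v f) \<longrightarrow> (\<forall>j. coeff (U v q) j \<in> Q)"
    using minimal_in_prime[OF Q v ex] by (elim bexE conjE) rule
  have min: "coeff (U v q) j \<in> Q" if "q \<in> Q" "degree (U v q) < degree (U v f)" for q j
    using min' that by simp
  define l where "l = lead_coeff (U v f)"
  have fA: "f \<in> ?A" using f(1) Qc by blast
  have lY: "l \<in> polys Y" unfolding l_def by (rule coeff_U_polys'[OF fA])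
  then have lA: "l \<in> ?A" using YA by blast
  have lk: "l ^ k \<in> ?A - Q" for k using prime_power[OF Q sub lA] f(2) lA by (auto simp: l_def)
  let ?Q = "Q \<inter> polys Y"
  have QY: "prime_of (polys Y) {} ?Q" by (rule prime_of_Int[OF Q]) (use YA in auto)
  have expand: "q \<in> Q" if "q \<in> ?A" "\<And>j. coeff (U v q) j \<in> Q" for q
    by (subst U_expand[of q v]) (use that in \<open>auto intro!: ideal_sum[OF sub id] ideal_mult2[OF sub id]\<close>)
  \<comment> \<open>The part of the ideal \<open>(G) + Q\<close> outside \<open>Q\<close>. An
    element of least degree in \<open>v\<close> will turn out, after trimming, to be free of
    \<open>v\<close>.\<close>
  define T where "T = {x \<in> ?A - Q. \<exists>B\<in>?A. x - B * G \<in> Q}"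
  have "G \<in> T" using G Q0 by (auto simp: T_def intro!: bexI[of _ 1])
  then obtain g0 where g0: "g0 \<in> T" "\<And>x. x \<in> T \<Longrightarrow> degree (U v g0) \<le> degree (U v x)"
    using exists_least_iff[of "\<lambda>d. \<exists>x\<in>T. degree (U v x) = d"] by (metis not_le_imp_less)
  have "\<exists>j. coeff (U v g0) j \<notin> Q" using g0(1) expand[of g0] by (auto simp: T_def)
  then obtain g where g: "g \<in> ?A" "\<And>j. coeff (U v (g0 - g)) j \<in> Q" "lead_coeff (U v g) \<notin> Q"
    "degree (U v g) \<le> degree (U v g0)"
    using trim[OF Q0 v] g0(1) by (auto simp: T_def)
  have gg: "g0 - g \<in> Q" using expand g g0 by (auto simp: T_def)
  then have gQ: "g \<notin> Q" using ideal_cong[OF sub id gg] g0 by (auto simp: T_def)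
  obtain B where B: "B \<in> ?A" "g - B * G \<in> Q"
  proof -
    obtain B where B: "B \<in> ?A" "g0 - B * G \<in> Q" using g0 by (auto simp: T_def)
    have "g0 - B * G - (g0 - g) \<in> Q" using ideal_diff[OF sub id B(2) gg] .
    then show ?thesis using that B by simp
  qed
  have gT: "g \<in> T" using g gQ B by (auto simp: T_def)
  have Tmin: "degree (U v g) \<le> degree (U v x)" if "x \<in> T" for x using g0(2)[OF that] g(4) by simp
  have red: "r \<in> Q" if "r \<in> ?A" "r - C * G \<in> Q" "C \<in> ?A" "degree (U v r) < degree (U v g)" for r C
  proof (rule ccontr)
    assume "r \<notin> Q"
    then have "r \<in> T" using that by (auto simp: T_def)
    then show False using Tmin that(4) by fastforce
  qed
  \<comment> \<open>Otherwise the remainder of \<open>g\<close> modulo \<open>f\<close> has smaller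
    degree than \<open>g\<close>, hence lies in \<open>Q\<close>, and so does
    \<open>l ^ k * g\<close>.\<close>
  have small: "degree (U v g) < degree (U v f)"
  proof (rule ccontr)
    assume n: "\<not> degree (U v g) < degree (U v f)"
    obtain k c r where r: "l ^ k * g = c * f + r" "degree (U v r) < degree (U v f)" "c \<in> ?A" "r \<in> ?A"
      using pseudo_division[of v f g "insert v Y"] f(3) g(1) fA unfolding vdeg_U l_def by metis
    have "r - l ^ k * B * G = l ^ k * (g - B * G) - c * f" using r(1) by (simp add: algebra_simps)
    also have "\<dots> \<in> Q"
      by (rule ideal_diff[OF sub id ideal_mult[OF sub id _ B(2)] ideal_mult[OF sub id r(3) f(1)]])
        (use lk in auto)
    finally have "r \<in> Q" using red[OF r(4)] r(2) n lk B by auto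
    then have "l ^ k * g \<in> Q" unfolding r(1) using f(1) r(3)
      by (intro ideal_add[OF sub id] ideal_mult[OF sub id])
    then show False using prime_mult[OF Q, of "l ^ k" g] lk gQ g(1) by auto
  qed
  \<comment> \<open>If the degree were positive, \<open>g\<close> would divide
    \<open>h ^ k * f\<close> modulo \<open>Q\<close>. The cofactor \<open>c\<close> would lie in
    \<open>Q\<close> without being trivial modulo \<open>?Q\<close>, and its trimmed form would have
    smaller degree than \<open>f\<close>.\<close>
  have deg0: "degree (U v g) = 0"
  proof (rule ccontr)
    assume pos: "degree (U v g) \<noteq> 0"
    define h where "h = lead_coeff (U v g)"
    have hY: "h \<in> polys Y" unfolding h_def by (rule coeff_U_polys'[OF g(1)])
    then have hA: "h \<in> ?A" using YA by blast
    have hk: "h ^ k \<in> ?A - Q" for k using prime_power[OF Q sub hA] g(3) hA by (auto simp: h_def)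
    obtain k c r where r: "h ^ k * f = c * g + r" "degree (U v r) < degree (U v g)" "c \<in> ?A" "r \<in> ?A"
      using pseudo_division[of v g f "insert v Y"] pos g(1) fA unfolding vdeg_U h_def by (metis gr0I)
    have "r - (- c * B) * G = h ^ k * f - c * (g - B * G)" using r(1) by (simp add: algebra_simps)
    also have "\<dots> \<in> Q"
      by (rule ideal_diff[OF sub id ideal_mult[OF sub id _ f(1)] ideal_mult[OF sub id r(3) B(2)]])
        (use hk in auto)
    finally have *: "r - (- c * B) * G \<in> Q" .
    have rQ: "r \<in> Q" by (rule red[OF r(4) * _ r(2)]) (use r(3) B in \<open>auto intro!: polys_mult\<close>)
    have "c * g = h ^ k * f - r" using r(1) by simp
    then have cgQ: "c * g \<in> Q" using rQ f(1) hk ideal_diff[OF sub id] ideal_mult[OF sub id] by auto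
    then have cQ: "c \<in> Q" using prime_mult[OF Q r(3) g(1)] gQ by auto
    have Ucg: "U v (c * g) = smult (h ^ k) (U v f) - U v r"
    proof -
      have "c * g = h ^ k * f - r" using r(1) by simp
      then have "U v (c * g) = U v (h ^ k) * U v f - U v r" by (simp only: U_diff U_mult)
      then show ?thesis by (simp add: U_const[OF polys_power[OF hY] v])
    qed
    have "coeff (U v (c * g)) (degree (U v f)) = h ^ k * l"
      using r(2) small by (simp add: Ucg l_def coeff_eq_0)
    moreover have "h ^ k * l \<notin> Q" using prime_mult[OF Q] hk lA f(2) by (auto simp: l_def)
    ultimately have ncg: "coeff (U v (c * g)) (degree (U v f)) \<notin> ?Q" by auto
    have "\<exists>j. coeff (U v c) j \<notin> ?Q"
      using ncg coeff_U_mult_in[OF prime_ideal[OF QY] g(1), of c] by (auto simp: mult.commute)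
    then obtain y where y: "y \<in> ?A" "\<And>j. coeff (U v (c - y)) j \<in> ?Q" "lead_coeff (U v y) \<notin> ?Q"
      using trim[OF _ v r(3)] Q0 by (metis IntI polys_0)
    have "lead_coeff (U v g) \<notin> ?Q" using g(3) by simp
    from coeff_U_lead_mult[OF QY r(3) y(1,2) g(1) y(3) this]
    have "coeff (U v (c * g)) (degree (U v y) + degree (U v g)) \<noteq> 0" using Q0 by auto
    then have "degree (U v y) + degree (U v g) \<le> degree (U v (c * g))" by (rule le_degree)
    also have "\<dots> \<le> degree (U v f)" unfolding Ucg
      using r(2) small by (intro degree_diff_le) (auto intro: degree_smult_le)
    finally have "degree (U v y) < degree (U v f)" using pos by simp
    moreover have "y \<in> Q"
    proof -
      have "c - y \<in> Q" using expand[of "c - y"] y r(3) by auto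
      then show ?thesis using cQ ideal_cong[OF sub id] by blast
    qed
    ultimately show False using min y(3) coeff_U_polys'[OF y(1)] by blast
  qed
  have "g = coeff (U v g) 0" using U_expand[of g v] deg0 by simp
  then have gY: "g \<in> polys Y" using coeff_U_polys'[OF g(1)] by metis
  show ?thesis
  proof (intro bexI[of _ "l * g"] conjI allI impI)
    show "l * g \<in> polys Y" using lY gY by auto
    show "l * g \<notin> Q" using prime_mult[OF Q lA g(1)] gQ f(2) by (simp add: l_def)
    fix p assume p: "prime_of (polys Y) {} p" "Q \<inter> polys Y \<subseteq> p" "l * g \<notin> p"
    note idp = prime_ideal[OF p(1)] and subY = subring_polys[of Y]
    have lgp: "l \<notin> p" "g \<notin> p" using p(3) prime_mult[OF p(1) lY gY] by auto
    let ?J = "gen ?A (p \<union> Q)"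
    have J: "ideal_of ?A {} ?J"
      by (intro ideal_gen) (use Qc YA ideal_carrier[OF subY idp] in auto)
    \<comment> \<open>Up to powers of \<open>l\<close> and modulo the extension of \<open>p\<close>,
      all elements of \<open>?J\<close> are multiples of \<open>f\<close>: remainders of elements of
      \<open>Q\<close> have their coefficients in \<open>Q \<inter> polys Y\<close>, hence in
      \<open>p\<close>.\<close>
    have rep: "\<exists>k c r. l ^ k * x = r + c * f \<and> c \<in> ?A \<and> (\<forall>j. coeff (U v r) j \<in> p)" if "x \<in> ?J" for x
      using that
    proof induction
      case zero
      then show ?case using ideal_0[OF subY idp] by (intro exI[of _ 0]) auto
    next
      case (base x)
      show ?case
      proof (cases "x \<in> p")
        case True
        then have "coeff (U v x) j \<in> p" for j
          using U_const[OF ideal_carrier[OF subY idp] v] ideal_0[OF subY idp]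
          by (simp add: coeff_pCons split: nat.split)
        then have "\<forall>j. coeff (U v x) j \<in> p" by simp
        moreover have "l ^ 0 * x = x + 0 * f" by simp
        ultimately show ?thesis using polys_0 by blast
      next
        case False
        then have xQ: "x \<in> Q" using base by simp
        obtain k c r where r: "l ^ k * x = c * f + r" "degree (U v r) < degree (U v f)" "c \<in> ?A" "r \<in> ?A"
          using pseudo_division[of v f x "insert v Y"] f(3) Qc[OF xQ] fA unfolding vdeg_U l_def by metis
        have "r = l ^ k * x - c * f" using r(1) by simp
        then have "r \<in> Q" using xQ f(1) r(3) lk ideal_diff[OF sub id] ideal_mult[OF sub id] by auto
        then have "coeff (U v r) j \<in> p" for j using min r(2) p(2) coeff_U_polys'[OF r(4)] by blast
        then show ?thesis using r by (metis add.commute)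
      qed
    next
      case (add x y)
      then obtain k c r k' c' r' where *: "l ^ k * x = r + c * f" "l ^ k' * y = r' + c' * f"
        "c \<in> ?A" "c' \<in> ?A" "\<And>j. coeff (U v r) j \<in> p" "\<And>j. coeff (U v r') j \<in> p" by blast
      have "l ^ (k + k') * (x + y) = l ^ k' * (l ^ k * x) + l ^ k * (l ^ k' * y)"
        by (simp add: algebra_simps power_add)
      also have "\<dots> = (l ^ k' * r + l ^ k * r') + (l ^ k' * c + l ^ k * c') * f"
        unfolding * by (simp add: algebra_simps)
      finally have "l ^ (k + k') * (x + y) = (l ^ k' * r + l ^ k * r') + (l ^ k' * c + l ^ k * c') * f" .
      moreover have "l ^ k' * c + l ^ k * c' \<in> ?A" using * lk by (intro polys_add polys_mult) auto
      moreover have "\<forall>j. coeff (U v (l ^ k' * r + l ^ k * r')) j \<in> p"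
        using * lk by (auto simp: U_add intro!: ideal_add[OF subY idp] coeff_U_mult_in[OF idp])
      ultimately show ?case by blast
    next
      case (mult a x)
      then obtain k c r where *: "l ^ k * x = r + c * f" "c \<in> ?A" "\<And>j. coeff (U v r) j \<in> p" by blast
      have "l ^ k * (a * x) = a * (l ^ k * x)" by (simp add: algebra_simps)
      also have "\<dots> = a * r + a * c * f" unfolding * by (simp add: algebra_simps)
      finally have "l ^ k * (a * x) = a * r + a * c * f" .
      moreover have "a * c \<in> ?A" "\<forall>j. coeff (U v (a * r)) j \<in> p"
        using * mult.hyps(1) by (auto intro!: coeff_U_mult_in[OF idp])
      ultimately show ?case by blast
    qed
    \<comment> \<open>\<open>g ^ n\<close> is congruent to \<open>B ^ n * G ^ n\<close> modulo
      \<open>g - B * G\<close>. A power of \<open>G\<close> in \<open>?J\<close> would therefore put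
      some \<open>l ^ k * g ^ n\<close> into \<open>p\<close>, although neither \<open>l\<close> nor
      \<open>g\<close> lies in the prime \<open>p\<close>.\<close>
    have "G ^ n \<notin> ?J" for n
    proof
      assume "G ^ n \<in> ?J"
      then have "B ^ n * G ^ n \<in> ?J" using B(1) by (intro gen.mult) auto
      moreover have "\<exists>t\<in>?A. g ^ n - B ^ n * G ^ n = t * (g - B * G)"
      proof (induction n)
        case (Suc n)
        then obtain t where t: "t \<in> ?A" "g ^ n - B ^ n * G ^ n = t * (g - B * G)" by blast
        have "g ^ Suc n - B ^ Suc n * G ^ Suc n =
            g * (g ^ n - B ^ n * G ^ n) + B ^ n * G ^ n * (g - B * G)"
          by (simp add: algebra_simps)
        also have "\<dots> = (g * t + B ^ n * G ^ n) * (g - B * G)" unfolding t(2) by (simp add: algebra_simps)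
        finally show ?case using t(1) g(1) B(1) G(1) by (auto intro!: bexI[of _ "g * t + B ^ n * G ^ n"])
      qed (auto intro!: bexI[of _ 0])
      ultimately have "g ^ n \<in> ?J"
        using gen.base[of "g - B * G" "p \<union> Q" ?A] B(2) gen.mult gen.add
        by (metis Un_iff diff_add_cancel)
      then obtain k c r where *: "l ^ k * g ^ n = r + c * f" "c \<in> ?A" "\<And>j. coeff (U v r) j \<in> p"
        using rep by blast
      have "l ^ k * g ^ n \<in> p"
        by (rule lead_eliminate[OF p(1) v _ *(1,3,2) fA f(3)]) (use lY gY lgp(1) in \<open>auto simp: l_def\<close>)
      then show False using prime_mult[OF p(1), of "l ^ k" "g ^ n"] lY gY
          prime_power[OF p(1) subY] lgp by blast
    qed
    then obtain q where "prime_of ?A {} q" "?J \<subseteq> q" "q \<inter> range (\<lambda>n. G ^ n) = {}"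
    proof (elim prime_avoiding[OF diffring_polys_empty J, of "range (\<lambda>n. G ^ n)", rotated -1])
      show "1 \<in> range (\<lambda>n. G ^ n)" by (metis power_0 rangeI)
      show "x * y \<in> range (\<lambda>n. G ^ n)" if "x \<in> range (\<lambda>n. G ^ n)" "y \<in> range (\<lambda>n. G ^ n)" for x y
        using that by (auto simp flip: power_add)
    qed (use G(1) in auto)
    moreover have "G \<in> range (\<lambda>n. G ^ n)" by (metis power_one_right rangeI)
    ultimately show "\<exists>q. prime_of ?A {} q \<and> p \<subseteq> q \<and> Q \<subseteq> q \<and> G \<notin> q"
      using gen.base[of _ "p \<union> Q" ?A] by blast
  qed
qed


section \<open>Rankings and reduction\<close>

lemma nat_mono_subseq:
  fixes s :: "nat \<Rightarrow> nat"
  shows "\<exists>g :: nat \<Rightarrow> nat. strict_mono g \<and> (\<forall>i j. i \<le> j \<longrightarrow> s (g i) \<le> s (g j))"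
proof -
  obtain f where f: "strict_mono f" "monoseq (\<lambda>n. s (f n))" using seq_monosub by blast
  from f(2) consider "incseq (\<lambda>n. s (f n))" | "decseq (\<lambda>n. s (f n))" by (auto simp: monoseq_iff)
  then show ?thesis
  proof cases
    case 1
    then show ?thesis using f(1) by (intro exI[of _ f]) (auto simp: incseq_def)
  next
    case 2
    obtain N where N: "\<And>n. s (f N) \<le> s (f n)" using ex_has_least_nat[of "\<lambda>_. True" _ "\<lambda>n. s (f n)"] by blast
    have "s (f (N + n)) = s (f N)" for n using 2 N[of "N + n"] by (auto simp: decseq_def intro: antisym)
    moreover have "strict_mono (\<lambda>n. f (N + n))" using f(1) by (auto simp: strict_mono_def)
    ultimately show ?thesis by (intro exI[of _ "\<lambda>n. f (N + n)"]) simp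
  qed
qed

lemma dickson:
  fixes s :: "nat \<Rightarrow> nat \<Rightarrow> nat"
  shows "\<exists>g :: nat \<Rightarrow> nat. strict_mono g \<and> (\<forall>c<m. \<forall>i j. i \<le> j \<longrightarrow> s (g i) c \<le> s (g j) c)"
proof (induction m)
  case 0
  then show ?case by (intro exI[of _ id]) (auto simp: strict_mono_def)
next
  case (Suc m)
  then obtain g :: "nat \<Rightarrow> nat" where g: "strict_mono g" "\<forall>c<m. \<forall>i j. i \<le> j \<longrightarrow> s (g i) c \<le> s (g j) c" by blast
  obtain h :: "nat \<Rightarrow> nat" where h: "strict_mono h" "\<forall>i j. i \<le> j \<longrightarrow> s (g (h i)) m \<le> s (g (h j)) m"
    using nat_mono_subseq[of "\<lambda>i. s (g i) m"] by blast
  have "s (g (h i)) c \<le> s (g (h j)) c" if "c < Suc m" "i \<le> j" for c i j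
    using that g(2) h(2) strict_mono_less_eq[OF h(1)] by (cases "c = m") auto
  then show ?case using strict_mono_o[OF g(1) h(1)] by (intro exI[of _ "g \<circ> h"]) (simp add: o_def)
qed

definition dle :: "dvar \<Rightarrow> dvar \<Rightarrow> bool" where
  "dle u v \<longleftrightarrow> fst u = fst v \<and> (\<forall>k. snd u k \<le> snd v k)"

lemma proper_derivative_dle: "proper_derivative v u \<longleftrightarrow> dle u v \<and> u \<noteq> v"
  by (auto simp: proper_derivative_def dle_def prod_eq_iff)

lemma dvars_dickson:
  assumes "\<And>i. s i \<in> dvars m n"
  obtains i j :: nat where "i < j" "dle (s i) (s j)"
proof -
  \<comment> \<open>The extra coordinates \<open>fst (s i)\<close> and \<open>n - fst (s i)\<close>
    can both be weakly increasing only if the index of the variable is constant.\<close>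
  define t where "t = (\<lambda>i c. if c < m then snd (s i) c else if c = m then fst (s i) else n - fst (s i))"
  obtain g :: "nat \<Rightarrow> nat" where g: "strict_mono g" "\<forall>c<Suc (Suc m). \<forall>i j. i \<le> j \<longrightarrow> t (g i) c \<le> t (g j) c"
    using dickson[of "Suc (Suc m)" t] by blast
  have t: "t (g 0) c \<le> t (g 1) c" if "c < Suc (Suc m)" for c using g(2) that by auto
  have "fst (s (g 0)) < n" "fst (s (g 1)) < n" using assms[of "g 0"] assms[of "g 1"] by (auto simp: dvars_def)
  then have "fst (s (g 0)) = fst (s (g 1))" using t[of m] t[of "Suc m"] by (simp add: t_def)
  moreover have "snd (s (g 0)) k \<le> snd (s (g 1)) k" for k
    using t[of k] assms[of "g 0"] by (cases "k < m") (auto simp: t_def dvars_def)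
  ultimately show ?thesis using that[of "g 0" "g 1"] g(1) by (auto simp: dle_def strict_mono_def)
qed

lemma dv_dvars [intro]: "u \<in> dvars m n \<Longrightarrow> j < m \<Longrightarrow> dv j u \<in> dvars m n"
  by (auto simp: dvars_def dv_def)

lemma dle_induct [consumes 3, case_names base dv]:
  assumes "u \<in> dvars m n" "v \<in> dvars m n" "dle u v"
    and "P u" "\<And>w j. w \<in> dvars m n \<Longrightarrow> dle u w \<Longrightarrow> j < m \<Longrightarrow> P w \<Longrightarrow> P (dv j w)"
  shows "P v"
  using assms(2,3)
proof (induction "\<Sum>j<m. snd v j" arbitrary: v rule: less_induct)
  case less
  show ?case
  proof (cases "v = u")
    case False
    have "\<exists>j. snd u j \<noteq> snd v j" using False less.prems(2) unfolding dle_def prod_eq_iff fun_eq_iff by metis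
    then obtain j where "snd u j \<noteq> snd v j" by blast
    then have j: "snd u j < snd v j" using less.prems(2) by (simp add: dle_def order_less_le)
    have jm: "j < m"
    proof (rule ccontr)
      assume "\<not> j < m"
      then have "snd v j = 0" using less.prems(1) by (auto simp: dvars_def)
      with j show False by simp
    qed
    define w where "w = (fst v, (snd v)(j := snd v j - 1))"
    have v: "v = dv j w" using j by (auto simp: dv_def w_def prod_eq_iff)
    have w: "w \<in> dvars m n" "dle u w" using less.prems j jm by (auto simp: dvars_def dle_def w_def)
    have "(\<Sum>i<m. snd w i) < (\<Sum>i<m. snd v i)"
      using j jm by (intro sum_strict_mono_ex1) (auto simp: w_def intro!: bexI[of _ j])
    then show ?thesis using less.hyps w assms(5)[OF w jm] v by blast
  qed (use assms(4) in simp)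
qed

section \<open>Maxima and sorted enumerations of finite sets\<close>

lemma finite_has_max:
  assumes "finite S" "S \<noteq> {}" "\<And>x y z. x \<in> S \<Longrightarrow> y \<in> S \<Longrightarrow> z \<in> S \<Longrightarrow> R x y \<Longrightarrow> R y z \<Longrightarrow> R x z"
    "\<And>x y. x \<in> S \<Longrightarrow> y \<in> S \<Longrightarrow> x \<noteq> y \<Longrightarrow> R x y \<or> R y x"
  shows "\<exists>x\<in>S. \<forall>y\<in>S. y \<noteq> x \<longrightarrow> R y x"
  using assms
proof (induction S rule: finite_ne_induct)
    case (insert x S)
    have "\<exists>z\<in>S. \<forall>y\<in>S. y \<noteq> z \<longrightarrow> R y z"
    proof (rule insert.IH)
      show "R a c" if "a \<in> S" "b \<in> S" "c \<in> S" "R a b" "R b c" for a b c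
        using insert.prems(1)[of a b c] that by simp
      show "R a b \<or> R b a" if "a \<in> S" "b \<in> S" "a \<noteq> b" for a b
        using insert.prems(2)[of a b] that by simp
    qed
    then obtain z where z: "z \<in> S" "\<forall>y\<in>S. y \<noteq> z \<longrightarrow> R y z" by blast
    show ?case
    proof (cases "R x z")
      case False
      have "z \<noteq> x" using z(1) insert.hyps by auto
      then have "R z x" using False insert.prems(2)[of x z] z(1) by auto
      then have "R y x" if "y \<in> S" for y using that insert.prems(1)[of y z x] z by (cases "y = z") auto
      then show ?thesis by auto
    next
      case True
      then show ?thesis using z by (intro bexI[of _ z]) auto
    qed
qed simp

lemma sorted_list_exists:
  assumes "finite S" "\<And>x y z. x \<in> S \<Longrightarrow> y \<in> S \<Longrightarrow> z \<in> S \<Longrightarrow> R x y \<Longrightarrow> R y z \<Longrightarrow> R x z"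
    "\<And>x y. x \<in> S \<Longrightarrow> y \<in> S \<Longrightarrow> x \<noteq> y \<Longrightarrow> R x y \<or> R y x"
  shows "\<exists>xs. set xs = S \<and> sorted_wrt R xs"
  using assms
proof (induction "card S" arbitrary: S)
  case (Suc k)
  have "S \<noteq> {}" using Suc.hyps(2) by auto
  have "\<exists>x\<in>S. \<forall>y\<in>S. y \<noteq> x \<longrightarrow> R y x"
  proof (rule finite_has_max[OF Suc.prems(1) \<open>S \<noteq> {}\<close>, of R])
    show "R a c" if "a \<in> S" "b \<in> S" "c \<in> S" "R a b" "R b c" for a b c
      by (rule Suc.prems(2)[OF that])
    show "R a b \<or> R b a" if "a \<in> S" "b \<in> S" "a \<noteq> b" for a b
      by (rule Suc.prems(3)[OF that])
  qed
  then obtain x where x: "x \<in> S" "\<forall>y\<in>S. y \<noteq> x \<longrightarrow> R y x" by blast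
  have "\<exists>xs. set xs = S - {x} \<and> sorted_wrt R xs"
  proof (rule Suc.hyps(1))
    show "k = card (S - {x})" using Suc.hyps(2) x(1) Suc.prems(1) by simp
    show "R a c" if "a \<in> S - {x}" "b \<in> S - {x}" "c \<in> S - {x}" "R a b" "R b c" for a b c
      using Suc.prems(2)[of a b c] that by simp
    show "R a b \<or> R b a" if "a \<in> S - {x}" "b \<in> S - {x}" "a \<noteq> b" for a b
      using Suc.prems(3)[of a b] that by simp
  qed (use Suc.prems(1) in simp)
  then obtain xs where "set xs = S - {x}" "sorted_wrt R xs" by blast
  then show ?case using x by (intro exI[of _ "xs @ [x]"]) (auto simp: sorted_wrt_append)
qed simp

text \<open>\<open>ar_lower\<close> quantifies over sorted enumerations; this identifies the one it
  provides with the list built in \<open>char_set_exists\<close>.\<close>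

lemma sorted_wrt_unique:
  assumes "\<And>x y. x \<in> set xs \<Longrightarrow> y \<in> set xs \<Longrightarrow> R x y \<Longrightarrow> \<not> R y x"
    "sorted_wrt R xs" "sorted_wrt R ys" "set xs = set ys"
  shows "xs = ys"
  using assms
proof (induction xs arbitrary: ys)
  case (Cons x xs)
  obtain y ys' where ys: "ys = y # ys'" using Cons.prems(4) by (cases ys) simp_all
  have "x = y"
  proof (rule ccontr)
    assume ne: "x \<noteq> y"
    have eq: "set (x # xs) = set (y # ys')" using Cons.prems(4) ys by simp
    have "y \<in> set xs" "x \<in> set ys'" using eq ne by (metis list.set_intros(1) set_ConsD)+
    then have "R x y" "R y x" using Cons.prems(2,3) ys by auto
    then show False using Cons.prems(1)[of x y] \<open>y \<in> set xs\<close> by simp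
  qed
  moreover have "x \<notin> set xs" "x \<notin> set ys'"
  proof -
    have "\<not> R x x" using Cons.prems(1)[of x x] by auto
    then show "x \<notin> set xs" "x \<notin> set ys'" using Cons.prems(2,3) \<open>x = y\<close> unfolding ys by auto
  qed
  ultimately have eq: "set xs = set ys'" using Cons.prems(4) unfolding ys by auto
  have "xs = ys'"
  proof (rule Cons.IH[OF _ _ _ eq])
    show "\<not> R b a" if "a \<in> set xs" "b \<in> set xs" "R a b" for a b
      using Cons.prems(1)[of a b] that by simp
  qed (use Cons.prems(2,3) ys in simp_all)
  then show ?case using ys \<open>x = y\<close> by simp
qed simp

section \<open>Reduction by an autoreduced set\<close>

definition dops :: "nat \<Rightarrow> (nat \<Rightarrow> 'a::comm_ring_1 \<Rightarrow> 'a) \<Rightarrow> ('a dpoly \<Rightarrow> 'a dpoly) set" where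
  "dops m \<delta> = {dderiv \<delta> j |j. j < m}"

lemma prime_dideal_prime_of: "prime_dideal m \<delta> n P \<longleftrightarrow> prime_of (polys (dvars m n)) (dops m \<delta>) P"
proof -
  have d: "(\<forall>d\<in>dops m \<delta>. \<forall>x\<in>P. d x \<in> P) \<longleftrightarrow> (\<forall>p\<in>P. \<forall>j<m. dderiv \<delta> j p \<in> P)"
    by (auto simp: dops_def)
  have c: "(\<forall>a\<in>A. \<forall>x\<in>P. a * x \<in> P) \<longleftrightarrow> (\<forall>x\<in>P. \<forall>a\<in>A. a * x \<in> P)" for A :: "'a dpoly set"
    by blast
  show ?thesis
    unfolding prime_dideal_def prime_of_def ideal_of_def dpolys_eq d c
    by (rule iffI; elim conjE; intro conjI; assumption)
qed

lemma diffring_dops: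
  fixes \<delta> :: "nat \<Rightarrow> 'a::field_char_0 \<Rightarrow> 'a"
  assumes "\<forall>j<m. is_derivation (\<delta> j)" "\<And>v j. v \<in> Y \<Longrightarrow> j < m \<Longrightarrow> dv j v \<in> Y"
  shows "diffring (polys Y) (dops m \<delta>)"
proof (rule diffring_polys)
  fix d :: "'a dpoly \<Rightarrow> 'a dpoly"
  assume "d \<in> dops m \<delta>"
  then obtain j where "j < m" "d = dderiv \<delta> j" by (auto simp: dops_def)
  then show "\<exists>d0 w. is_derivation d0 \<and> d = der d0 w \<and> (\<forall>v\<in>Y. w v \<in> polys Y)"
    using assms by (intro exI[of _ "\<delta> j"] exI[of _ "\<lambda>v. Xv (dv j v)"]) (auto simp: dderiv_der)
qed

text \<open>Stands for products of initials and separants. As divisors of powers of \<open>H\<close>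
  they are nonzero wherever \<open>H\<close> is (\<open>hdiv_deval\<close>) and lie outside every
  prime that misses \<open>H\<close> (\<open>hdiv_notin\<close>).\<close>

definition hdiv :: "(dvar \<Rightarrow> dvar \<Rightarrow> bool) \<Rightarrow> ('a::comm_ring_1) dpoly set \<Rightarrow> dvar set \<Rightarrow> 'a dpoly set" where
  "hdiv lt A W = {h \<in> polys W. \<exists>k. \<exists>h'\<in>polys W. h * h' = H lt A ^ k}"

lemma hdiv_1: "1 \<in> hdiv lt A W"
  by (auto simp: hdiv_def intro!: exI[of _ 0])

lemma hdiv_mult: "h \<in> hdiv lt A W \<Longrightarrow> g \<in> hdiv lt A W \<Longrightarrow> h * g \<in> hdiv lt A W"
proof -
  assume "h \<in> hdiv lt A W" "g \<in> hdiv lt A W"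
  then obtain k h' l g' where *: "h \<in> polys W" "g \<in> polys W" "h' \<in> polys W" "g' \<in> polys W"
    "h * h' = H lt A ^ k" "g * g' = H lt A ^ l" by (auto simp: hdiv_def)
  have "(h * g) * (h' * g') = (h * h') * (g * g')" by (simp add: algebra_simps)
  also have "\<dots> = H lt A ^ (k + l)" using * by (simp add: power_add)
  finally show ?thesis using * by (auto simp: hdiv_def)
qed

lemma hdiv_mono: "h \<in> hdiv lt A V \<Longrightarrow> V \<subseteq> W \<Longrightarrow> h \<in> hdiv lt A W"
  unfolding hdiv_def using polys_mono by blast

lemma hdiv_power: "h \<in> hdiv lt A W \<Longrightarrow> h ^ k \<in> hdiv lt A W"
  by (induction k) (auto intro: hdiv_1 hdiv_mult)

lemma hdiv_polys: "h \<in> hdiv lt A W \<Longrightarrow> h \<in> polys W"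
  by (simp add: hdiv_def)

lemma initial_U: "initial lt p = coeff (U (leader lt p) p) (vdeg (leader lt p) p)"
  by (simp add: initial_def vcoeff_U)

lemma vars_coeff_U: "vars (coeff (U v p) k) \<subseteq> vars p - {v}"
  using coeff_U_polys[of p "vars p" v k] by (simp add: polys_def)

lemma vars_pdiff: "vars (pdiff v p) \<subseteq> vars p"
  using pdiff_polys[of p "vars p" v] by (simp add: polys_def)

lemma initial_separant_hdiv:
  assumes "finite A" "\<And>f. f \<in> A \<Longrightarrow> vars f \<subseteq> W" "f \<in> A"
  shows "initial lt f \<in> hdiv lt A W" "separant lt f \<in> hdiv lt A W"
proof -
  define r where "r = (\<Prod>f\<in>A - {f}. separant lt f * initial lt f)"
  have i: "initial lt f \<in> polys W" "separant lt f \<in> polys W" if "f \<in> A" for f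
    using assms(2)[OF that] vars_coeff_U vars_pdiff unfolding initial_U separant_def polys_def by blast+
  have "r \<in> polys W" unfolding r_def using i by (auto intro!: polys_prod polys_mult)
  moreover have "H lt A = separant lt f * initial lt f * r"
    unfolding H_def r_def by (rule prod.remove) (use assms in auto)
  ultimately have "initial lt f * (separant lt f * r) = H lt A ^ 1" "separant lt f * (initial lt f * r) = H lt A ^ 1"
    "initial lt f * r \<in> polys W" "separant lt f * r \<in> polys W"
    using i[OF assms(3)] by (auto simp: algebra_simps)
  then show "initial lt f \<in> hdiv lt A W" "separant lt f \<in> hdiv lt A W"
    using i[OF assms(3)] unfolding hdiv_def by blast+
qed

lemma H_polys:
  assumes "finite A" "\<And>f. f \<in> A \<Longrightarrow> vars f \<subseteq> W"
  shows "H lt A \<in> polys W"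
  unfolding H_def using initial_separant_hdiv[OF assms] hdiv_polys by (intro polys_prod polys_mult) blast+

lemma
  assumes "is_ranking m n lt"
  shows ranking_irrefl: "u \<in> dvars m n \<Longrightarrow> \<not> lt u u"
    and ranking_trans: "u \<in> dvars m n \<Longrightarrow> v \<in> dvars m n \<Longrightarrow> w \<in> dvars m n \<Longrightarrow> lt u v \<Longrightarrow> lt v w \<Longrightarrow> lt u w"
    and ranking_total: "u \<in> dvars m n \<Longrightarrow> v \<in> dvars m n \<Longrightarrow> u \<noteq> v \<Longrightarrow> lt u v \<or> lt v u"
    and ranking_asym: "u \<in> dvars m n \<Longrightarrow> v \<in> dvars m n \<Longrightarrow> lt u v \<Longrightarrow> \<not> lt v u"
    and ranking_dv: "u \<in> dvars m n \<Longrightarrow> j < m \<Longrightarrow> lt u (dv j u)"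
    and ranking_dv_mono: "u \<in> dvars m n \<Longrightarrow> v \<in> dvars m n \<Longrightarrow> lt u v \<Longrightarrow> j < m \<Longrightarrow> lt (dv j u) (dv j v)"
  using assms unfolding is_ranking_def by blast+

context
  fixes m n :: nat and lt :: "dvar \<Rightarrow> dvar \<Rightarrow> bool"
  assumes rk: "is_ranking m n lt"
begin

private lemmas irrefl = ranking_irrefl[OF rk] and trans = ranking_trans[OF rk] and total = ranking_total[OF rk]
  and asym = ranking_asym[OF rk] and lt_dv = ranking_dv[OF rk] and dv_mono = ranking_dv_mono[OF rk]

lemma dle_lt:
  assumes "u \<in> dvars m n" "v \<in> dvars m n" "dle u v"
  shows "v = u \<or> lt u v"
  using assms
proof (induction v rule: dle_induct)
  case (dv w j)
  then show ?case using lt_dv[OF dv(1,3)] trans[OF assms(1) dv(1) dv_dvars[OF dv(1,3)]] by auto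
qed simp

text \<open>By Dickson's lemma an infinite descending sequence would contain a term that is a
  derivative of an earlier one, hence not below it.\<close>

lemma ranking_wf: "wf {(u, v). u \<in> dvars m n \<and> v \<in> dvars m n \<and> lt u v}"
  unfolding wf_iff_no_infinite_down_chain
proof
  assume "\<exists>f. \<forall>i. (f (Suc i), f i) \<in> {(u, v). u \<in> dvars m n \<and> v \<in> dvars m n \<and> lt u v}"
  then obtain f where f: "\<And>i. f i \<in> dvars m n" "\<And>i. lt (f (Suc i)) (f i)" by auto
  have less: "lt (f j) (f i)" if "i < j" for i j
    using that
  proof (induction j)
    case (Suc j)
    then show ?case using f(2)[of j] trans[OF f(1) f(1) f(1)] by (cases "i = j") auto
  qed simp
  obtain i j where "i < j" "dle (f i) (f j)" using dvars_dickson[of f, OF f(1)] .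
  then have "f j = f i \<or> lt (f i) (f j)" using dle_lt f(1) by blast
  then show False using less[OF \<open>i < j\<close>] irrefl asym f(1) by metis
qed

lemma leader_in:
  assumes "p \<in> polys (dvars m n)" "vars p \<noteq> {}"
  shows "leader lt p \<in> vars p" "\<And>v. v \<in> vars p \<Longrightarrow> v \<noteq> leader lt p \<Longrightarrow> lt v (leader lt p)"
proof -
  have sub: "vars p \<subseteq> dvars m n" using assms(1) by (simp add: polys_def)
  have "\<exists>u\<in>vars p. \<forall>v\<in>vars p. v \<noteq> u \<longrightarrow> lt v u"
  proof (rule finite_has_max[OF finite_vars assms(2), of lt])
    show "lt a c" if "a \<in> vars p" "b \<in> vars p" "c \<in> vars p" "lt a b" "lt b c" for a b c
      using trans[of a b c] that sub by auto
    show "lt a b \<or> lt b a" if "a \<in> vars p" "b \<in> vars p" "a \<noteq> b" for a b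
      using total[of a b] that sub by auto
  qed
  then obtain u where u: "u \<in> vars p" "\<And>v. v \<in> vars p \<Longrightarrow> v \<noteq> u \<Longrightarrow> lt v u" by blast
  have "leader lt p = u"
    unfolding leader_def
  proof (rule the_equality)
    fix w assume w: "w \<in> vars p \<and> (\<forall>v\<in>vars p. v \<noteq> w \<longrightarrow> lt v w)"
    show "w = u"
    proof (rule ccontr)
      assume ne: "w \<noteq> u"
      have "lt w u" "lt u w" using u w ne by auto
      then show False using asym[of w u] u(1) w sub by auto
    qed
  qed (use u in simp)
  then show "leader lt p \<in> vars p" "\<And>v. v \<in> vars p \<Longrightarrow> v \<noteq> leader lt p \<Longrightarrow> lt v (leader lt p)"
    using u by auto
qed

lemma leader_dvars: "p \<in> polys (dvars m n) \<Longrightarrow> vars p \<noteq> {} \<Longrightarrow> leader lt p \<in> dvars m n"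
  using leader_in(1)[of p] by (auto simp: polys_def)

text \<open>The first derivation of \<open>f\<close> produces the derived leader linearly with the
  separant as coefficient (\<open>der_split\<close>); further derivations keep that coefficient and
  add only terms of lower rank.\<close>

lemma derivative_of_leader:
  assumes f: "f \<in> polys (dvars m n)" "vars f \<noteq> {}" "f \<in> N" "vars f \<subseteq> W"
    and N: "ideal_of (polys (dvars m n)) (dops m \<delta>) N" and d: "\<forall>j<m. is_derivation (\<delta> j)"
    and W: "W \<subseteq> dvars m n" "\<And>w j. w \<in> W \<Longrightarrow> j < m \<Longrightarrow> dv j w \<in> W"
    and v: "v \<in> dvars m n" "proper_derivative v (leader lt f)"
  shows "v \<in> W" "\<exists>e\<in>polys {w \<in> W. lt w v}. separant lt f * Xv v + e \<in> N" "lt (leader lt f) v"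
proof -
  define u where "u = leader lt f"
  define s where "s = separant lt f"
  have u: "u \<in> dvars m n" "u \<in> W" unfolding u_def using leader_dvars[OF f(1,2)] leader_in(1)[OF f(1,2)] f(4) by auto
  have fu: "w \<in> dvars m n" "w = u \<or> lt w u" if "w \<in> vars f" for w
    using f(1) that leader_in(2)[OF f(1,2) that] by (auto simp: polys_def u_def)
  have su: "s \<in> polys (vars f)" unfolding s_def separant_def by (intro pdiff_polys) simp
  have dN: "dderiv \<delta> j x \<in> N" if "x \<in> N" "j < m" for x j
    using N that by (auto simp: ideal_of_def dops_def)
  have uv: "dle u v" using v(2) by (simp add: proper_derivative_dle u_def)
  have "v \<in> W \<and> (v \<noteq> u \<longrightarrow> (\<exists>e\<in>polys {w \<in> W. lt w v}. s * Xv v + e \<in> N))"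
    using u(1) v(1) uv
  proof (induction v rule: dle_induct)
    show "u \<in> W \<and> (u \<noteq> u \<longrightarrow> (\<exists>e\<in>polys {w \<in> W. lt w u}. s * Xv u + e \<in> N))" using u by simp
    fix w j assume w: "w \<in> dvars m n" "dle u w" "j < m"
      and IH: "w \<in> W \<and> (w \<noteq> u \<longrightarrow> (\<exists>e\<in>polys {x \<in> W. lt x w}. s * Xv w + e \<in> N))"
    let ?v = "dv j w" and ?w = "\<lambda>x. Xv (dv j x) :: 'a dpoly"
    let ?V = "{x \<in> W. lt x ?v}"
    have dj: "is_derivation (\<delta> j)" using d w(3) by simp
    have wv: "lt w ?v" using lt_dv w by blast
    have ltv: "x \<in> ?V \<and> dv j x \<in> ?V" if "x \<in> W" "lt x w" for x
    proof -
      have "x \<in> dvars m n" using that W by auto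
      then show ?thesis using that W(2)[OF that(1) w(3)] dv_mono[of x w j] trans[of x w ?v] w wv by auto
    qed
    have uw: "u = w \<or> lt u w" using dle_lt[OF u(1) w(1,2)] by auto
    have "\<exists>e\<in>polys ?V. s * Xv ?v + e \<in> N"
    proof (cases "w = u")
      case True
      have "dderiv \<delta> j f = der (\<delta> j) (?w(u := 0)) f + s * Xv ?v"
        using der_split[OF dj, of ?w f u] True by (simp add: dderiv_der s_def separant_def u_def)
      moreover have "der (\<delta> j) (?w(u := 0)) f \<in> polys ?V"
      proof (rule der_polys[OF dj, of f "vars f"])
        show "vars f \<subseteq> ?V"
        proof
          fix x assume x: "x \<in> vars f"
          then show "x \<in> ?V" using fu[OF x] f(4) wv True ltv[of x] by auto
        qed
        show "(?w(u := 0)) x \<in> polys ?V" if x: "x \<in> vars f" for x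
          using fu[OF x] f(4) True ltv[of x] x by auto
      qed simp
      ultimately show ?thesis using dN[OF f(3) w(3)] by (intro bexI) (auto simp: add.commute)
    next
      case False
      then obtain e where e: "e \<in> polys {x \<in> W. lt x w}" "s * Xv w + e \<in> N" using IH by blast
      have "lt u w" using uw False by simp
      have sV: "s \<in> polys {x \<in> W. lt x w}"
      proof (rule polys_mono[OF su], rule subsetI)
        fix x assume x: "x \<in> vars f"
        then show "x \<in> {x \<in> W. lt x w}" using fu[OF x] f(4) \<open>lt u w\<close> trans[of x u w] u w by auto
      qed
      have dV: "dderiv \<delta> j p \<in> polys ?V" if "p \<in> polys {x \<in> W. lt x w}" for p
        unfolding dderiv_der by (rule der_polys[OF dj that]) (use ltv in auto)
      have "dderiv \<delta> j (s * Xv w + e) = s * Xv ?v + (dderiv \<delta> j s * Xv w + dderiv \<delta> j e)"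
        by (simp add: dderiv_der der_add[OF dj] der_mult[OF dj] der_Xv[OF dj])
      moreover have "dderiv \<delta> j s * Xv w + dderiv \<delta> j e \<in> polys ?V"
        using dV[OF sV] dV[OF e(1)] IH wv by (intro polys_add polys_mult) auto
      ultimately show ?thesis using dN[OF e(2) w(3)] by (intro bexI) auto
    qed
    then show "?v \<in> W \<and> (?v \<noteq> u \<longrightarrow> (\<exists>e\<in>polys ?V. s * Xv ?v + e \<in> N))"
      using W(2) IH w(3) by blast
  qed
  moreover have "v \<noteq> u" "dle u v" using v(2) by (auto simp: proper_derivative_dle u_def)
  ultimately show "v \<in> W" "\<exists>e\<in>polys {w \<in> W. lt w v}. separant lt f * Xv v + e \<in> N" "lt (leader lt f) v"
    using dle_lt[OF u(1) v(1)] by (auto simp: s_def u_def)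
qed

text \<open>Ritt's reduction: the highest derivative at which \<open>p\<close> fails to be reduced
  is removed by a pseudo-division that creates only lower failures, and \<open>ranking_wf\<close>
  ends the process. The clause on \<open>W\<close> is for \<open>differential_projection\<close>,
  where a reduction among the x must leave the degrees in the y under control.\<close>

lemma reduction:
  fixes A N :: "'a::field_char_0 dpoly set"
  assumes A: "finite A" "A \<subseteq> polys (dvars m n)" "\<And>f. f \<in> A \<Longrightarrow> vars f \<noteq> {}" "A \<subseteq> N"
    and N: "ideal_of (polys (dvars m n)) (dops m \<delta>) N" and d: "\<forall>j<m. is_derivation (\<delta> j)"
    and W: "W \<subseteq> dvars m n" "\<And>w j. w \<in> W \<Longrightarrow> j < m \<Longrightarrow> dv j w \<in> W" "\<And>f. f \<in> A \<Longrightarrow> vars f \<subseteq> W"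
    and p: "p \<in> polys (dvars m n)"
  shows "\<exists>h r. h \<in> hdiv lt A (\<Union>f\<in>A. vars f) \<and> r \<in> polys (dvars m n) \<and> (\<forall>f\<in>A. reduced lt r f) \<and> h * p - r \<in> N \<and>
    (\<forall>w. w \<notin> W \<longrightarrow> vdeg w r \<le> vdeg w p)"
proof -
  let ?Y = "dvars m n"
  let ?V = "\<Union>f\<in>A. vars f"
  have VY: "?V \<subseteq> ?Y" "\<And>f. f \<in> A \<Longrightarrow> vars f \<subseteq> ?V" using A(2) by (auto simp: polys_def)
  note sub = subring_polys[of ?Y]
  define bad where "bad p = {v \<in> vars p. \<exists>f\<in>A. proper_derivative v (leader lt f) \<or>
      v = leader lt f \<and> vdeg v f \<le> vdeg v p}" for p :: "'a dpoly"
  define R where "R p h r \<longleftrightarrow> h \<in> hdiv lt A ?V \<and> r \<in> polys ?Y \<and> h * p - r \<in> N \<and>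
      (\<forall>w. w \<notin> W \<longrightarrow> vdeg w r \<le> vdeg w p)" for p h r :: "'a dpoly"
  have Rtrans: "R p (h' * h) r'" if "R p h r" "R r h' r'" for p h r h' r'
  proof -
    have "h' \<in> hdiv lt A ?V" using that(2) by (simp add: R_def)
    from polys_mono[OF hdiv_polys[OF this] VY(1)] have "h' \<in> polys ?Y" .
    then have "h' * (h * p - r) \<in> N" using ideal_mult[OF sub N] that by (auto simp: R_def)
    then have "h' * (h * p - r) + (h' * r - r') \<in> N" using ideal_add[OF sub N] that by (auto simp: R_def)
    then have "(h' * h) * p - r' \<in> N" by (simp add: algebra_simps)
    moreover have "vdeg w r' \<le> vdeg w p" if "w \<notin> W" for w
      using \<open>R p h r\<close> \<open>R r h' r'\<close> that unfolding R_def by (meson order_trans)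
    ultimately show ?thesis using that hdiv_mult unfolding R_def by blast
  qed
  have lf: "leader lt f \<in> vars f" "leader lt f \<in> ?Y" "0 < vdeg (leader lt f) f" if "f \<in> A" for f
    using leader_in(1)[of f] leader_dvars[of f] A that vdeg_0_iff[of "leader lt f" f] by auto
  have red: "\<forall>f\<in>A. reduced lt p f" if "bad p = {}" for p
    unfolding reduced_def
  proof (intro ballI conjI)
    fix f assume f: "f \<in> A"
    show "\<not> proper_derivative v (leader lt f)" if "v \<in> vars p" for v
      using that f \<open>bad p = {}\<close> unfolding bad_def by blast
    show "vdeg (leader lt f) p < vdeg (leader lt f) f"
    proof (cases "leader lt f \<in> vars p")
      case True
      then have "leader lt f \<notin> bad p" using that by simp
      then show ?thesis using f True by (auto simp: bad_def)
    qed (use lf[OF f] vdeg_0_iff[of "leader lt f" p] in simp)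
  qed
  have step: "\<exists>h r. R p h r \<and> (\<forall>w\<in>bad r. lt w v)"
    if p: "p \<in> polys ?Y" and v: "v \<in> bad p" and max: "\<And>w. w \<in> bad p \<Longrightarrow> w \<noteq> v \<Longrightarrow> lt w v" for p v
  proof -
    have vY: "v \<in> ?Y" using p v by (auto simp: bad_def polys_def)
    \<comment> \<open>If \<open>v\<close> is a proper derivative of a leader, the divisor is a
      derivative of that element of \<open>A\<close>, linear in \<open>v\<close>. Otherwise it is an
      element with leader \<open>v\<close> of least degree, so that a remainder of smaller degree
      satisfies the bounds of all elements with this leader.\<close>
    have "\<exists>g l. g \<in> N \<and> g \<in> polys {w \<in> W. w = v \<or> lt w v} \<and> l = coeff (U v g) (vdeg v g) \<and> 0 < vdeg v g \<and>
        l \<in> hdiv lt A ?V \<and> (\<forall>r. vdeg v r < vdeg v g \<longrightarrow> v \<notin> bad r)"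
    proof (cases "\<exists>f\<in>A. proper_derivative v (leader lt f)")
      case True
      then obtain f where f: "f \<in> A" "proper_derivative v (leader lt f)" by blast
      have fY: "f \<in> polys ?Y" "vars f \<noteq> {}" "f \<in> N" "vars f \<subseteq> W" using A W(3) f by auto
      note dl = derivative_of_leader[OF fY N d W(1,2) vY f(2)]
      then obtain e where e: "e \<in> polys {w \<in> W. lt w v}" "separant lt f * Xv v + e \<in> N" by blast
      have sv: "separant lt f \<in> polys {w \<in> W. lt w v}"
      proof -
        have "vars f \<subseteq> {w \<in> W. lt w v}"
        proof
          fix w assume w: "w \<in> vars f"
          then have "w = leader lt f \<or> lt w (leader lt f)" "w \<in> ?Y"
            using leader_in(2)[OF fY(1,2) w] fY(1) w by (auto simp: polys_def)
          then show "w \<in> {w \<in> W. lt w v}"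
            using dl(3) trans[of w "leader lt f" v] lf[OF f(1)] vY w fY(4) by auto
        qed
        then show ?thesis using vars_pdiff[of "leader lt f" f] unfolding polys_def separant_def by blast
      qed
      let ?g = "separant lt f * Xv v + e"
      have nv: "v \<notin> {w \<in> W. lt w v}" using irrefl[OF vY] by simp
      have "separant lt f \<noteq> 0"
      proof -
        define k where "k = vdeg (leader lt f) f - 1"
        have "coeff (U (leader lt f) (separant lt f)) k = of_nat (Suc k) * lead_coeff (U (leader lt f) f)"
          using lf(3)[OF f(1)] by (simp add: separant_def coeff_U_pdiff k_def vdeg_U)
        moreover have "lead_coeff (U (leader lt f) f) \<noteq> 0"
          using lf(3)[OF f(1)] by (auto simp: vdeg_U)
        moreover have "(of_nat (Suc k) :: 'a dpoly) \<noteq> 0" using of_nat_eq_0_iff[where 'a='a]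
          by (metis cst_eq_0 cst_of_nat nat.simps(3))
        ultimately show ?thesis using dpoly_mult_eq_0 by (metis U_0 coeff_0)
      qed
      then have Ug: "U v ?g = [:e, separant lt f:]" "degree (U v ?g) = 1"
        using U_const[OF e(1) nv] U_const[OF sv nv] by (simp_all add: U_add U_mult U_Xv)
      have "?g \<in> polys {w \<in> W. w = v \<or> lt w v}"
        by (intro polys_add polys_mult polys_mono[OF sv] polys_mono[OF e(1)]) (use dl(1) in auto)
      moreover have "separant lt f \<in> hdiv lt A ?V" using initial_separant_hdiv[OF A(1) VY(2) f(1)] by blast
      moreover have "v \<notin> bad r" if "vdeg v r < vdeg v ?g" for r
        using that vdeg_0_iff[of v r] Ug(2) by (auto simp: bad_def vdeg_U[of v ?g])
      moreover have "separant lt f = coeff (U v ?g) (vdeg v ?g)" "0 < vdeg v ?g"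
        unfolding vdeg_U Ug(2) unfolding Ug(1) by simp_all
      ultimately show ?thesis using e(2) by blast
    next
      case False
      then have "\<exists>f. f \<in> A \<and> v = leader lt f" using v by (auto simp: bad_def)
      then obtain f where f: "f \<in> A" "v = leader lt f" "\<And>g. g \<in> A \<Longrightarrow> v = leader lt g \<Longrightarrow> vdeg v f \<le> vdeg v g"
        using ex_has_least_nat[of "\<lambda>f. f \<in> A \<and> v = leader lt f" _ "vdeg v"] by metis
      have fY: "f \<in> polys ?Y" "vars f \<noteq> {}" using A f(1) by auto
      have "w = v \<or> lt w v" if "w \<in> vars f" for w using leader_in(2)[OF fY that] f(2) by auto
      then have "f \<in> polys {w \<in> W. w = v \<or> lt w v}"
        using W(3)[OF f(1)] unfolding polys_def by blast
      moreover have "coeff (U v f) (vdeg v f) \<in> hdiv lt A ?V"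
        using initial_separant_hdiv[OF A(1) VY(2) f(1)] by (simp add: initial_U f(2))
      moreover have "v \<notin> bad r" if "vdeg v r < vdeg v f" for r
        using that False f(3) by (fastforce simp: bad_def)
      moreover have "0 < vdeg v f" "f \<in> N" using lf(3)[OF f(1)] f(1,2) A(4) by auto
      ultimately show ?thesis by blast
    qed
    then obtain g l where g: "g \<in> N" "g \<in> polys {w \<in> W. w = v \<or> lt w v}" "l = coeff (U v g) (vdeg v g)"
      "0 < vdeg v g" "l \<in> hdiv lt A ?V" "\<And>r. vdeg v r < vdeg v g \<Longrightarrow> v \<notin> bad r" by blast
    have gY: "g \<in> polys ?Y" using g(2) W(1) by (auto intro: polys_mono)
    obtain k c r where r: "l ^ k * p = c * g + r" "vdeg v r < vdeg v g" "c \<in> polys ?Y" "r \<in> polys ?Y"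
      "\<And>w. w \<notin> vars g \<Longrightarrow> vdeg w r \<le> vdeg w p"
      using pseudo_division[OF g(4) p gY] unfolding g(3) by blast
    have "l ^ k * p - r \<in> N" using r(1,3) g(1) ideal_mult[OF sub N] by simp
    moreover have "l ^ k \<in> hdiv lt A ?V" using g(5) by (rule hdiv_power)
    moreover have "vars g \<subseteq> W" using g(2) by (auto simp: polys_def)
    ultimately have "R p (l ^ k) r" using r by (auto simp: R_def)
    moreover have "lt w v" if w: "w \<in> bad r" for w
    proof (rule ccontr)
      assume n: "\<not> lt w v"
      have "w \<noteq> v" using w g(6)[OF r(2)] by auto
      then have "w \<notin> vars g" using n g(2) by (auto simp: polys_def)
      then have le: "vdeg w r \<le> vdeg w p" by (rule r(5))
      then have "w \<in> vars p" using w vdeg_0_iff[of w r] vdeg_0_iff[of w p] by (auto simp: bad_def)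
      then have "w \<in> bad p" using w le by (auto simp: bad_def)
      then show False using max \<open>w \<noteq> v\<close> n by blast
    qed
    ultimately show ?thesis by blast
  qed
  have bmax: "bad p = {} \<or> (\<exists>v\<in>bad p. v \<in> ?Y \<and> (\<forall>w\<in>bad p. w \<noteq> v \<longrightarrow> lt w v))" if "p \<in> polys ?Y" for p
  proof (cases "bad p = {}")
    case False
    have bY: "bad p \<subseteq> ?Y" "finite (bad p)" using that finite_subset[of "bad p" "vars p"]
      by (auto simp: bad_def polys_def)
    have "\<exists>v\<in>bad p. \<forall>w\<in>bad p. w \<noteq> v \<longrightarrow> lt w v"
    proof (rule finite_has_max[OF bY(2) False, of lt])
      show "lt a c" if "a \<in> bad p" "b \<in> bad p" "c \<in> bad p" "lt a b" "lt b c" for a b c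
        using trans[of a b c] that bY by auto
      show "lt a b \<or> lt b a" if "a \<in> bad p" "b \<in> bad p" "a \<noteq> b" for a b
        using total[of a b] that bY by auto
    qed
    then show ?thesis using bY by blast
  qed simp
  have ind: "\<exists>h r. R p h r \<and> bad r = {}" if "v \<in> ?Y" "p \<in> polys ?Y" "v \<in> bad p" "\<And>w. w \<in> bad p \<Longrightarrow> w \<noteq> v \<Longrightarrow> lt w v" for v p
    using that
  proof (induction v arbitrary: p rule: wf_induct_rule[OF ranking_wf])
    case (1 v)
    obtain h r where r: "R p h r" "\<forall>w\<in>bad r. lt w v" using step[OF 1(3,4,5)] by blast
    have rY: "r \<in> polys ?Y" using r(1) by (simp add: R_def)
    from bmax[OF rY] show ?case
    proof
      assume "\<exists>v\<in>bad r. v \<in> ?Y \<and> (\<forall>w\<in>bad r. w \<noteq> v \<longrightarrow> lt w v)"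
      then obtain u where u: "u \<in> bad r" "u \<in> ?Y" "\<And>w. w \<in> bad r \<Longrightarrow> w \<noteq> u \<Longrightarrow> lt w u" by blast
      then obtain h' r' where "R r h' r'" "bad r' = {}" using 1(1)[OF _ u(2) rY u(1,3)] r(2) 1(2) by blast
      then show ?thesis using Rtrans[OF r(1)] by blast
    qed (use r in blast)
  qed
  have "\<exists>h r. R p h r \<and> bad r = {}"
    using bmax[OF p]
  proof
    assume "bad p = {}"
    moreover have "R p 1 p" using p hdiv_1 ideal_0[OF sub N] by (simp add: R_def)
    ultimately show ?thesis by blast
  qed (use ind p in blast)
  then show ?thesis using red unfolding R_def by blast
qed

end


section \<open>Characteristic sets\<close>

lemma reduced_rank_cong: "rank_eq lt f f' \<Longrightarrow> reduced lt g f \<longleftrightarrow> reduced lt g f'"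
  unfolding reduced_def rank_eq_def by metis

lemma vdeg_pdiff_le: "vdeg w (pdiff v p) \<le> vdeg w p"
  unfolding vdeg_le_iff
proof
  fix \<nu> assume "\<nu> \<in> ks (pdiff v p)"
  then obtain \<mu> where "\<mu> \<in> ks p" "\<nu> = \<mu> - Poly_Mapping.single v 1"
    unfolding pdiff_def using keys_sum[of _ "ks p"] by (fastforce split: if_splits)
  moreover have "lk \<mu> w \<le> vdeg w p" if "\<mu> \<in> ks p" for \<mu> using vdeg_le_iff[of w p "vdeg w p"] that by blast
  ultimately show "lk \<nu> w \<le> vdeg w p" by (fastforce simp: lookup_minus)
qed

lemma prime_const:
  fixes P :: "'a::field dpoly set"
  assumes "prime_of (polys Y) E P" "p \<in> P" "vars p = {}"
  shows "p = 0"
proof (rule ccontr)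
  assume "p \<noteq> 0"
  then obtain c where c: "p = cst c" "c \<noteq> 0" using vars_empty[OF assms(3)] by auto
  then have "cst (inverse c) * p = 1" by (simp flip: cst_mult)
  then show False using ideal_mult[OF subring_polys prime_ideal[OF assms(1)], of "cst (inverse c)" p] assms(1,2)
    by (auto simp: prime_of_def)
qed

lemma hdiv_notin:
  assumes P: "prime_of (polys W) E P" and "H lt A \<in> polys W - P" "h \<in> hdiv lt A W"
  shows "h \<in> polys W - P"
proof -
  obtain k h' where h: "h \<in> polys W" "h' \<in> polys W" "h * h' = H lt A ^ k" using assms(3) by (auto simp: hdiv_def)
  have "H lt A ^ k \<notin> P" using prime_power[OF P subring_polys] assms(2) by blast
  then show ?thesis using h ideal_mult2[OF subring_polys prime_ideal[OF P] h(2), of h] by auto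
qed

context
  fixes m n :: nat and lt :: "dvar \<Rightarrow> dvar \<Rightarrow> bool"
  assumes rk: "is_ranking m n lt"
begin

definition nonconst :: "('a::comm_ring_1) dpoly \<Rightarrow> bool" where
  "nonconst p \<longleftrightarrow> p \<in> polys (dvars m n) \<and> vars p \<noteq> {}"

private lemmas rk_irrefl = ranking_irrefl[OF rk] and rk_trans = ranking_trans[OF rk] and rk_total = ranking_total[OF rk]

private lemma ld: "nonconst p \<Longrightarrow> leader lt p \<in> dvars m n"
  and ldv: "nonconst p \<Longrightarrow> leader lt p \<in> vars p"
  and ldmax: "nonconst p \<Longrightarrow> v \<in> vars p \<Longrightarrow> v \<noteq> leader lt p \<Longrightarrow> lt v (leader lt p)"
  using leader_dvars[OF rk] leader_in[OF rk] unfolding nonconst_def by blast+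

lemma rank_lt_trans:
  assumes "nonconst f" "nonconst g" "nonconst h" "rank_lt lt f g" "rank_lt lt g h"
  shows "rank_lt lt f h"
  using rk_trans[OF ld ld ld, OF assms(1-3)] assms(4,5) unfolding rank_lt_def by (metis less_trans)

lemma rank_lt_irrefl: "nonconst f \<Longrightarrow> \<not> rank_lt lt f f"
  using rk_irrefl[OF ld] by (simp add: rank_lt_def)

lemma rank_lt_asym: "nonconst f \<Longrightarrow> nonconst g \<Longrightarrow> rank_lt lt f g \<Longrightarrow> \<not> rank_lt lt g f"
  using rank_lt_trans[of f g f] rank_lt_irrefl[of f] by blast

lemma rank_total: "nonconst f \<Longrightarrow> nonconst g \<Longrightarrow> rank_lt lt f g \<or> rank_eq lt f g \<or> rank_lt lt g f"
  using rk_total[OF ld ld, of f g] unfolding rank_lt_def rank_eq_def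
  by (cases "leader lt f = leader lt g") auto

lemma reduced_of_lower:
  assumes "nonconst f" "nonconst g" "lt (leader lt f) (leader lt g)"
  shows "reduced lt f g"
  unfolding reduced_def
proof (intro conjI ballI)
  have nin: "\<not> lt (leader lt g) v \<and> v \<noteq> leader lt g" if v: "v \<in> vars f" for v
  proof -
    have vY: "v \<in> dvars m n" using v assms(1) by (auto simp: nonconst_def polys_def)
    have "v = leader lt f \<or> lt v (leader lt f)" using ldmax[OF assms(1) v] by blast
    then have "lt v (leader lt g)" using rk_trans[OF vY ld ld, OF assms(1,2)] assms(3) by auto
    then show ?thesis using rk_irrefl[OF vY] rk_trans[OF vY ld vY, OF assms(2)] by auto
  qed
  then have "leader lt g \<notin> vars f" by blast
  then show "vdeg (leader lt g) f < vdeg (leader lt g) g"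
    using ldv[OF assms(2)] vdeg_0_iff[of "leader lt g" f] vdeg_0_iff[of "leader lt g" g] by simp
  fix v assume v: "v \<in> vars f"
  then have vY: "v \<in> dvars m n" using assms(1) by (auto simp: nonconst_def polys_def)
  show "\<not> proper_derivative v (leader lt g)"
    using dle_lt[OF rk ld[OF assms(2)] vY] nin[OF v] by (auto simp: proper_derivative_dle)
qed

lemma reduced_both_leader: "reduced lt f g \<Longrightarrow> reduced lt g f \<Longrightarrow> leader lt f \<noteq> leader lt g"
  by (auto simp: reduced_def)

lemma reduced_rank_lt:
  assumes "nonconst f" "nonconst g" "reduced lt g f" "rank_lt lt f g"
  shows "reduced lt f g"
proof -
  have "leader lt f \<noteq> leader lt g" using assms(3,4) rk_irrefl[OF ld[OF assms(2)]]
    by (auto simp: reduced_def rank_lt_def)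
  then show ?thesis using assms reduced_of_lower unfolding rank_lt_def by blast
qed

lemma autoreduced_sorted:
  assumes "autoreduced lt A" "\<And>f. f \<in> A \<Longrightarrow> nonconst f"
  shows "\<exists>xs. set xs = A \<and> sorted_wrt (rank_lt lt) xs"
proof (rule sorted_list_exists)
  show "finite A" using assms by (simp add: autoreduced_def)
  show "rank_lt lt f h" if "f \<in> A" "g \<in> A" "h \<in> A" "rank_lt lt f g" "rank_lt lt g h" for f g h
    using rank_lt_trans that assms(2) by blast
  show "rank_lt lt f g \<or> rank_lt lt g f" if "f \<in> A" "g \<in> A" "f \<noteq> g" for f g
  proof -
    have "leader lt f \<noteq> leader lt g" using assms(1) that by (intro reduced_both_leader) (auto simp: autoreduced_def)
    then show ?thesis using rank_total[of f g] assms(2) that by (auto simp: rank_eq_def)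
  qed
qed

text \<open>Joining \<open>p\<close> to the elements of \<Lambda> of lower rank gives an autoreduced
  subset of \<open>P\<close> that is lower than \<Lambda>.\<close>

lemma char_set_no_reduced:
  assumes cs: "char_set lt P \<Lambda>" and P: "P \<subseteq> polys (dvars m n)"
    and p: "p \<in> P" "vars p \<noteq> {}" "\<And>f. f \<in> \<Lambda> \<Longrightarrow> reduced lt p f"
  shows False
proof -
  have ar: "autoreduced lt \<Lambda>" "\<Lambda> \<subseteq> P" using cs by (auto simp: char_set_def)
  have nc: "nonconst f" if "f \<in> \<Lambda>" for f using ar P that by (auto simp: nonconst_def autoreduced_def)
  have np: "nonconst p" using p P by (auto simp: nonconst_def)
  obtain Ls where Ls: "set Ls = \<Lambda>" "sorted_wrt (rank_lt lt) Ls"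
    using autoreduced_sorted[OF ar(1) nc] by blast
  let ?Q = "\<lambda>f. rank_lt lt f p"
  \<comment> \<open>Elements ranked above \<open>p\<close> are dropped because they need not be
    reduced with respect to \<open>p\<close>.\<close>
  define T where "T = takeWhile ?Q Ls"
  have T: "f \<in> \<Lambda>" "rank_lt lt f p" if "f \<in> set T" for f
    using that set_takeWhileD[of f ?Q Ls] Ls(1) unfolding T_def by auto
  define B where "B = insert p (set T)"
  have red: "reduced lt f p" if "f \<in> set T" for f
    using reduced_rank_lt[OF nc np p(3) T(2)] T(1) that by blast
  have "autoreduced lt B"
    unfolding autoreduced_def
  proof (intro conjI ballI impI)
    show "finite B" by (simp add: B_def)
    show "vars f \<noteq> {}" if "f \<in> B" for f using that T(1) nc np by (auto simp: B_def nonconst_def)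
    show "reduced lt g f" if "f \<in> B" "g \<in> B" "f \<noteq> g" for f g
      using that T(1) red p(3) ar(1) unfolding B_def autoreduced_def by blast
  qed
  moreover have "B \<subseteq> P" using T(1) ar(2) p(1) by (auto simp: B_def)
  moreover have "ar_lower lt B \<Lambda>"
    unfolding ar_lower_def
  proof (rule exI[of _ "T @ [p]"], rule exI[of _ Ls], intro conjI)
    have "sorted_wrt (rank_lt lt) T" using Ls(2) unfolding T_def by (metis sorted_wrt_append takeWhile_dropWhile_id)
    then show "sorted_wrt (rank_lt lt) (T @ [p])" using T(2) by (auto simp: sorted_wrt_append)
    have Ti: "(T @ [p]) ! i = Ls ! i" if "i < length T" for i
      using that by (simp add: nth_append T_def takeWhile_nth)
    then have eq: "rank_eq lt ((T @ [p]) ! i) (Ls ! i)" if "i < length T" for i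
      using that by (simp add: rank_eq_def)
    show "(\<exists>k<length (T @ [p]). k < length Ls \<and> (\<forall>i<k. rank_eq lt ((T @ [p]) ! i) (Ls ! i)) \<and>
        rank_lt lt ((T @ [p]) ! k) (Ls ! k)) \<or>
        length Ls < length (T @ [p]) \<and> (\<forall>i<length Ls. rank_eq lt ((T @ [p]) ! i) (Ls ! i))"
    proof (cases "length T < length Ls")
      case True
      let ?g = "Ls ! length T"
      have g: "?g \<in> \<Lambda>" using True Ls(1) by auto
      have "\<not> rank_lt lt ?g p" using True unfolding T_def by (rule nth_length_takeWhile)
      moreover have "\<not> rank_eq lt ?g p" using p(3)[OF g] by (auto simp: rank_eq_def reduced_def)
      ultimately have "rank_lt lt p ?g" using rank_total[OF nc[OF g] np] by blast
      then show ?thesis using eq True by (intro disjI1 exI[of _ "length T"]) auto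
    next
      case False
      then show ?thesis using eq by (intro disjI2) auto
    qed
  qed (use Ls in \<open>auto simp: B_def\<close>)
  ultimately show False using cs by (auto simp: char_set_def)
qed

lemma char_set_reduced_0:
  fixes P :: "'a::field_char_0 dpoly set"
  assumes cs: "char_set lt P \<Lambda>" and P: "prime_of (polys (dvars m n)) E P"
    and p: "p \<in> P" "\<And>f. f \<in> \<Lambda> \<Longrightarrow> reduced lt p f"
  shows "p = 0"
proof (rule ccontr)
  assume "p \<noteq> 0"
  then have "vars p \<noteq> {}" using prime_const[OF P p(1)] by blast
  then show False using char_set_no_reduced[OF cs _ p(1) _ p(2)] P by (auto simp: prime_of_def ideal_of_def)
qed

lemma char_set_nonconst:
  assumes "char_set lt P \<Lambda>" "P \<subseteq> polys (dvars m n)" "f \<in> \<Lambda>"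
  shows "nonconst f"
  using assms by (auto simp: char_set_def autoreduced_def nonconst_def)

text \<open>Both are nonzero, have smaller degree than \<open>f\<close> in its leader and no larger
  degree in any other derivative. So they are reduced with respect to \<Lambda>, and as elements of
  \<open>P\<close> they would have to be 0. For the separant, being nonzero uses characteristic
  0.\<close>

lemma separant_initial_notin:
  fixes P :: "'a::field_char_0 dpoly set"
  assumes cs: "char_set lt P \<Lambda>" and P: "prime_of (polys (dvars m n)) E P" and f: "f \<in> \<Lambda>"
  shows "initial lt f \<notin> P" "separant lt f \<notin> P"
proof -
  have PY: "P \<subseteq> polys (dvars m n)" using P by (auto simp: prime_of_def ideal_of_def)
  let ?u = "leader lt f"
  have nf: "nonconst f" by (rule char_set_nonconst[OF cs PY f])
  obtain d where d: "vdeg ?u f = Suc d" using ldv[OF nf] vdeg_0_iff[of ?u f] not0_implies_Suc by metis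
  have red: "reduced lt p g" if g: "g \<in> \<Lambda>" and p: "vars p \<subseteq> vars f" "\<And>w. vdeg w p \<le> vdeg w f" "vdeg ?u p \<le> d" for p g
  proof (cases "g = f")
    case True
    have "\<not> proper_derivative v ?u" if v: "v \<in> vars p" for v
    proof
      assume pd: "proper_derivative v ?u"
      have vf: "v \<in> vars f" "v \<in> dvars m n" using p(1) v nf by (auto simp: nonconst_def polys_def)
      have "v \<noteq> ?u" "lt ?u v" using dle_lt[OF rk ld[OF nf] vf(2)] pd by (auto simp: proper_derivative_dle)
      then show False using ldmax[OF nf vf(1)] rk_trans[OF vf(2) ld[OF nf] vf(2)] rk_irrefl[OF vf(2)] by blast
    qed
    then show ?thesis using True p(3) d by (auto simp: reduced_def)
  next
    case False
    then have "reduced lt f g" using cs f g by (auto simp: char_set_def autoreduced_def)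
    then show ?thesis using p(1,2) unfolding reduced_def by (meson le_less_trans subsetD)
  qed
  have i: "initial lt f = lead_coeff (U ?u f)" by (simp add: initial_U vdeg_U)
  have lc: "lead_coeff (U ?u f) \<noteq> 0" using d unfolding vdeg_U by (metis degree_0 leading_coeff_0_iff nat.distinct(1))
  show "initial lt f \<notin> P"
  proof
    assume "initial lt f \<in> P"
    moreover have "reduced lt (initial lt f) g" if "g \<in> \<Lambda>" for g
    proof (rule red[OF that])
      have "?u \<notin> vars (initial lt f)" using vars_coeff_U unfolding initial_U by blast
      then show "vdeg ?u (initial lt f) \<le> d" using vdeg_0_iff[of ?u "initial lt f"] by simp
    qed (use vars_coeff_U vdeg_coeff_U_le in \<open>unfold initial_U, blast+\<close>)
    ultimately have "initial lt f = 0" by (rule char_set_reduced_0[OF cs P])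
    then show False using lc i by simp
  qed
  show "separant lt f \<notin> P"
  proof
    assume "separant lt f \<in> P"
    moreover have "reduced lt (separant lt f) g" if "g \<in> \<Lambda>" for g
    proof (rule red[OF that])
      show "vdeg ?u (separant lt f) \<le> d"
        unfolding vdeg_U separant_def
        by (rule degree_le) (use d in \<open>auto simp: coeff_U_pdiff coeff_eq_0 vdeg_U\<close>)
    qed (simp_all add: separant_def vars_pdiff vdeg_pdiff_le)
    ultimately have "separant lt f = 0" by (rule char_set_reduced_0[OF cs P])
    moreover have "coeff (U ?u (separant lt f)) d = of_nat (Suc d) * lead_coeff (U ?u f)"
      using d by (simp add: separant_def coeff_U_pdiff vdeg_U)
    ultimately have "(of_nat (Suc d) :: 'a dpoly) = 0 \<or> lead_coeff (U ?u f) = 0"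
      using dpoly_mult_eq_0[of "of_nat (Suc d)" "lead_coeff (U ?u f)"] by simp
    moreover have "(of_nat (Suc d) :: 'a dpoly) \<noteq> 0"
      using cst_eq_0[of "of_nat (Suc d) :: 'a"] by (simp only: cst_of_nat of_nat_eq_0_iff)
    ultimately show False using lc by simp
  qed
qed

lemma H_notin:
  fixes P :: "'a::field_char_0 dpoly set"
  assumes cs: "char_set lt P \<Lambda>" and P: "prime_of (polys (dvars m n)) E P" and A: "A \<subseteq> \<Lambda>"
  shows "H lt A \<in> polys (dvars m n) - P"
  unfolding H_def
proof (rule prime_prod[OF P subring_polys])
  have PY: "P \<subseteq> polys (dvars m n)" using P by (auto simp: prime_of_def ideal_of_def)
  have fin: "finite \<Lambda>" using cs by (simp add: char_set_def autoreduced_def)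
  then show "finite A" using A finite_subset by blast
  fix f assume "f \<in> A"
  then have f: "f \<in> \<Lambda>" using A by blast
  have "vars g \<subseteq> dvars m n" if "g \<in> \<Lambda>" for g
    using char_set_nonconst[OF cs PY that] by (simp add: nonconst_def polys_def)
  from initial_separant_hdiv[OF fin this f]
  have "initial lt f \<in> polys (dvars m n)" "separant lt f \<in> polys (dvars m n)" using hdiv_polys by blast+
  then show "separant lt f * initial lt f \<in> polys (dvars m n) - P"
    using separant_initial_notin[OF cs P f] prime_mult[OF P] by auto
qed

text \<open>\<open>N\<close> may be any differential ideal containing the characteristic set, so \<open>h p\<close> lies in
  the smallest one.\<close>
lemma char_set_generates:
  fixes P N :: "'a::field_char_0 dpoly set"
  assumes cs: "char_set lt P \<Lambda>" and P: "prime_of (polys (dvars m n)) (dops m \<delta>) P" and d: "\<forall>j<m. is_derivation (\<delta> j)"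
    and N: "ideal_of (polys (dvars m n)) (dops m \<delta>) N" "\<Lambda> \<subseteq> N" and p: "p \<in> P"
  shows "\<exists>h\<in>hdiv lt \<Lambda> (dvars m n). h * p \<in> N"
proof -
  let ?Y = "dvars m n"
  have PY: "P \<subseteq> polys ?Y" using P by (auto simp: prime_of_def ideal_of_def)
  have fin: "finite \<Lambda>" "\<Lambda> \<subseteq> P" using cs by (simp_all add: char_set_def autoreduced_def)
  have I: "ideal_of (polys ?Y) (dops m \<delta>) (N \<inter> P)" using N(1) prime_ideal[OF P] unfolding ideal_of_def by blast
  have nc: "f \<in> polys ?Y" "vars f \<noteq> {}" "vars f \<subseteq> ?Y" if "f \<in> \<Lambda>" for f
    using char_set_nonconst[OF cs PY that] by (simp_all add: nonconst_def polys_def)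
  obtain h r where h0: "h \<in> hdiv lt \<Lambda> (\<Union>f\<in>\<Lambda>. vars f)" and h: "r \<in> polys ?Y" "\<forall>f\<in>\<Lambda>. reduced lt r f" "h * p - r \<in> N \<inter> P"
    using reduction[OF rk fin(1) _ _ _ I d order_refl dv_dvars nc(3), of p] nc fin N(2) p PY by blast
  have hY: "h \<in> hdiv lt \<Lambda> ?Y" using hdiv_mono[OF h0] nc(3) by blast
  have "h * p \<in> P" using ideal_mult[OF subring_polys prime_ideal[OF P] hdiv_polys[OF hY] p] .
  then have "r \<in> P" using ideal_cong[OF subring_polys prime_ideal[OF P], of "h * p" r] h(3) by blast
  then have "r = 0" using char_set_reduced_0[OF cs P] h(2) by blast
  then show ?thesis using hY h(3) by auto
qed

text \<open>Greedy construction: pick again and again an element of least rank among those reduced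
  with respect to the earlier picks. Dickson's lemma for the leaders makes it stop.\<close>

lemma char_set_exists:
  fixes P :: "'a::field_char_0 dpoly set"
  assumes PY: "P \<subseteq> polys (dvars m n)"
  shows "\<exists>\<Lambda>. char_set lt P \<Lambda>"
proof -
  define cand where "cand L = {p \<in> P. vars p \<noteq> {} \<and> (\<forall>f\<in>set L. reduced lt p f)}" for L :: "'a dpoly list"
  define pick where "pick L = (SOME p. p \<in> cand L \<and> (\<forall>q\<in>cand L. \<not> rank_lt lt q p))" for L
  have nc: "nonconst p" if "p \<in> cand L" for p L using that PY by (auto simp: cand_def nonconst_def)
  let ?R = "{(u, v). u \<in> dvars m n \<and> v \<in> dvars m n \<and> lt u v} <*lex*> less_than"
  have pick: "pick L \<in> cand L" "\<And>q. q \<in> cand L \<Longrightarrow> \<not> rank_lt lt q (pick L)" if ne: "cand L \<noteq> {}" for L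
  proof -
    have "wf (inv_image ?R (\<lambda>p :: 'a dpoly. (leader lt p, vdeg (leader lt p) p)))"
      using ranking_wf[OF rk] by (intro wf_inv_image wf_lex_prod) auto
    then have "\<exists>p\<in>cand L. \<forall>q. (q, p) \<in> inv_image ?R (\<lambda>p. (leader lt p, vdeg (leader lt p) p)) \<longrightarrow> q \<notin> cand L"
      using ne unfolding wf_eq_minimal by blast
    then obtain p where p: "p \<in> cand L"
      "\<And>q. (q, p) \<in> inv_image ?R (\<lambda>p. (leader lt p, vdeg (leader lt p) p)) \<Longrightarrow> q \<notin> cand L" by blast
    have "\<not> rank_lt lt q p" if q: "q \<in> cand L" for q
      using p(2)[of q] q ld[OF nc[OF q]] ld[OF nc[OF p(1)]] by (auto simp: rank_lt_def)
    then have "\<exists>p. p \<in> cand L \<and> (\<forall>q\<in>cand L. \<not> rank_lt lt q p)" using p(1) by blast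
    then have "pick L \<in> cand L \<and> (\<forall>q\<in>cand L. \<not> rank_lt lt q (pick L))" unfolding pick_def by (rule someI_ex)
    then show "pick L \<in> cand L" "\<And>q. q \<in> cand L \<Longrightarrow> \<not> rank_lt lt q (pick L)" by blast+
  qed
  define G where "G = rec_nat [] (\<lambda>_ L. L @ [pick L])"
  have G: "G 0 = []" "G (Suc k) = G k @ [pick (G k)]" for k by (simp_all add: G_def)
  have len: "length (G k) = k" for k by (induction k) (simp_all add: G)
  have take: "take i (G k) = G i" if "i \<le> k" for i k
    using that by (induction k) (auto simp: G len le_Suc_eq)
  have nth: "G k ! i = pick (G i)" if "i < k" for i k
    using that by (induction k) (auto simp: G len nth_append less_Suc_eq)
  have inG: "pick (G i) \<in> set (G k)" if "i < k" for i k using nth[OF that] len that by (metis nth_mem)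
  have mono: "cand (G k) \<subseteq> cand (G i)" if "i \<le> k" for i k
    using take[OF that] set_take_subset[of i "G k"] by (auto simp: cand_def)
  have "\<exists>k. cand (G k) = {}"
  proof (rule ccontr)
    assume "\<nexists>k. cand (G k) = {}"
    then have pk: "pick (G k) \<in> cand (G k)" "q \<in> cand (G k) \<Longrightarrow> \<not> rank_lt lt q (pick (G k))" for k q
      using pick by blast+
    \<comment> \<open>Reducedness excludes a proper derivative, and with equal leaders the later
      pick would have the smaller degree, against the choice of the earlier one.\<close>
    obtain i j where ij: "i < j" "dle (leader lt (pick (G i))) (leader lt (pick (G j)))"
      using dvars_dickson[of "\<lambda>i. leader lt (pick (G i))" m n] ld[OF nc[OF pk(1)]] by blast
    have red: "reduced lt (pick (G j)) (pick (G i))" using pk(1)[of j] inG[OF ij(1)] by (simp add: cand_def)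
    then have "leader lt (pick (G i)) = leader lt (pick (G j))"
      using ij(2) ldv[OF nc[OF pk(1)[of j]]] by (auto simp: reduced_def proper_derivative_dle)
    then have "rank_lt lt (pick (G j)) (pick (G i))" using red by (simp add: reduced_def rank_lt_def)
    moreover have "pick (G j) \<in> cand (G i)" using pk(1)[of j] mono[of i j] ij(1) by auto
    ultimately show False using pk(2)[of "pick (G j)" i] by blast
  qed
  then obtain k where k: "cand (G k) = {}" "\<And>i. i < k \<Longrightarrow> cand (G i) \<noteq> {}"
    using exists_least_iff[of "\<lambda>k. cand (G k) = {}"] by blast
  note pk = pick[OF k(2)]
  have setG: "f \<in> set (G k) \<longleftrightarrow> (\<exists>i<k. f = pick (G i))" for f
    using nth[of _ k] by (auto simp: in_set_conv_nth len)
  have ncp: "nonconst (pick (G i))" if "i < k" for i using nc[OF pk(1)[OF that]] .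
  have red: "reduced lt (pick (G j)) (pick (G i)) \<and> reduced lt (pick (G i)) (pick (G j)) \<and>
      rank_lt lt (pick (G i)) (pick (G j))" if "i < j" "j < k" for i j
  proof -
    have ik: "i < k" using that by simp
    have r: "reduced lt (pick (G j)) (pick (G i))" using pk(1)[OF that(2)] inG[OF that(1)] by (simp add: cand_def)
    have "\<not> rank_lt lt (pick (G j)) (pick (G i))" using pk(2)[OF ik] pk(1)[OF that(2)] mono[of i j] that by auto
    moreover have "\<not> rank_eq lt (pick (G i)) (pick (G j))" using r by (auto simp: reduced_def rank_eq_def)
    ultimately have "rank_lt lt (pick (G i)) (pick (G j))" using rank_total[OF ncp ncp, of i j] ik that by blast
    then show ?thesis using r reduced_rank_lt[OF ncp ncp r] ik that by blast
  qed
  have ar: "autoreduced lt (set (G k))"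
    unfolding autoreduced_def
  proof (intro conjI ballI impI)
    fix f assume f: "f \<in> set (G k)"
    then obtain i where i: "i < k" "f = pick (G i)" using setG by blast
    show "vars f \<noteq> {}" using ncp[OF i(1)] i(2) by (simp add: nonconst_def)
    fix g assume "g \<in> set (G k)" "f \<noteq> g"
    then obtain j where "j < k" "g = pick (G j)" "i \<noteq> j" using setG i(2) by blast
    then show "reduced lt g f" using red[of i j] red[of j i] i by (cases "i < j") auto
  qed simp
  have sorted: "sorted_wrt (rank_lt lt) (G k)"
    using red by (auto simp: sorted_wrt_iff_nth_less len nth)
  have asym: "\<not> rank_lt lt g f" if "f \<in> set (G k)" "g \<in> set (G k)" "rank_lt lt f g" for f g
  proof -
    have "nonconst f" "nonconst g" using that(1,2) ncp setG by auto
    from rank_lt_asym[OF this that(3)] show ?thesis .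
  qed
  have "\<not> ar_lower lt B (set (G k))" if B: "B \<subseteq> P" "autoreduced lt B" for B
  proof
    assume "ar_lower lt B (set (G k))"
    then obtain As Bs where *: "set As = B" "sorted_wrt (rank_lt lt) As" "set Bs = set (G k)" "sorted_wrt (rank_lt lt) Bs"
      and c: "(\<exists>i. i < length As \<and> i < length Bs \<and> (\<forall>j<i. rank_eq lt (As ! j) (Bs ! j)) \<and> rank_lt lt (As ! i) (Bs ! i)) \<or>
       (length Bs < length As \<and> (\<forall>j<length Bs. rank_eq lt (As ! j) (Bs ! j)))"
      unfolding ar_lower_def by blast
    have "G k = Bs" by (rule sorted_wrt_unique[OF _ sorted *(4) *(3)[symmetric]]) (rule asym)
    then have Bs: "Bs = G k" by (rule sym)
    have ncA: "nonconst (As ! i)" if "i < length As" for i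
    proof -
      have "As ! i \<in> B" using nth_mem[OF that] *(1) by simp
      then show ?thesis using B PY by (auto simp: nonconst_def autoreduced_def)
    qed
    \<comment> \<open>Being reduced with respect to an element depends only on its rank. So while
      the ranks agree, \<open>As ! i\<close> was a candidate at stage \<open>i\<close>: it cannot
      rank below the pick, nor can it extend the list, since \<open>cand (G k)\<close> is
      empty.\<close>
    have candA: "As ! i \<in> cand (G i)" if i: "i < length As" "i \<le> k" "\<forall>j<i. rank_eq lt (As ! j) (Bs ! j)" for i
    proof -
      have "reduced lt (As ! i) f" if fi: "f \<in> set (G i)" for f
      proof -
        obtain j where j: "j < i" "f = pick (G j)" using fi nth[of _ i] by (auto simp: in_set_conv_nth len)
        have "rank_lt lt (As ! j) (As ! i)" using *(2) i(1) j(1) by (auto simp: sorted_wrt_iff_nth_less)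
        then have "As ! j \<noteq> As ! i" using rank_lt_irrefl[OF ncA[OF i(1)]] by auto
        moreover have "As ! j \<in> B" "As ! i \<in> B" 
          using *(1) nth_mem[of j As] nth_mem[of i As] i(1) j(1) by simp_all
        ultimately have "reduced lt (As ! i) (As ! j)" using B(2) by (auto simp: autoreduced_def)
        moreover have "rank_eq lt (As ! j) f" using i(2,3) j Bs nth[of j k] by auto
        ultimately show ?thesis using reduced_rank_cong by blast
      qed
      moreover have "As ! i \<in> P" using nth_mem[OF i(1)] *(1) B(1) by auto
      ultimately show ?thesis using ncA[OF i(1)] by (simp add: cand_def nonconst_def)
    qed
    from c show False
    proof (elim disjE exE conjE)
      fix i assume i: "i < length As" "i < length Bs" "\<forall>j<i. rank_eq lt (As ! j) (Bs ! j)" "rank_lt lt (As ! i) (Bs ! i)"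
      then have "i < k" using Bs len by simp
      then show False using pk(2)[of i "As ! i"] candA[of i] i nth[of i k] Bs by simp
    next
      assume "length Bs < length As" "\<forall>j<length Bs. rank_eq lt (As ! j) (Bs ! j)"
      then show False using candA[of k] k(1) Bs len by auto
    qed
  qed
  moreover have "set (G k) \<subseteq> P" using setG pk(1) by (auto simp: cand_def)
  ultimately show ?thesis using ar unfolding char_set_def by blast
qed

end


section \<open>Extending a derivation to a differential extension\<close>

lemma dv_commute: "dv i (dv j u) = dv j (dv i u)"
  by (cases "i = j") (auto simp: dv_def fun_upd_twist)

lemma inj_dv: "inj (dv j)"
proof (rule injI)
  fix u v assume a: "dv j u = dv j v"
  have "snd u i = snd v i" for i
  proof -
    have "snd (dv j u) i = snd (dv j v) i" using a by simp
    then show ?thesis by (simp add: dv_def split: if_splits)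
  qed
  then show "u = v" using a by (auto simp: dv_def prod_eq_iff)
qed

context
  fixes m n :: nat and \<delta> :: "nat \<Rightarrow> 'a::field_char_0 \<Rightarrow> 'a" and D :: "'a \<Rightarrow> 'a"
  assumes d: "\<forall>j<m. is_derivation (\<delta> j)" and D: "is_derivation D"
    and dD: "\<forall>j<m. \<delta> j \<circ> D = D \<circ> \<delta> j"
begin

text \<open>The derivatives of order less than \<open>k\<close> in \<open>D\<close>, which is the operator with index \<open>m\<close>.\<close>
private definition RV :: "nat \<Rightarrow> dvar set" where
  "RV k = {u \<in> dvars (Suc m) n. snd u m < k}"

private abbreviation DD :: "'a dpoly \<Rightarrow> 'a dpoly" where
  "DD \<equiv> der D (\<lambda>v. Xv (dv m v))"

private lemma RV_mono: "RV k \<subseteq> RV (Suc k)"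
  by (auto simp: RV_def)

private lemma dv_RV: "u \<in> RV k \<Longrightarrow> j < m \<Longrightarrow> dv j u \<in> RV k"
  and dvm_RV: "u \<in> RV k \<Longrightarrow> dv m u \<in> RV (Suc k)"
  by (auto simp: RV_def dvars_def dv_def)

private lemma diffring_RV: "diffring (polys (RV k)) (dops m \<delta>)"
  using d dv_RV by (rule diffring_dops)

private lemma DD_RV: "p \<in> polys (RV k) \<Longrightarrow> DD p \<in> polys (RV (Suc k))"
  by (rule der_polys[OF D]) (use RV_mono dvm_RV in auto)

private lemma dderiv_DD: "j < m \<Longrightarrow> dderiv \<delta> j (DD p) = DD (dderiv \<delta> j p)"
proof -
  assume j: "j < m"
  then have "is_derivation (\<delta> j)" "\<delta> j (D x) = D (\<delta> j x)" for x
    using d dD by (auto simp: fun_eq_iff)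
  then show ?thesis unfolding dderiv_der
    using D by (intro der_der_commute[of _ _ p UNIV]) (auto simp: polys_def dv_commute)
qed

text \<open>This is the extension of a derivation to a finitely generated extension field in characteristic 0:
  the new variable \<open>dv m v\<close> stands for the value at \<open>v\<close>. If \<open>v\<close> is algebraic, with minimal polynomial \<open>f\<close>,
  the value is prescribed by \<open>D f = 0\<close>; otherwise it is set to 0.\<close>
private lemma extend_finite:
  assumes Q: "prime_of (polys (RV (Suc k))) {} Q" and DQ: "\<And>q. q \<in> Q \<Longrightarrow> q \<in> polys (RV k) \<Longrightarrow> DD q \<in> Q"
    and V: "finite V" "V \<subseteq> RV (Suc k) - RV k"
  shows "\<exists>I. prime_of (polys (RV (Suc k) \<union> dv m ` V)) {} I \<and> I \<inter> polys (RV (Suc k)) = Q \<and>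
    (\<forall>q\<in>Q \<inter> polys (RV k \<union> V). DD q \<in> I)"
  using V
proof (induction V rule: finite_induct)
  case empty
  have "Q \<subseteq> polys (RV (Suc k))" using Q by (auto simp: prime_of_def ideal_of_def)
  then show ?case using Q DQ by (intro exI[of _ Q]) auto
next
  case (insert v V)
  let ?C = "RV (Suc k) \<union> dv m ` V" and ?x = "dv m v" and ?Y = "RV k \<union> V"
  let ?B = "polys (insert v ?Y) :: 'a dpoly set" and ?C' = "insert ?x ?C"
  obtain I where I: "prime_of (polys ?C) {} I" "I \<inter> polys (RV (Suc k)) = Q"
    "\<And>q. q \<in> Q \<Longrightarrow> q \<in> polys ?Y \<Longrightarrow> DD q \<in> I"
    using insert by blast
  have vk: "v \<in> RV (Suc k)" "v \<notin> ?Y" using insert by auto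
  have BR: "insert v ?Y \<subseteq> RV (Suc k)" using insert RV_mono by auto
  have xC: "?x \<notin> ?C"
  proof -
    have "snd v m = k" using insert.prems by (auto simp: RV_def)
    then have "snd ?x m = Suc k" by (simp add: dv_def)
    then have "?x \<notin> RV (Suc k)" by (simp add: RV_def)
    moreover have "?x \<notin> dv m ` V" using insert.hyps(2) inj_image_mem_iff[OF inj_dv] by blast
    ultimately show ?thesis by blast
  qed
  \<comment> \<open>Algebraicity of \<open>v\<close> is tested over \<open>RV k \<union> V\<close>
    only, because the induction hypothesis controls \<open>DD\<close> just on the relations among
    these variables.\<close>
  define QV where "QV = Q \<inter> ?B"
  have BR': "?B \<subseteq> polys (RV (Suc k))" using BR polys_mono by blast
  have QV: "prime_of ?B {} QV" unfolding QV_def by (rule prime_of_Int[OF Q]) (use BR' in auto)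
  have RC: "polys (RV (Suc k)) \<subseteq> polys ?C" using polys_mono by blast
  have CC: "polys ?C \<subseteq> polys ?C'" using polys_mono[of _ ?C ?C'] by blast
  have DDB: "DD b \<in> polys ?C'" if "b \<in> ?B" for b
    by (rule der_polys[OF D that]) (use vk RV_mono dvm_RV insert.prems in auto)
  have BC: "?B \<subseteq> polys ?C'" using BR' RC CC by blast
  \<comment> \<open>An ideal by the Leibniz rule. Hence \<open>DD q \<in> I'\<close> can be proved
    by pseudo-dividing \<open>q\<close> by \<open>f\<close> and treating divisor and remainder
    separately.\<close>
  define M where "M I' = {a \<in> ?B. a \<in> I' \<and> DD a \<in> I'}" for I'
  have M: "ideal_of ?B {} (M I')" if I': "prime_of (polys ?C') {} I'" for I'
  proof -
    note id = prime_ideal[OF I'] and sub = subring_polys[of ?C']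
    have "DD (a * x) \<in> I'" if "a \<in> ?B" "x \<in> I'" "DD x \<in> I'" for a x
    proof -
      have "a * DD x \<in> I'" "DD a * x \<in> I'"
        using ideal_mult[OF sub id _ that(3), of a] ideal_mult[OF sub id _ that(2), of "DD a"] that(1) BC DDB by auto
      then show ?thesis using ideal_add[OF sub id] by (simp add: der_mult[OF D])
    qed
    moreover have "a * x \<in> I'" if "a \<in> ?B" "x \<in> I'" for a x
      using ideal_mult[OF sub id, of a x] that BC by blast
    ultimately show ?thesis using ideal_add[OF sub id] ideal_0[OF sub id]
      unfolding ideal_of_def M_def by (auto simp: der_add[OF D] der_0[OF D])
  qed
  have expand: "r \<in> M I'" if I': "prime_of (polys ?C') {} I'" "I \<subseteq> I'"
    and r: "r \<in> ?B" "\<And>j. coeff (U v r) j \<in> QV" for r I'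
  proof -
    have co: "coeff (U v r) j \<in> M I'" for j
    proof -
      have c: "coeff (U v r) j \<in> Q" "coeff (U v r) j \<in> ?B" using r(2)[of j] by (auto simp: QV_def)
      then have "coeff (U v r) j \<in> I" using I(2) by blast
      moreover have "DD (coeff (U v r) j) \<in> I" by (rule I(3)[OF c(1) coeff_U_polys'[OF r(1)]])
      ultimately show ?thesis using c(2) I'(2) by (auto simp: M_def)
    qed
    have "(\<Sum>j\<le>degree (U v r). coeff (U v r) j * Xv v ^ j) \<in> M I'"
      by (intro ideal_sum[OF subring_polys M[OF I'(1)]] ideal_mult2[OF subring_polys M[OF I'(1)]] co polys_power) auto
    then show ?thesis using U_expand[of r v] by metis
  qed
  have "\<exists>I'. prime_of (polys ?C') {} I' \<and> I' \<inter> polys ?C = I \<and> (\<forall>q\<in>QV. DD q \<in> I')"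
  proof (cases "\<exists>f\<in>QV. \<exists>j. coeff (U v f) j \<notin> QV")
    case False
    have "1 \<notin> I" using I(1) by (simp add: prime_of_def)
    \<comment> \<open>\<open>v\<close> is transcendental in this case; the arguments
      \<open>1\<close> and \<open>0\<close> encode the relation
      \<open>Xv (dv m v) = 0\<close>.\<close>
    then obtain I' where I': "prime_of (polys ?C') {} I'" "I' \<inter> polys ?C = I"
      using prime_linear_extension[OF I(1) xC, of 1 0] by auto
    have "DD q \<in> I'" if q: "q \<in> QV" for q
    proof -
      have "q \<in> M I'" using I' False q by (intro expand) (auto simp: QV_def)
      then show ?thesis by (simp add: M_def)
    qed
    then show ?thesis using I' by blast
  next
    case True
    then obtain f0 j0 where "f0 \<in> QV" "coeff (U v f0) j0 \<notin> QV" by blast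
    from minimal_in_prime[OF QV vk(2) this] obtain f where f: "f \<in> QV" "lead_coeff (U v f) \<notin> QV"
      "0 < degree (U v f)" "pdiff v f \<notin> QV"
      and min: "\<forall>q\<in>QV. degree (U v q) < degree (U v f) \<longrightarrow> (\<forall>j. coeff (U v q) j \<in> QV)"
      by (elim bexE conjE) rule
    let ?s = "pdiff v f" and ?e = "der D ((\<lambda>u. Xv (dv m u))(v := 0)) f" and ?l = "lead_coeff (U v f)"
    have fB: "f \<in> ?B" using f(1) by (simp add: QV_def)
    have nQ: "b \<in> polys ?C \<and> b \<notin> I" if "b \<in> ?B" "b \<notin> QV" for b
      using that I(2) BR' RC by (auto simp: QV_def)
    have s: "?s \<in> polys ?C" "?s \<notin> I" using nQ[OF pdiff_polys[OF fB] f(4)] by auto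
    have e: "?e \<in> polys ?C"
      by (rule der_polys[OF D fB]) (use vk RV_mono dvm_RV insert.prems in auto)
    obtain I' where I': "prime_of (polys ?C') {} I'" "I' \<inter> polys ?C = I" "?s * Xv ?x + ?e \<in> I'"
      using prime_linear_extension[OF I(1) xC s(1) e s(2)] by blast
    note id = prime_ideal[OF I'(1)] and sub = subring_polys[of ?C']
    have II: "I \<subseteq> I'" using I'(2) by blast
    have fI: "f \<in> I'" using f(1) I(2) II by (auto simp: QV_def)
    have "DD f = ?s * Xv ?x + ?e" using der_split[OF D, of "\<lambda>u. Xv (dv m u)" f v] by simp
    then have fM: "f \<in> M I'" using I'(3) fB fI by (simp add: M_def)
    have lB: "?l \<in> ?B" using polys_mono[OF coeff_U_polys'[OF fB], of "insert v ?Y"] by blast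
    have lI: "?l \<notin> I'" "?l \<in> polys ?C'" using nQ[OF lB f(2)] I'(2) CC by auto
    have "DD q \<in> I'" if q: "q \<in> QV" for q
    proof -
      have qB: "q \<in> ?B" using q by (simp add: QV_def)
      obtain i c r where r: "?l ^ i * q = c * f + r" "degree (U v r) < degree (U v f)" "c \<in> ?B" "r \<in> ?B"
        using pseudo_division[of v f q "insert v ?Y"] f(3) qB fB unfolding vdeg_U by metis
      note idQ = prime_ideal[OF QV] and subB = subring_polys[of "insert v ?Y"]
      have "r = ?l ^ i * q - c * f" using r(1) by simp
      also have "\<dots> \<in> QV"
        using ideal_diff[OF subB idQ ideal_mult[OF subB idQ polys_power[OF lB] q] ideal_mult[OF subB idQ r(3) f(1)]] .
      finally have "r \<in> QV" .
      then have "\<And>j. coeff (U v r) j \<in> QV" using min r(2) by blast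
      then have "r \<in> M I'" by (rule expand[OF I'(1) II r(4)])
      then have "?l ^ i * q \<in> M I'" unfolding r(1)
        using ideal_add[OF subB M[OF I'(1)] ideal_mult[OF subB M[OF I'(1)] r(3) fM]] by blast
      then have "?l ^ i * DD q + DD (?l ^ i) * q \<in> I'" by (simp add: M_def der_mult[OF D])
      moreover have "DD (?l ^ i) * q \<in> I'"
      proof (rule ideal_mult[OF sub id DDB[OF polys_power[OF lB]]])
        show "q \<in> I'" using q I(2) II by (auto simp: QV_def)
      qed
      ultimately have "?l ^ i * DD q \<in> I'"
        using ideal_diff[OF sub id, of "?l ^ i * DD q + DD (?l ^ i) * q" "DD (?l ^ i) * q"] by simp
      moreover have "?l ^ i \<notin> I'" using prime_power[OF I'(1) sub lI(2)] lI(1) by blast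
      ultimately show ?thesis
        using prime_mult[OF I'(1) polys_power[OF lI(2)] DDB[OF qB], of i] by blast
    qed
    then show ?thesis using I' by blast
  qed
  then obtain I' where I': "prime_of (polys ?C') {} I'" "I' \<inter> polys ?C = I" "\<forall>q\<in>QV. DD q \<in> I'" by blast
  have "I' \<inter> polys (RV (Suc k)) = Q" using I'(2) I(2) RC by blast
  then show ?case using I' by (intro exI[of _ I']) (simp add: QV_def)
qed

text \<open>Membership in the ideal generated by \<open>Q\<close> and its \<open>DD\<close>-image
  involves finitely many values of \<open>DD\<close>, so \<open>extend_finite\<close> shows that no
  new element of the lower ring is obtained. Avoiding the complement of \<open>Q\<close> then gives
  the prime.\<close>

private lemma extend_step:
  assumes Q: "prime_of (polys (RV (Suc k))) (dops m \<delta>) Q"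
    and DQ: "\<And>q. q \<in> Q \<Longrightarrow> q \<in> polys (RV k) \<Longrightarrow> DD q \<in> Q"
  shows "\<exists>Q'. prime_of (polys (RV (Suc (Suc k)))) (dops m \<delta>) Q' \<and> Q' \<inter> polys (RV (Suc k)) = Q \<and>
    (\<forall>q\<in>Q. DD q \<in> Q')"
proof -
  let ?R = "polys (RV (Suc k)) :: 'a dpoly set" and ?R' = "polys (RV (Suc (Suc k))) :: 'a dpoly set"
  have Q0: "prime_of ?R {} Q" using prime_of_subset[OF Q] by blast
  have QR: "Q \<subseteq> ?R" using Q by (auto simp: prime_of_def ideal_of_def)
  have RR: "?R \<subseteq> ?R'" using polys_mono RV_mono by blast
  have dQ: "e q \<in> Q" if "e \<in> dops m \<delta>" "q \<in> Q" for e q using prime_ideal[OF Q] that by (auto simp: ideal_of_def)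
  let ?G = "Q \<union> DD ` Q"
  have J: "ideal_of ?R' (dops m \<delta>) (gen ?R' ?G)"
  proof (rule ideal_gen[OF diffring_RV])
    show "?G \<subseteq> ?R'" using QR RR DD_RV by blast
    fix e g assume e: "e \<in> dops m \<delta>" "g \<in> ?G"
    then obtain j where j: "j < m" "e = dderiv \<delta> j" by (auto simp: dops_def)
    have "e g \<in> ?G" using e(2)
    proof
      assume "g \<in> DD ` Q"
      then obtain q where "q \<in> Q" "g = DD q" by blast
      then show ?thesis using dderiv_DD[OF j(1), of q] dQ[OF e(1)] j(2) by auto
    qed (use dQ[OF e(1)] in blast)
    then show "e g \<in> gen ?R' ?G" by (rule gen.base)
  qed
  let ?T = "RV (Suc k) - RV k"
  let ?gen = "\<lambda>V. gen (polys (RV (Suc k) \<union> dv m ` V)) (Q \<union> DD ` (Q \<inter> polys (RV k \<union> V)))"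
  \<comment> \<open>Claimed for every \<open>V\<close> above \<open>V0\<close>, so that the sets
    found for two summands can be merged.\<close>
  have fin: "\<exists>V0. finite V0 \<and> V0 \<subseteq> ?T \<and> (\<forall>V. V0 \<subseteq> V \<longrightarrow> V \<subseteq> ?T \<longrightarrow> p \<in> ?gen V)" if "p \<in> gen ?R' ?G" for p
    using that
  proof induction
    case zero
    then show ?case by (intro exI[of _ "{}"]) (simp add: gen.zero)
  next
    case (base g)
    then show ?case
    proof
      assume "g \<in> DD ` Q"
      then obtain q where q: "q \<in> Q" "g = DD q" by blast
      have "vars q \<subseteq> RV (Suc k)" using QR q(1) by (auto simp: polys_def)
      moreover have "g \<in> ?gen V" if "vars q - RV k \<subseteq> V" for V
        using that q by (intro gen.base) (auto simp: polys_def)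
      ultimately show ?thesis by (intro exI[of _ "vars q - RV k"]) auto
    qed (auto intro!: exI[of _ "{}"] gen.base)
  next
    case (add x y)
    then obtain V1 V2 where V: "finite V1" "V1 \<subseteq> ?T" "\<forall>V. V1 \<subseteq> V \<longrightarrow> V \<subseteq> ?T \<longrightarrow> x \<in> ?gen V"
      "finite V2" "V2 \<subseteq> ?T" "\<forall>V. V2 \<subseteq> V \<longrightarrow> V \<subseteq> ?T \<longrightarrow> y \<in> ?gen V" by blast
    have "x + y \<in> ?gen V" if "V1 \<union> V2 \<subseteq> V" "V \<subseteq> ?T" for V using V(3,6) that by (intro gen.add) auto
    then show ?case using V by (intro exI[of _ "V1 \<union> V2"]) blast
  next
    case (mult a x)
    then obtain V1 where V: "finite V1" "V1 \<subseteq> ?T" "\<forall>V. V1 \<subseteq> V \<longrightarrow> V \<subseteq> ?T \<longrightarrow> x \<in> ?gen V" by blast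
    let ?d = "\<lambda>u. (fst u, (snd u)(m := k))"
    \<comment> \<open>A cofactor \<open>a\<close> may contain derivatives of order
      \<open>Suc k\<close> in \<open>D\<close>; \<open>?d\<close> returns the derivatives of order
      \<open>k\<close> from which these arise.\<close>
    define V2 where "V2 = ?d ` (vars a - RV (Suc k))"
    have top: "?d u \<in> ?T \<and> dv m (?d u) = u" if "u \<in> vars a" "u \<notin> RV (Suc k)" for u
    proof -
      have "u \<in> RV (Suc (Suc k))" using mult.hyps(1) that(1) by (auto simp: polys_def)
      then have "u \<in> dvars (Suc m) n" "snd u m = Suc k" using that(2) by (auto simp: RV_def)
      then show ?thesis by (auto simp: RV_def dvars_def dv_def prod_eq_iff fun_upd_idem_iff)
    qed
    have "a * x \<in> ?gen V" if "V1 \<union> V2 \<subseteq> V" "V \<subseteq> ?T" for V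
    proof (rule gen.mult)
      show "x \<in> ?gen V" using V(3) that by auto
      have "u \<in> RV (Suc k) \<union> dv m ` V" if "u \<in> vars a" for u
      proof (cases "u \<in> RV (Suc k)")
        case False
        then have "?d u \<in> V" using that \<open>V1 \<union> V2 \<subseteq> V\<close> by (auto simp: V2_def)
        then have "dv m (?d u) \<in> dv m ` V" by blast
        then show ?thesis using top[OF that False] by simp
      qed simp
      then show "a \<in> polys (RV (Suc k) \<union> dv m ` V)" unfolding polys_def by blast
    qed
    moreover have "V2 \<subseteq> ?T" "finite V2" using top by (auto simp: V2_def)
    ultimately show ?case using V(1,2) by (intro exI[of _ "V1 \<union> V2"]) simp
  qed
  have JS: "p \<in> Q" if p: "p \<in> gen ?R' ?G" "p \<in> ?R" for p
  proof -
    obtain V where V: "finite V" "V \<subseteq> ?T" "p \<in> ?gen V" using fin[OF p(1)] by blast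
    obtain I where I: "prime_of (polys (RV (Suc k) \<union> dv m ` V)) {} I" "I \<inter> ?R = Q"
      "\<forall>q\<in>Q \<inter> polys (RV k \<union> V). DD q \<in> I"
      using extend_finite[OF Q0 DQ V(1,2)] by blast
    have "?gen V \<subseteq> I" by (rule gen_subset[OF prime_ideal[OF I(1)]]) (use I(2,3) in blast)
    then show ?thesis using V(3) p(2) I(2) by blast
  qed
  obtain Q' where Q': "prime_of ?R' (dops m \<delta>) Q'" "gen ?R' ?G \<subseteq> Q'" "Q' \<inter> (?R - Q) = {}"
  proof (rule prime_avoiding[OF diffring_RV J, of "?R - Q"])
    show "?R - Q \<subseteq> ?R'" using RR by blast
    show "1 \<in> ?R - Q" using Q by (simp add: prime_of_def)
    show "x * y \<in> ?R - Q" if "x \<in> ?R - Q" "y \<in> ?R - Q" for x y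
      using that prime_mult[OF Q, of x y] by auto
  qed (use JS in auto)
  have "Q' \<inter> ?R = Q" using Q'(2,3) gen.base[of _ ?G ?R'] QR by blast
  moreover have "\<forall>q\<in>Q. DD q \<in> Q'" using Q'(2) gen.base[of _ ?G ?R'] by blast
  ultimately show ?thesis using Q'(1) by blast
qed

text \<open>Used with \<open>k = 0\<close>, where the condition on \<open>D\<close> concerns
  constants only, and with \<open>k = 1\<close>, where \<open>Q\<close> already relates each x to
  the prospective value of D at x.\<close>

theorem extend_derivation:
  assumes Q: "prime_of (polys {u \<in> dvars (Suc m) n. snd u m < Suc k}) (dops m \<delta>) Q"
    and DQ: "\<And>q. q \<in> Q \<Longrightarrow> q \<in> polys {u \<in> dvars (Suc m) n. snd u m < k} \<Longrightarrow> dderiv (\<delta>(m := D)) m q \<in> Q"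
  shows "\<exists>P. prime_dideal (Suc m) (\<delta>(m := D)) n P \<and> P \<inter> polys {u \<in> dvars (Suc m) n. snd u m < Suc k} = Q"
proof -
  let ?A = "\<lambda>i. polys (RV (Suc (k + i))) :: 'a dpoly set"
  let ?ok = "\<lambda>i Q. prime_of (?A i) (dops m \<delta>) Q \<and> (\<forall>q\<in>Q. q \<in> polys (RV (k + i)) \<longrightarrow> DD q \<in> Q)"
  let ?next = "\<lambda>i Q Q'. Q' \<inter> ?A i = Q \<and> (\<forall>q\<in>Q. DD q \<in> Q')"
  have DDm: "DD = dderiv (\<delta>(m := D)) m" by (simp add: dderiv_der)
  \<comment> \<open>The clause for \<open>i = 0\<close> makes the chain start at \<open>Q\<close>;
    \<open>dependent_nat_choice\<close> by itself leaves the start open.\<close>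
  have "\<exists>F. \<forall>i. (?ok i (F i) \<and> (i = 0 \<longrightarrow> F i = Q)) \<and> ?next i (F i) (F (Suc i))"
  proof (rule dependent_nat_choice)
      show "\<exists>F. ?ok 0 F \<and> (0 = 0 \<longrightarrow> F = Q)" using Q DQ by (intro exI[of _ Q]) (simp add: RV_def DDm)
      fix F :: "'a dpoly set" and i assume "?ok i F \<and> (i = 0 \<longrightarrow> F = Q)"
      then have ok: "?ok i F" by blast
      then obtain Q' where Q': "prime_of (?A (Suc i)) (dops m \<delta>) Q'" "Q' \<inter> ?A i = F" "\<forall>q\<in>F. DD q \<in> Q'"
        using extend_step[of "k + i" F] by auto
      then show "\<exists>F'. (?ok (Suc i) F' \<and> (Suc i = 0 \<longrightarrow> F' = Q)) \<and> ?next i F F'"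
        by (intro exI[of _ Q']) auto
  qed
  then obtain F where F0: "\<forall>i. (?ok i (F i) \<and> (i = 0 \<longrightarrow> F i = Q)) \<and> ?next i (F i) (F (Suc i))"
    by (elim exE)
  have F: "\<And>i. prime_of (?A i) (dops m \<delta>) (F i)" "\<And>i. F (Suc i) \<inter> ?A i = F i"
    "\<And>i q. q \<in> F i \<Longrightarrow> DD q \<in> F (Suc i)" "F 0 = Q"
    using F0 by simp_all
  have FA: "F i \<subseteq> ?A i" for i using F(1)[of i] by (auto simp: prime_of_def ideal_of_def)
  have AA: "?A i \<subseteq> ?A (i + j)" for i j
  proof -
    have "RV (Suc (k + i)) \<subseteq> RV (Suc (k + (i + j)))" by (auto simp: RV_def)
    then show ?thesis unfolding polys_def by blast
  qed
  have Fij: "F (i + j) \<inter> ?A i = F i" for i j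
  proof (induction j)
    case (Suc j)
    have "F (i + Suc j) \<inter> ?A i = F (i + Suc j) \<inter> ?A (i + j) \<inter> ?A i" using AA by blast
    then show ?case using F(2)[of "i + j"] Suc by simp
  qed (use FA in auto)
  define P where "P = (\<Union>i. F i)"
  have PA: "P \<inter> ?A i = F i" for i
  proof
    show "P \<inter> ?A i \<subseteq> F i"
    proof
      fix p assume p: "p \<in> P \<inter> ?A i"
      then obtain j where "p \<in> F j" by (auto simp: P_def)
      then have "p \<in> F (i + j) \<inter> ?A i" using Fij[of j i] p by (auto simp: add.commute)
      then show "p \<in> F i" using Fij by blast
    qed
  qed (use FA in \<open>auto simp: P_def\<close>)
  have all: "\<exists>i. p \<in> ?A i" if "p \<in> polys (dvars (Suc m) n)" for p
  proof -
    have "finite ((\<lambda>u. snd u m) ` vars p)" by simp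
    then obtain b where b: "\<forall>x\<in>(\<lambda>u. snd u m) ` vars p. x \<le> b"
      using finite_nat_set_iff_bounded_le by blast
    have "vars p \<subseteq> RV (Suc (k + b))"
    proof
      fix u assume "u \<in> vars p"
      then show "u \<in> RV (Suc (k + b))" using b that by (auto simp: RV_def polys_def)
    qed
    then have "p \<in> ?A b" by (simp add: polys_def)
    then show ?thesis by (rule exI[of _ b])
  qed
  have two: "\<exists>i. p \<in> ?A i \<and> q \<in> ?A i" if pq: "p \<in> polys (dvars (Suc m) n)" "q \<in> polys (dvars (Suc m) n)" for p q
  proof -
    obtain i where i: "p \<in> ?A i" using all[OF pq(1)] by (elim exE)
    obtain j where j: "q \<in> ?A j" using all[OF pq(2)] by (elim exE)
    have "p \<in> ?A (i + j)" using AA[of i j] i by (rule subsetD)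
    moreover have "q \<in> ?A (i + j)" using subsetD[OF AA[of j i] j] by (simp only: add.commute)
    ultimately show ?thesis by (intro exI[of _ "i + j"] conjI)
  qed
  have Ad: "?A i \<subseteq> polys (dvars (Suc m) n)" for i
  proof -
    have "RV (Suc (k + i)) \<subseteq> dvars (Suc m) n" by (auto simp: RV_def)
    then show ?thesis unfolding polys_def by blast
  qed
  have PY: "P \<subseteq> polys (dvars (Suc m) n)" using FA Ad by (auto simp: P_def)
  note sub = subring_polys and id = prime_ideal[OF F(1)]
  have "prime_of (polys (dvars (Suc m) n)) (dops (Suc m) (\<delta>(m := D))) P"
    unfolding prime_of_def ideal_of_def
  proof (intro conjI ballI impI)
    show "0 \<in> P" using ideal_0[OF sub id] by (auto simp: P_def)
    show "1 \<notin> P" using PA[of 0] F(1)[of 0] by (auto simp: prime_of_def)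
    fix x assume x: "x \<in> P"
    { fix y assume y: "y \<in> P"
      obtain i where "x \<in> ?A i" "y \<in> ?A i" using two x y PY by blast
      then have "x + y \<in> F i" using PA[of i] x y ideal_add[OF sub id] by blast
      then show "x + y \<in> P" by (auto simp: P_def) }
    { fix a :: "'a dpoly" assume "a \<in> polys (dvars (Suc m) n)"
      then obtain i where "x \<in> ?A i" "a \<in> ?A i" using two x PY by blast
      then have "a * x \<in> F i" using PA[of i] x ideal_mult[OF sub id] by blast
      then show "a * x \<in> P" by (auto simp: P_def) }
    { fix e :: "'a dpoly \<Rightarrow> 'a dpoly" assume "e \<in> dops (Suc m) (\<delta>(m := D))"
      then obtain j where j: "j < Suc m" "e = dderiv (\<delta>(m := D)) j" by (auto simp: dops_def)
      obtain i where i: "x \<in> F i" using x by (auto simp: P_def)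
      show "e x \<in> P"
      proof (cases "j = m")
        case True
        then show ?thesis using F(3)[OF i] j(2) DDm by (auto simp: P_def)
      next
        case False
        then have "e = dderiv \<delta> j" "j < m" using j by (simp_all add: dderiv_der)
        then have "e x \<in> F i" using id[of i] i by (auto simp: ideal_of_def dops_def)
        then show ?thesis by (auto simp: P_def)
      qed }
  next
    fix x y :: "'a dpoly"
    assume xy: "x \<in> polys (dvars (Suc m) n)" "y \<in> polys (dvars (Suc m) n)" "x * y \<in> P"
    obtain i where i: "x \<in> ?A i" "y \<in> ?A i" using two xy by blast
    then have "x * y \<in> F i" using PA[of i] xy(3) by blast
    then show "x \<in> P \<or> y \<in> P" using prime_mult[OF F(1) i] by (auto simp: P_def)
  qed (use PY in auto)
  moreover have "P \<inter> polys {u \<in> dvars (Suc m) n. snd u m < Suc k} = Q" using PA[of 0] F(4) by (simp add: RV_def)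
  ultimately show ?thesis by (auto simp: prime_dideal_prime_of)
qed

end


section \<open>Evaluation at points\<close>

lemma theta_dv:
  assumes "commuting_derivations m \<delta>" "j < m"
  shows "theta m \<delta> (e(j := Suc (e j))) x = \<delta> j (theta m \<delta> e x)"
proof -
  have com: "\<delta> j ((\<delta> i ^^ k) x) = (\<delta> i ^^ k) (\<delta> j x)" if "i < m" for i k x
    using assms that by (induction k) (auto simp: commuting_derivations_def fun_eq_iff)
  have "foldr (\<lambda>i. \<delta> i ^^ (e(j := Suc (e j))) i) xs x = \<delta> j (foldr (\<lambda>i. \<delta> i ^^ e i) xs x)"
    if "distinct xs" "set xs \<subseteq> {..<m}" "j \<in> set xs" for xs
    using that
  proof (induction xs)
    case (Cons i xs)
    show ?case
    proof (cases "i = j")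
      case True
      then have "foldr (\<lambda>i. \<delta> i ^^ (e(j := Suc (e j))) i) xs x = foldr (\<lambda>i. \<delta> i ^^ e i) xs x"
        using Cons.prems by (intro foldr_cong) auto
      then show ?thesis using True by simp
    next
      case False
      then show ?thesis using Cons com[of i] by simp
    qed
  qed simp
  from this[of "[0..<m]"] show ?thesis using assms(2) by (simp add: theta_def atLeast0LessThan)
qed

lemma theta_0: "theta m \<delta> (\<lambda>_. 0) x = x"
proof -
  have "foldr (\<lambda>_ y. y) xs x = x" for xs :: "nat list" by (induction xs) auto
  then show ?thesis by (simp add: theta_def)
qed

lemma deval_add: "deval m \<delta> a (p + q) = deval m \<delta> a p + deval m \<delta> a q"
  and deval_mult: "deval m \<delta> a (p * q) = deval m \<delta> a p * deval m \<delta> a q"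
  and deval_diff: "deval m \<delta> a (p - q) = deval m \<delta> a p - deval m \<delta> a q"
  and deval_power: "deval m \<delta> a (p ^ k) = deval m \<delta> a p ^ k"
  and deval_cst [simp]: "deval m \<delta> a (cst c) = c"
  and deval_Xv [simp]: "deval m \<delta> a (Xv v) = theta m \<delta> (snd v) (a ! fst v)"
  and deval_0 [simp]: "deval m \<delta> a 0 = 0" and deval_1 [simp]: "deval m \<delta> a 1 = 1"
  by (simp_all add: deval_ev ev_add ev_mult ev_diff ev_power)

lemma deval_dderiv:
  assumes "commuting_derivations m \<delta>" "j < m"
  shows "deval m \<delta> a (dderiv \<delta> j p) = \<delta> j (deval m \<delta> a p)"
  unfolding deval_ev dderiv_der
proof (rule ev_der[where Y = UNIV])
  show dj: "is_derivation (\<delta> j)" using assms by (simp add: commuting_derivations_def)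
  fix x y
  show "\<delta> j (x + y) = \<delta> j x + \<delta> j y" "\<delta> j (x * y) = x * \<delta> j y + \<delta> j x * y"
    using dj by (auto simp: is_derivation_def)
  fix v :: dvar
  show "ev (\<lambda>x. x) (\<lambda>v. theta m \<delta> (snd v) (a ! fst v)) (Xv (dv j v)) = \<delta> j (theta m \<delta> (snd v) (a ! fst v))"
    using theta_dv[OF assms] by (simp add: dv_def)
qed (simp_all add: polys_def)

lemma deval_append:
  "p \<in> polys (dvars m n) \<Longrightarrow> length a = n \<Longrightarrow> deval m \<delta> (a @ b) p = deval m \<delta> a p"
  unfolding deval_ev by (rule ev_cong) (auto simp: dvars_def nth_append)

lemma deval_take:
  "p \<in> polys (dvars m n) \<Longrightarrow> n \<le> length a \<Longrightarrow> deval m \<delta> (take n a) p = deval m \<delta> a p"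
  using deval_append[of p m n "take n a" \<delta> "drop n a"] by simp

lemma ideal_vanishing:
  assumes "commuting_derivations m \<delta>"
  shows "ideal_of (polys (dvars m n)) (dops m \<delta>) {p \<in> polys (dvars m n). \<forall>a\<in>S. deval m \<delta> a p = 0}"
proof -
  have *: "\<delta> j 0 = 0" "is_derivation (\<delta> j)" if "j < m" for j
    using assms is_derivation_0 that by (auto simp: commuting_derivations_def)
  have "dderiv \<delta> j p \<in> polys (dvars m n)" if "p \<in> polys (dvars m n)" "j < m" for j p
    unfolding dderiv_der by (rule der_polys[OF *(2)[OF that(2)] that(1)]) (use that(2) dv_dvars in auto)
  then show ?thesis
    unfolding ideal_of_def dops_def using *(1)
    by (auto simp: deval_add deval_mult deval_dderiv[OF assms])
qed

lemma hdiv_deval: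
  assumes "deval m \<delta> a (H lt A) \<noteq> 0" "h \<in> hdiv lt A W"
  shows "deval m \<delta> a h \<noteq> 0"
proof -
  obtain k h' where "h * h' = H lt A ^ k" using assms(2) by (auto simp: hdiv_def)
  then have "deval m \<delta> a h * deval m \<delta> a h' = deval m \<delta> a (H lt A) ^ k"
    by (metis deval_mult deval_power)
  then show ?thesis using assms(1) by auto
qed

text \<open>The polynomials vanishing at \<open>a\<close> form a differential ideal containing
  \<Lambda>, hence also \<open>h * p\<close> with \<open>h\<close> dividing a power of
  \<open>H\<close>, and \<open>h\<close> is nonzero at \<open>a\<close>. This replaces the infinite
  system \<open>P\<close> by a finite one.\<close>

lemma char_set_vanishing:
  fixes P :: "'a::field_char_0 dpoly set"
  assumes "is_ranking m n lt" "commuting_derivations m \<delta>" "char_set lt P \<Lambda>" "prime_dideal m \<delta> n P"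
    and a: "\<And>f. f \<in> \<Lambda> \<Longrightarrow> deval m \<delta> a f = 0" "deval m \<delta> a (H lt \<Lambda>) \<noteq> 0" and p: "p \<in> P"
  shows "deval m \<delta> a p = 0"
proof -
  let ?N = "{p \<in> polys (dvars m n). \<forall>a\<in>{a}. deval m \<delta> a p = 0}"
  have P: "prime_of (polys (dvars m n)) (dops m \<delta>) P" using assms(4) by (simp add: prime_dideal_prime_of)
  have "\<Lambda> \<subseteq> ?N" using a(1) assms(3) P by (auto simp: char_set_def prime_of_def ideal_of_def)
  then have "\<exists>h\<in>hdiv lt \<Lambda> (dvars m n). h * p \<in> ?N"
    using assms(2) by (intro char_set_generates[OF assms(1,3) P _ ideal_vanishing[OF assms(2)] _ p])
      (simp_all add: commuting_derivations_def)
  then obtain h where "h \<in> hdiv lt \<Lambda> (dvars m n)" "h * p \<in> ?N" by blast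
  then show ?thesis using hdiv_deval[OF a(2)] by (auto simp: deval_mult)
qed

lemma char_set_H_notin:
  fixes P :: "'a::field_char_0 dpoly set"
  assumes "is_ranking m n lt" "char_set lt P \<Lambda>" "prime_dideal m \<delta> n P"
  shows "H lt \<Lambda> \<in> polys (dvars m n)" "H lt \<Lambda> \<notin> P"
  using H_notin[OF assms(1,2) _ order_refl] assms(3) by (auto simp: prime_dideal_prime_of)


section \<open>Projections\<close>

text \<open>\<open>chevalley_step\<close> removes the variables of \<open>us\<close> from the last
  to the first; each is algebraic modulo \<open>Q\<close> over \<open>B\<close> and the ones before
  it.\<close>

lemma chevalley_chain:
  fixes Q :: "'a::field_char_0 dpoly set"
  assumes "prime_of (polys (B \<union> set us)) {} Q" "distinct us" "set us \<inter> B = {}"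
    and "\<And>i. i < length us \<Longrightarrow> \<exists>f\<in>Q \<inter> polys (B \<union> set (take (Suc i) us)). \<exists>k. coeff (U (us ! i) f) k \<notin> Q"
    and "G \<in> polys (B \<union> set us)" "G \<notin> Q"
  shows "\<exists>G'\<in>polys B. G' \<notin> Q \<and> (\<forall>p. prime_of (polys B) {} p \<longrightarrow> Q \<inter> polys B \<subseteq> p \<longrightarrow> G' \<notin> p \<longrightarrow>
      (\<exists>q. prime_of (polys (B \<union> set us)) {} q \<and> p \<subseteq> q \<and> Q \<subseteq> q \<and> G \<notin> q))"
  using assms
proof (induction us arbitrary: Q G rule: rev_induct)
  case Nil
  have "Q \<subseteq> polys B" using Nil.prems(1) by (auto simp: prime_of_def ideal_of_def)
  then show ?case using Nil.prems(5,6) by (intro bexI[of _ G]) (auto simp: Int_absorb2)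
next
  case (snoc v us)
  let ?Y = "B \<union> set us"
  have Y: "B \<union> set (us @ [v]) = insert v ?Y" "v \<notin> ?Y" using snoc.prems(2,3) by auto
  note Q = snoc.prems(1)[unfolded Y(1)]
  obtain f k where f: "f \<in> Q" "coeff (U v f) k \<notin> Q" using snoc.prems(4)[of "length us"] by auto
  note G = snoc.prems(5)[unfolded Y(1)] snoc.prems(6)
  obtain G1 where G1: "G1 \<in> polys ?Y" "G1 \<notin> Q"
    "\<And>p. prime_of (polys ?Y) {} p \<Longrightarrow> Q \<inter> polys ?Y \<subseteq> p \<Longrightarrow> G1 \<notin> p \<Longrightarrow>
      \<exists>q. prime_of (polys (insert v ?Y)) {} q \<and> p \<subseteq> q \<and> Q \<subseteq> q \<and> G \<notin> q"
    using chevalley_step[OF Q Y(2) f G] by blast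
  let ?Q = "Q \<inter> polys ?Y"
  have sub: "polys B \<subseteq> polys ?Y" "polys ?Y \<subseteq> polys (insert v ?Y)"
    using polys_mono[of _ B ?Y] polys_mono[of _ ?Y "insert v ?Y"] by blast+
  have "\<exists>G'\<in>polys B. G' \<notin> ?Q \<and> (\<forall>p. prime_of (polys B) {} p \<longrightarrow> ?Q \<inter> polys B \<subseteq> p \<longrightarrow> G' \<notin> p \<longrightarrow>
      (\<exists>q. prime_of (polys ?Y) {} q \<and> p \<subseteq> q \<and> ?Q \<subseteq> q \<and> G1 \<notin> q))"
  proof (rule snoc.IH)
    show "prime_of (polys ?Y) {} ?Q" by (rule prime_of_Int[OF Q]) (use sub in auto)
    fix i assume i: "i < length us"
    have t: "take (Suc i) (us @ [v]) = take (Suc i) us" "(us @ [v]) ! i = us ! i" using i by (simp_all add: nth_append)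
    obtain f k where f: "f \<in> Q" "f \<in> polys (B \<union> set (take (Suc i) us))" "coeff (U (us ! i) f) k \<notin> Q"
      using snoc.prems(4)[of i] i unfolding t by auto
    have "B \<union> set (take (Suc i) us) \<subseteq> ?Y" using set_take_subset[of "Suc i" us] by blast
    then have "f \<in> ?Q" using f(1) polys_mono[OF f(2)] by blast
    then show "\<exists>f\<in>?Q \<inter> polys (B \<union> set (take (Suc i) us)). \<exists>k. coeff (U (us ! i) f) k \<notin> ?Q"
      using f by blast
  qed (use snoc.prems(2,3) G1(1,2) in auto)
  then obtain G' where G': "G' \<in> polys B" "G' \<notin> ?Q"
    "\<And>p. prime_of (polys B) {} p \<Longrightarrow> ?Q \<inter> polys B \<subseteq> p \<Longrightarrow> G' \<notin> p \<Longrightarrow>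
      \<exists>q. prime_of (polys ?Y) {} q \<and> p \<subseteq> q \<and> ?Q \<subseteq> q \<and> G1 \<notin> q" by blast
  have "\<exists>q. prime_of (polys (insert v ?Y)) {} q \<and> p \<subseteq> q \<and> Q \<subseteq> q \<and> G \<notin> q"
    if p: "prime_of (polys B) {} p" "Q \<inter> polys B \<subseteq> p" "G' \<notin> p" for p
  proof -
    have "?Q \<inter> polys B \<subseteq> p" using p(2) by blast
    from G'(3)[OF p(1) this p(3)] obtain q1 where q1: "prime_of (polys ?Y) {} q1" "p \<subseteq> q1" "?Q \<subseteq> q1" "G1 \<notin> q1"
      by blast
    from G1(3)[OF q1(1,3,4)] show ?thesis using q1(2) by blast
  qed
  then show ?case using G'(1,2) sub(1) unfolding Y(1) by blast
qed

text \<open>An elimination ranking built from \<open>lt\<close>: all derivatives of the x (indices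
  below \<open>n\<close>) precede those of the y, so a polynomial whose leader belongs to an x
  contains no y.\<close>

definition elim_lt :: "nat \<Rightarrow> (dvar \<Rightarrow> dvar \<Rightarrow> bool) \<Rightarrow> dvar \<Rightarrow> dvar \<Rightarrow> bool" where
  "elim_lt n lt u v \<longleftrightarrow> (if fst v < n then fst u < n \<and> lt u v
     else fst u < n \<or> lt (fst u - n, snd u) (fst v - n, snd v))"

lemma elim_ranking:
  assumes "is_ranking m n lt"
  shows "is_ranking m (2 * n) (elim_lt n lt)"
proof -
  define c where "c u = (if fst u < n then u else (fst u - n, snd u))" for u :: dvar
  have c: "c u \<in> dvars m n" if "u \<in> dvars m (2 * n)" for u using that by (auto simp: c_def dvars_def)
  have cd: "c (dv j u) = dv j (c u)" "fst (dv j u) = fst u" for j u by (auto simp: c_def dv_def)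
  have lt: "elim_lt n lt u v \<longleftrightarrow> fst u < n \<and> \<not> fst v < n \<or> (fst u < n \<longleftrightarrow> fst v < n) \<and> lt (c u) (c v)" for u v
    by (auto simp: elim_lt_def c_def)
  have inj: "u = v" if "c u = c v" "fst u < n \<longleftrightarrow> fst v < n" for u v
    using that by (auto simp: c_def prod_eq_iff split: if_splits)
  note R = assms[unfolded is_ranking_def]
  show ?thesis
    unfolding is_ranking_def
  proof (intro conjI ballI allI impI)
    fix u assume u: "u \<in> dvars m (2 * n)"
    show "\<not> elim_lt n lt u u" using R c[OF u] by (simp add: lt)
    show "elim_lt n lt u (dv j u)" if "j < m" for j using R c[OF u] that by (simp add: lt cd)
    fix v assume v: "v \<in> dvars m (2 * n)"
    show "elim_lt n lt u v \<or> elim_lt n lt v u" if "u \<noteq> v"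
    proof (cases "fst u < n \<longleftrightarrow> fst v < n")
      case True
      then have "c u \<noteq> c v" using inj that by blast
      then have "lt (c u) (c v) \<or> lt (c v) (c u)" using R c[OF u] c[OF v] by blast
      then show ?thesis using True by (auto simp: lt)
    qed (auto simp: lt)
    show "elim_lt n lt (dv j u) (dv j v)" if "elim_lt n lt u v" "j < m" for j
    proof -
      have "lt (c u) (c v) \<longrightarrow> lt (dv j (c u)) (dv j (c v))" using R c[OF u] c[OF v] that(2) by blast
      then show ?thesis using that(1) by (auto simp: lt cd)
    qed
    fix w assume w: "w \<in> dvars m (2 * n)"
    show "elim_lt n lt u w" if "elim_lt n lt u v \<and> elim_lt n lt v w"
    proof -
      have "lt (c u) (c v) \<and> lt (c v) (c w) \<longrightarrow> lt (c u) (c w)" using R c[OF u] c[OF v] c[OF w] by blast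
      then show ?thesis using that by (auto simp: lt)
    qed
  qed
qed

text \<open>Specialises the x to \<open>a\<close> and leaves the y as variables.\<close>

definition subst_x :: "nat \<Rightarrow> (nat \<Rightarrow> 'a::field \<Rightarrow> 'a) \<Rightarrow> nat \<Rightarrow> 'a list \<Rightarrow> 'a dpoly \<Rightarrow> 'a dpoly" where
  "subst_x m \<delta> n a = ev cst (\<lambda>v. if fst v < n then cst (theta m \<delta> (snd v) (a ! fst v)) else Xv v)"

lemma subst_x_hom:
  "subst_x m \<delta> n a (p + q) = subst_x m \<delta> n a p + subst_x m \<delta> n a q"
  "subst_x m \<delta> n a (p * q) = subst_x m \<delta> n a p * subst_x m \<delta> n a q"
  "subst_x m \<delta> n a 0 = 0" "subst_x m \<delta> n a 1 = 1" "subst_x m \<delta> n a (cst c) = cst c"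
  "subst_x m \<delta> n a (sum f S) = (\<Sum>i\<in>S. subst_x m \<delta> n a (f i))"
  by (simp_all add: subst_x_def ev_add ev_mult ev_sum)

lemma subst_x_deval: "p \<in> polys (dvars m n) \<Longrightarrow> subst_x m \<delta> n a p = cst (deval m \<delta> a p)"
proof (induction p rule: polys_induct)
  case (Xv v)
  then show ?case by (auto simp: subst_x_def dvars_def)
qed (simp_all add: subst_x_hom deval_add deval_mult cst_add cst_mult)

lemma coeff_U_subst_x:
  "\<not> fst v < n \<Longrightarrow> coeff (U v (subst_x m \<delta> n a p)) k = subst_x m \<delta> n a (coeff (U v p) k)"
proof (induction p arbitrary: k rule: dpoly_induct)
  case (cst c)
  then show ?case by (simp add: subst_x_hom U_cst coeff_pCons split: nat.split)
next
  case (Xv u)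
  then show ?case
    by (auto simp: subst_x_def U_cst U_Xv coeff_pCons split: nat.split)
qed (simp_all add: subst_x_hom U_add U_mult coeff_mult)

text \<open>Let \<open>Gy\<close> be the part of a characteristic set of \<open>Q\<close> (for a ranking with \<open>x < y\<close>) with leaders among the
  \<open>y\<close>, and \<open>Hy\<close> the product of its initials and separants. After inverting \<open>Hy\<close>, every polynomial is
  modulo \<open>Q\<close> one in the variables \<open>B\<close>, which are no proper derivatives of leaders of \<open>Gy\<close>; of these only
  the finitely many leaders are algebraic over the others (\<open>B0\<close>), so that Chevalley's theorem applies.\<close>
theorem differential_projection:
  fixes Q :: "'a::field_char_0 dpoly set"
  assumes dcf: "is_DCF0 m \<delta>" and rk: "is_ranking m n lt" and Qd: "prime_dideal m \<delta> (2 * n) Q"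
  shows "\<exists>h\<in>polys (dvars m n). h \<notin> Q \<and> (\<forall>a. length a = n \<longrightarrow> (\<forall>f\<in>Q \<inter> polys (dvars m n). deval m \<delta> a f = 0) \<longrightarrow>
    deval m \<delta> a h \<noteq> 0 \<longrightarrow> (\<exists>b. length b = n \<and> (\<forall>f\<in>Q. deval m \<delta> (a @ b) f = 0)))"
proof -
  have com: "commuting_derivations m \<delta>" using dcf by (simp add: is_DCF0_def)
  then have d: "\<forall>j<m. is_derivation (\<delta> j)" by (simp add: commuting_derivations_def)
  let ?X = "dvars m n" and ?Y = "dvars m (2 * n)" and ?lt = "elim_lt n lt"
  note rk2 = elim_ranking[OF rk]
  have Q: "prime_of (polys ?Y) (dops m \<delta>) Q" using Qd by (simp add: prime_dideal_prime_of)
  note idQ = prime_ideal[OF Q] and subY = subring_polys[of ?Y]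
  have QY: "Q \<subseteq> polys ?Y" using idQ by (simp add: ideal_of_def)
  have XY: "?X \<subseteq> ?Y" by (auto simp: dvars_def)
  have Xfst: "v \<in> ?X \<longleftrightarrow> v \<in> ?Y \<and> fst v < n" for v by (auto simp: dvars_def)
  obtain \<Gamma> where cs: "char_set ?lt Q \<Gamma>" using char_set_exists[OF rk2 QY] by blast
  have \<Gamma>: "finite \<Gamma>" "\<Gamma> \<subseteq> Q" "autoreduced ?lt \<Gamma>" using cs by (auto simp: char_set_def autoreduced_def)
  have nc: "f \<in> polys ?Y" "vars f \<noteq> {}" "vars f \<subseteq> ?Y" if "f \<in> \<Gamma>" for f
    using \<Gamma> QY that by (auto simp: autoreduced_def polys_def)
  have ld: "leader ?lt f \<in> vars f" "\<And>v. v \<in> vars f \<Longrightarrow> v \<noteq> leader ?lt f \<Longrightarrow> ?lt v (leader ?lt f)"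
    "leader ?lt f \<in> ?Y" if "f \<in> \<Gamma>" for f
    using leader_in[OF rk2 nc(1,2)[OF that]] leader_dvars[OF rk2 nc(1,2)[OF that]] by blast+
  \<comment> \<open>By the elimination ranking, the elements of \<Gamma> outside \<open>Gx\<close>
    are those whose leader is a derivative of some y.\<close>
  define Gx where "Gx = {f \<in> \<Gamma>. vars f \<subseteq> ?X}"
  define Gy where "Gy = \<Gamma> - Gx"
  have G: "Gx \<subseteq> \<Gamma>" "Gy \<subseteq> \<Gamma>" "finite Gx" "finite Gy" "Gx \<union> Gy = \<Gamma>" "Gx \<inter> Gy = {}"
    using \<Gamma>(1) by (auto simp: Gx_def Gy_def)
  have ly: "\<not> fst (leader ?lt f) < n" if "f \<in> Gy" for f
  proof
    assume l: "fst (leader ?lt f) < n"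
    have f: "f \<in> \<Gamma>" using that G by blast
    have "fst v < n" if "v \<in> vars f" for v
      using ld(2)[OF f that] l by (cases "v = leader ?lt f") (auto simp: elim_lt_def)
    then have "vars f \<subseteq> ?X" using nc(3)[OF f] Xfst by blast
    then show False using that f by (simp add: Gx_def Gy_def)
  qed
  let ?Hx = "H ?lt Gx" and ?Hy = "H ?lt Gy"
  have HH: "H ?lt \<Gamma> = ?Hx * ?Hy"
    unfolding H_def G(5)[symmetric] by (rule prod.union_disjoint[OF G(3,4,6)])
  have Hx: "?Hx \<in> polys ?X" by (rule H_polys[OF G(3)]) (auto simp: Gx_def)
  have HQ: "?Hx \<notin> Q" "?Hy \<notin> Q" using H_notin[OF rk2 cs Q G(1)] H_notin[OF rk2 cs Q G(2)] by auto
  define B where "B = {v \<in> ?Y. \<forall>f\<in>Gy. \<not> proper_derivative v (leader ?lt f)}"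
  define L where "L = leader ?lt ` Gy"
  define B0 where "B0 = B - L"
  have BY: "B \<subseteq> ?Y" by (auto simp: B_def)
  have vB: "vars f \<subseteq> B" if f: "f \<in> Gy" for f
  proof
    fix v assume v: "v \<in> vars f"
    have f': "f \<in> \<Gamma>" using f G by blast
    have vY: "v \<in> ?Y" using v nc(3)[OF f'] by blast
    have "\<not> proper_derivative v (leader ?lt g)" if g: "g \<in> Gy" for g
    proof (cases "g = f")
      case True
      show ?thesis
      proof
        assume pd: "proper_derivative v (leader ?lt g)"
        then have "?lt (leader ?lt f) v" "v \<noteq> leader ?lt f"
          using dle_lt[OF rk2 ld(3)[OF f'] vY] True by (auto simp: proper_derivative_dle)
        moreover have "?lt v (leader ?lt f)" using ld(2)[OF f' v] calculation(2) by blast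
        ultimately show False using ranking_asym[OF rk2 vY ld(3)[OF f']] by simp
      qed
    next
      case False
      then have "reduced ?lt f g" using \<Gamma>(3) f' g G(2) by (auto simp: autoreduced_def)
      then show ?thesis using v unfolding reduced_def by blast
    qed
    then show "v \<in> B" using vY by (simp add: B_def)
  qed
  have LB: "L \<subseteq> B" using vB ld(1) G(2) unfolding L_def by blast
  then have BL: "B = B0 \<union> L" "B0 \<subseteq> B" by (auto simp: B0_def)
  have XB: "?X \<subseteq> B0"
  proof
    fix v assume v: "v \<in> ?X"
    then have "fst v < n" using Xfst by blast
    then show "v \<in> B0" using ly v XY by (auto simp: B0_def B_def L_def proper_derivative_def)
  qed
  have LY: "u \<in> ?Y" if "u \<in> L" for u using that LB BY by blast
  have finL: "finite L" using G(4) by (simp add: L_def)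
  have tot: "?lt u w" if "u \<in> L" "v \<in> L" "w \<in> L" "?lt u v" "?lt v w" for u v w
    using ranking_trans[OF rk2 LY LY LY, of u v w] that by simp
  have tot2: "?lt u v \<or> ?lt v u" if "u \<in> L" "v \<in> L" "u \<noteq> v" for u v
    using ranking_total[OF rk2 LY LY, of u v] that by simp
  have "\<exists>us. set us = L \<and> sorted_wrt ?lt us"
    by (rule sorted_list_exists[where R = ?lt, OF finL]) (rule tot tot2; assumption)+
  then obtain us where us: "set us = L" "sorted_wrt ?lt us" by blast
  note asym = ranking_asym[OF rk2]
  have dist: "distinct us"
    unfolding distinct_conv_nth
  proof (intro allI impI)
    fix i j assume "i < length us" "j < length us" "i \<noteq> j"
    then have "?lt (us ! i) (us ! j) \<or> ?lt (us ! j) (us ! i)" "us ! i \<in> ?Y" "us ! j \<in> ?Y"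
      using us LY nth_mem[of i us] nth_mem[of j us] by (auto simp: sorted_wrt_iff_nth_less neq_iff)
    then show "us ! i \<noteq> us ! j" using asym by metis
  qed
  define QB where "QB = Q \<inter> polys B"
  have pB: "polys B \<subseteq> polys ?Y" "polys B0 \<subseteq> polys B" "polys ?X \<subseteq> polys B0"
    using polys_mono BY BL(2) XB by blast+
  have QBp: "prime_of (polys B) {} QB" unfolding QB_def by (rule prime_of_Int[OF Q]) (use pB in auto)
  have HyB: "?Hy \<in> polys B" by (rule H_polys[OF G(4) vB])
  \<comment> \<open>The relation is the element of \<open>Gy\<close> with leader
    \<open>us ! i\<close>: its initial is a coefficient outside \<open>Q\<close>, and any other
    leader in it has lower rank, hence stands earlier in \<open>us\<close>.\<close>
  have rel: "\<exists>f\<in>QB \<inter> polys (B0 \<union> set (take (Suc i) us)). \<exists>k. coeff (U (us ! i) f) k \<notin> QB" if i: "i < length us" for i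
  proof -
    have "us ! i \<in> L" using i us(1) nth_mem by blast
    then obtain f where f: "f \<in> Gy" "us ! i = leader ?lt f" by (auto simp: L_def)
    have f': "f \<in> \<Gamma>" using f(1) G(2) by blast
    have "vars f \<subseteq> B0 \<union> set (take (Suc i) us)"
    proof
      fix v assume v: "v \<in> vars f"
      show "v \<in> B0 \<union> set (take (Suc i) us)"
      proof (cases "v \<in> L")
        case True
        then obtain j where j: "j < length us" "v = us ! j" using us(1) by (metis in_set_conv_nth)
        have "\<not> i < j"
        proof
          assume "i < j"
          then have "?lt (us ! i) v" using us(2) j by (auto simp: sorted_wrt_iff_nth_less)
          moreover have "v \<noteq> us ! i" using dist j i \<open>i < j\<close> by (simp add: nth_eq_iff_index_eq)
          then have "?lt v (us ! i)" using ld(2)[OF f' v] f(2) by simp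
          ultimately show False using asym LY True \<open>us ! i \<in> L\<close> by blast
        qed
        then have "v \<in> set (take (Suc i) us)" using j i by (auto simp: in_set_conv_nth intro!: exI[of _ j])
        then show ?thesis by blast
      next
        case False
        then show ?thesis using vB[OF f(1)] v by (auto simp: B0_def)
      qed
    qed
    then have "f \<in> polys (B0 \<union> set (take (Suc i) us))" by (simp add: polys_def)
    moreover have "f \<in> QB" using f' \<Gamma>(2) vB[OF f(1)] by (auto simp: QB_def polys_def)
    moreover have "coeff (U (us ! i) f) (vdeg (us ! i) f) \<notin> QB"
      using separant_initial_notin(1)[OF rk2 cs Q f'] by (simp add: initial_U f(2) QB_def)
    ultimately show ?thesis by blast
  qed
  have "\<exists>G'\<in>polys B0. G' \<notin> QB \<and> (\<forall>p. prime_of (polys B0) {} p \<longrightarrow> QB \<inter> polys B0 \<subseteq> p \<longrightarrow> G' \<notin> p \<longrightarrow>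
      (\<exists>q. prime_of (polys (B0 \<union> set us)) {} q \<and> p \<subseteq> q \<and> QB \<subseteq> q \<and> ?Hy \<notin> q))"
  proof (rule chevalley_chain[OF _ dist _ rel])
    show "prime_of (polys (B0 \<union> set us)) {} QB" "?Hy \<in> polys (B0 \<union> set us)"
      using QBp HyB unfolding us(1) BL(1)[symmetric] .
    show "set us \<inter> B0 = {}" unfolding us(1) B0_def by blast
    show "?Hy \<notin> QB" using HQ(2) by (simp add: QB_def)
  qed
  then obtain G0 where G0: "G0 \<in> polys B0" "G0 \<notin> QB" and ext: "\<And>p. prime_of (polys B0) {} p \<Longrightarrow> QB \<inter> polys B0 \<subseteq> p \<Longrightarrow> G0 \<notin> p \<Longrightarrow>
      \<exists>q. prime_of (polys B) {} q \<and> p \<subseteq> q \<and> QB \<subseteq> q \<and> ?Hy \<notin> q"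
    unfolding us(1) BL(1)[symmetric] by blast
  have G0Q: "G0 \<notin> Q" using G0 pB by (auto simp: QB_def)
  \<comment> \<open>Specialising could turn \<open>G0\<close> into 0. Taking a coefficient outside
    \<open>Q\<close>, one y-derivative at a time, ends with an \<open>h\<close> in the x whose
    nonvanishing prevents this.\<close>
  have spec: "\<exists>h\<in>polys ?X. h \<notin> Q \<and> (\<forall>a. deval m \<delta> a h \<noteq> 0 \<longrightarrow> subst_x m \<delta> n a g \<noteq> 0)"
    if "finite V" "V \<subseteq> ?Y - ?X" "g \<in> polys (?X \<union> V)" "g \<notin> Q" for V g
    using that
  proof (induction V arbitrary: g rule: finite_induct)
    case empty
    then show ?case by (intro bexI[of _ g]) (auto simp: subst_x_deval)
  next
    case (insert v V)
    have gv: "g \<in> polys (insert v (?X \<union> V))" using insert.prems(2) by simp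
    have "\<exists>k. coeff (U v g) k \<notin> Q"
    proof (rule ccontr)
      assume n: "\<nexists>k. coeff (U v g) k \<notin> Q"
      have "Xv v \<in> polys ?Y" using insert.prems(1) by simp
      then have "(\<Sum>k\<le>degree (U v g). coeff (U v g) k * Xv v ^ k) \<in> Q"
        using n by (intro ideal_sum[OF subY idQ] ideal_mult2[OF subY idQ]) (auto intro: polys_power)
      then show False using insert.prems(3) U_expand[of g v] by simp
    qed
    then obtain k where k: "coeff (U v g) k \<notin> Q" by blast
    have vn: "\<not> fst v < n" using insert.prems(1) Xfst[of v] by blast
    have "V \<subseteq> ?Y - ?X" using insert.prems(1) by blast
    from insert.IH[OF this coeff_U_polys'[OF gv] k] obtain h where h: "h \<in> polys ?X" "h \<notin> Q"
      "\<And>a. deval m \<delta> a h \<noteq> 0 \<Longrightarrow> subst_x m \<delta> n a (coeff (U v g) k) \<noteq> 0" by blast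
    have "subst_x m \<delta> n a g \<noteq> 0" if "deval m \<delta> a h \<noteq> 0" for a
      using h(3)[OF that] coeff_U_subst_x[OF vn, of m \<delta> a g k] by auto
    then show ?case using h(1,2) by blast
  qed
  have "G0 \<in> polys (?X \<union> (vars G0 - ?X))" by (auto simp: polys_def)
  moreover have "vars G0 - ?X \<subseteq> ?Y - ?X" using G0(1) BL(2) BY by (auto simp: polys_def)
  ultimately obtain h1 where h1: "h1 \<in> polys ?X" "h1 \<notin> Q" "\<And>a. deval m \<delta> a h1 \<noteq> 0 \<Longrightarrow> subst_x m \<delta> n a G0 \<noteq> 0"
    using spec[of "vars G0 - ?X" G0] G0Q by auto
  let ?P = "Q \<inter> polys ?X"
  have dX: "dderiv \<delta> j p \<in> polys ?X" if "p \<in> polys ?X" "j < m" for p j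
    unfolding dderiv_der by (rule der_polys[OF _ that(1)]) (use that(2) d dv_dvars in auto)
  have dQ: "dderiv \<delta> j p \<in> Q" if "p \<in> Q" "j < m" for p j
    using idQ that by (auto simp: ideal_of_def dops_def)
  have diffY: "diffring (polys ?Y) (dops m \<delta>)" by (rule diffring_dops[OF d]) auto
  let ?N = "gen (polys ?Y) ?P"
  have N: "ideal_of (polys ?Y) (dops m \<delta>) ?N"
    by (rule ideal_gen[OF diffY]) (use QY dX dQ in \<open>auto simp: dops_def intro!: gen.base\<close>)
  have NQ: "?N \<subseteq> Q" by (rule gen_subset[OF idQ]) blast
  \<comment> \<open>\<open>q\<close> contains no leader of \<open>Gy\<close> and no proper
    derivative of one. Reduction by \<open>Gx\<close> raises no degree in the y, so the remainder is
    reduced with respect to all of \<Gamma> and is 0. Thus \<open>h * q\<close> lies in the ideal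
    generated by \<open>?P\<close>, which \<open>subst_x\<close> sends to 0.\<close>
  have killQ: "subst_x m \<delta> n a q = 0"
    if a: "\<forall>f\<in>?P. deval m \<delta> a f = 0" "deval m \<delta> a ?Hx \<noteq> 0" and q: "q \<in> Q" "q \<in> polys B0" for a q
  proof -
    have Gx: "Gx \<subseteq> polys ?Y" "Gx \<subseteq> ?N" "\<And>f. f \<in> Gx \<Longrightarrow> vars f \<noteq> {}" "\<And>f. f \<in> Gx \<Longrightarrow> vars f \<subseteq> ?X"
      using nc G(1) \<Gamma>(2) by (auto simp: Gx_def polys_def intro: gen.base)
    obtain h r where h: "h \<in> hdiv ?lt Gx (\<Union>f\<in>Gx. vars f)" "r \<in> polys ?Y" "\<forall>f\<in>Gx. reduced ?lt r f"
      "h * q - r \<in> ?N" "\<forall>w. w \<notin> ?X \<longrightarrow> vdeg w r \<le> vdeg w q"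
      using reduction[OF rk2 G(3) Gx(1,3,2) N d XY dv_dvars Gx(4), of q] q(1) QY by blast
    have hX: "h \<in> hdiv ?lt Gx ?X" using hdiv_mono[OF h(1)] Gx(4) by blast
    have hY: "h \<in> polys ?Y" using hdiv_polys[OF hX] polys_mono XY by blast
    have "h * q \<in> Q" by (rule ideal_mult[OF subY idQ hY q(1)])
    then have rQ: "r \<in> Q" using ideal_cong[OF subY idQ, of "h * q" r] h(4) NQ by blast
    have "reduced ?lt r f" if f: "f \<in> Gy" for f
      unfolding reduced_def
    proof (intro conjI ballI)
      have "leader ?lt f \<notin> ?X" using ly[OF f] Xfst by blast
      moreover have "leader ?lt f \<notin> vars q" using f q(2) by (auto simp: polys_def B0_def L_def)
      ultimately have "vdeg (leader ?lt f) r = 0"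
        using h(5) vdeg_0_iff[of "leader ?lt f" q] by (metis le_zero_eq)
      moreover have "0 < vdeg (leader ?lt f) f"
        using ld(1) f G(2) vdeg_0_iff[of "leader ?lt f" f] by (metis gr0I subsetD)
      ultimately show "vdeg (leader ?lt f) r < vdeg (leader ?lt f) f" by simp
      fix v assume v: "v \<in> vars r"
      show "\<not> proper_derivative v (leader ?lt f)"
      proof
        assume pd: "proper_derivative v (leader ?lt f)"
        then have "v \<notin> ?X" using ly[OF f] Xfst[of v] by (simp add: proper_derivative_def)
        then have "vdeg v r \<le> vdeg v q" using h(5) by blast
        then have "v \<in> vars q" using v vdeg_0_iff[of v r] vdeg_0_iff[of v q] by (metis le_zero_eq)
        then have "v \<in> B" using q(2) BL(2) by (auto simp: polys_def)
        then show False using pd f by (auto simp: B_def)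
      qed
    qed
    then have "r = 0" using char_set_reduced_0[OF rk2 cs Q rQ] h(3) G(5) by blast
    then have hq: "h * q \<in> ?N" using h(4) by simp
    have "subst_x m \<delta> n a x = 0" if "x \<in> ?N" for x
      using that by induction (use a(1) in \<open>auto simp: subst_x_hom subst_x_deval\<close>)
    from this[OF hq] have "cst (deval m \<delta> a h) * subst_x m \<delta> n a q = 0"
      using subst_x_deval[OF hdiv_polys[OF hX]] by (simp add: subst_x_hom)
    moreover have "deval m \<delta> a h \<noteq> 0" by (rule hdiv_deval[OF a(2) hX])
    ultimately show ?thesis using dpoly_mult_eq_0 by fastforce
  qed
  show ?thesis
  proof (intro bexI[of _ "h1 * ?Hx"] conjI allI impI)
    show "h1 * ?Hx \<in> polys ?X" using h1(1) Hx by auto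
    show "h1 * ?Hx \<notin> Q" using prime_mult[OF Q] h1 Hx HQ(1) polys_mono XY by blast
    fix a :: "'a list" assume len: "length a = n" and aP: "\<forall>f\<in>?P. deval m \<delta> a f = 0"
      and ah: "deval m \<delta> a (h1 * ?Hx) \<noteq> 0"
    have ah: "deval m \<delta> a h1 \<noteq> 0" "deval m \<delta> a ?Hx \<noteq> 0" using ah by (auto simp: deval_mult)
    \<comment> \<open>The kernel of specialising x to \<open>a\<close>, prime because the target is
      a domain. The algebraic elimination extends it to a prime \<open>q0\<close> that also covers
      the leaders.\<close>
    define p0 where "p0 = {p \<in> polys B0. subst_x m \<delta> n a p = 0}"
    have "prime_of (polys B0) {} p0"
      unfolding prime_of_def ideal_of_def p0_def
      by (auto simp: subst_x_hom dest: dpoly_mult_eq_0)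
    moreover have "QB \<inter> polys B0 \<subseteq> p0" using killQ[OF aP ah(2)] by (auto simp: QB_def p0_def)
    moreover have "G0 \<notin> p0" using h1(3)[OF ah(1)] by (simp add: p0_def)
    ultimately obtain q0 where q0: "prime_of (polys B) {} q0" "p0 \<subseteq> q0" "QB \<subseteq> q0" "?Hy \<notin> q0"
      using ext by blast
    note id0 = prime_ideal[OF q0(1)] and subB = subring_polys[of B]
    \<comment> \<open>Polynomials that reduction by \<open>Gy\<close> sends into \<open>q0\<close>:
      in effect the extension of \<open>q0\<close> to all derivatives after inverting
      \<open>?Hy\<close>. It is used only as an ideal that contains no power of
      \<open>?Hy\<close>.\<close>
    define T where "T = {p \<in> polys ?Y. \<exists>h\<in>hdiv ?lt Gy B. \<exists>b\<in>q0. h * p - b \<in> Q}"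
    have hB: "h \<in> polys B" "h \<in> polys ?Y" if "h \<in> hdiv ?lt Gy B" for h using hdiv_polys[OF that] pB by blast+
    have q0B: "q0 \<subseteq> polys B" "q0 \<subseteq> polys ?Y" using id0 pB by (auto simp: ideal_of_def)
    have T: "ideal_of (polys ?Y) {} T"
      unfolding ideal_of_def
    proof (intro conjI ballI)
      show "0 \<in> T" using hdiv_1 ideal_0[OF subB id0] ideal_0[OF subY idQ] by (force simp: T_def)
      fix x assume x: "x \<in> T"
      then obtain h b where h: "x \<in> polys ?Y" "h \<in> hdiv ?lt Gy B" "b \<in> q0" "h * x - b \<in> Q" by (auto simp: T_def)
      { fix y assume "y \<in> T"
        then obtain h' b' where h': "y \<in> polys ?Y" "h' \<in> hdiv ?lt Gy B" "b' \<in> q0" "h' * y - b' \<in> Q" by (auto simp: T_def)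
        have "(h * h') * (x + y) - (h' * b + h * b') = h' * (h * x - b) + h * (h' * y - b')"
          by (simp add: algebra_simps)
        also have "\<dots> \<in> Q"
          using ideal_add[OF subY idQ ideal_mult[OF subY idQ hB(2)[OF h'(2)] h(4)] ideal_mult[OF subY idQ hB(2)[OF h(2)] h'(4)]] .
        finally have "(h * h') * (x + y) - (h' * b + h * b') \<in> Q" .
        moreover have "h' * b + h * b' \<in> q0"
          using ideal_add[OF subB id0 ideal_mult[OF subB id0 hB(1)[OF h'(2)] h(3)] ideal_mult[OF subB id0 hB(1)[OF h(2)] h'(3)]] .
        ultimately show "x + y \<in> T" using hdiv_mult[OF h(2) h'(2)] h(1) h'(1) by (auto simp: T_def) }
      { fix t :: "'a dpoly" assume t: "t \<in> polys ?Y"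
        have Gy: "Gy \<subseteq> polys ?Y" "Gy \<subseteq> Q" "\<And>f. f \<in> Gy \<Longrightarrow> vars f \<noteq> {}" "\<And>f. f \<in> Gy \<Longrightarrow> vars f \<subseteq> ?Y"
          using nc G(2) \<Gamma>(2) by auto
        \<comment> \<open>\<open>t\<close> may contain derivatives outside \<open>B\<close>; it is
          first reduced to some \<open>r\<close> in \<open>polys B\<close>, by which
          \<open>q0\<close> may be multiplied.\<close>
        obtain g r where g: "g \<in> hdiv ?lt Gy (\<Union>f\<in>Gy. vars f)" "r \<in> polys ?Y" "\<forall>f\<in>Gy. reduced ?lt r f" "g * t - r \<in> Q"
          using reduction[OF rk2 G(4) Gy(1,3,2) idQ d order_refl dv_dvars Gy(4) t] by blast
        have gB: "g \<in> hdiv ?lt Gy B" using hdiv_mono[OF g(1)] vB by blast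
        have "vars r \<subseteq> B" using g(2,3) unfolding B_def reduced_def polys_def by blast
        then have rB: "r \<in> polys B" by (simp add: polys_def)
        have "b \<in> polys ?Y" "g * t \<in> polys ?Y" using h(3) q0B hB(2)[OF gB] t by auto
        then have "(g * t) * (h * x - b) + b * (g * t - r) \<in> Q"
          using ideal_add[OF subY idQ ideal_mult[OF subY idQ _ h(4)] ideal_mult[OF subY idQ _ g(4)]] by blast
        then have "(g * h) * (t * x) - r * b \<in> Q" by (simp add: algebra_simps)
        moreover have "r * b \<in> q0" by (rule ideal_mult[OF subB id0 rB h(3)])
        ultimately show "t * x \<in> T" using hdiv_mult[OF gB h(2)] t h(1) by (auto simp: T_def) }
    qed (auto simp: T_def)
    define Ma where "Ma = {p \<in> polys ?X. \<forall>a\<in>{a}. deval m \<delta> a p = 0}"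
    have Ma: "ideal_of (polys ?X) (dops m \<delta>) Ma" unfolding Ma_def by (rule ideal_vanishing[OF com])
    \<comment> \<open>Generated by \<open>Q\<close> and the vanishing ideal of \<open>a\<close>,
      hence differential. Its containment in \<open>T\<close> shows that it contains no power of
      \<open>?Hy\<close>.\<close>
    let ?J = "gen (polys ?Y) (Q \<union> Ma)"
    have pXY: "polys ?X \<subseteq> polys ?Y" using polys_mono XY by blast
    have J: "ideal_of (polys ?Y) (dops m \<delta>) ?J"
    proof (rule ideal_gen[OF diffY])
      show "Q \<union> Ma \<subseteq> polys ?Y" using QY pXY by (auto simp: Ma_def)
      show "e g \<in> ?J" if "e \<in> dops m \<delta>" "g \<in> Q \<union> Ma" for e g
      proof (rule gen.base)
        show "e g \<in> Q \<union> Ma" using that Ma idQ by (auto simp: ideal_of_def)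
      qed
    qed
    have "Q \<union> Ma \<subseteq> T"
    proof
      fix x assume "x \<in> Q \<union> Ma"
      then show "x \<in> T"
      proof
        assume x: "x \<in> Q"
        then have "1 * x - 0 \<in> Q" by simp
        then show ?thesis using hdiv_1[of ?lt Gy B] ideal_0[OF subB id0] x QY unfolding T_def by blast
      next
        assume "x \<in> Ma"
        then have x: "x \<in> polys ?X" "deval m \<delta> a x = 0" by (auto simp: Ma_def)
        then have "x \<in> p0" using pB by (auto simp: p0_def subst_x_deval)
        moreover have "1 * x - x \<in> Q" using ideal_0[OF subY idQ] by simp
        ultimately show ?thesis using hdiv_1[of ?lt Gy B] q0(2) x(1) pXY unfolding T_def by blast
      qed
    qed
    then have JT: "?J \<subseteq> T" by (rule gen_subset[OF T])
    have HyT: "?Hy ^ k \<notin> T" for k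
    proof
      assume "?Hy ^ k \<in> T"
      then obtain h b where h: "h \<in> hdiv ?lt Gy B" "b \<in> q0" "h * ?Hy ^ k - b \<in> Q" by (auto simp: T_def)
      have "h * ?Hy ^ k - b \<in> polys B" using hB(1)[OF h(1)] HyB h(2) q0B by auto
      then have "h * ?Hy ^ k - b \<in> q0" using h(3) q0(3) by (auto simp: QB_def)
      then have "h * ?Hy ^ k \<in> q0" using ideal_cong[OF subB id0] h(2) by blast
      then have "h \<in> q0 \<or> ?Hy ^ k \<in> q0" using prime_mult[OF q0(1) hB(1)[OF h(1)] polys_power[OF HyB]] by blast
      moreover have "h \<notin> q0" using hdiv_notin[OF q0(1) _ h(1)] HyB q0(4) by blast
      ultimately show False using prime_power[OF q0(1) subB HyB] q0(4) by blast
    qed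
    have HyY: "?Hy \<in> polys ?Y" using HyB pB by blast
    obtain P where P: "prime_of (polys ?Y) (dops m \<delta>) P" "?J \<subseteq> P" "P \<inter> range (\<lambda>k. ?Hy ^ k) = {}"
    proof (rule prime_avoiding[OF diffY J, of "range (\<lambda>k. ?Hy ^ k)"])
      show "range (\<lambda>k. ?Hy ^ k) \<subseteq> polys ?Y" using HyY by auto
      show "1 \<in> range (\<lambda>k. ?Hy ^ k)" by (metis power_0 rangeI)
      show "x * y \<in> range (\<lambda>k. ?Hy ^ k)" if "x \<in> range (\<lambda>k. ?Hy ^ k)" "y \<in> range (\<lambda>k. ?Hy ^ k)" for x y
        using that by (auto simp flip: power_add)
      show "?J \<inter> range (\<lambda>k. ?Hy ^ k) = {}" using JT HyT by blast
    qed
    \<comment> \<open>The equations \<open>x = a\<close>. Together with \<Gamma> and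
      \<open>?Hy \<noteq> 0\<close> they form the finite system; that \<open>?Hx\<close> is nonzero
      is already known at \<open>a\<close>.\<close>
    define E where "E = (\<lambda>i. Xv (i, \<lambda>_. 0) - cst (a ! i)) ` {..<n}"
    have "E \<subseteq> Ma" by (auto simp: E_def Ma_def dvars_def deval_diff theta_0)
    then have EP: "E \<subseteq> P" "E \<subseteq> polys ?Y" using P(2) gen.base[of _ "Q \<union> Ma" "polys ?Y"] pXY by (auto simp: Ma_def)
    have GP: "\<Gamma> \<subseteq> P" using P(2) gen.base[of _ "Q \<union> Ma" "polys ?Y"] \<Gamma>(2) by blast
    have "?Hy \<notin> P" using P(3) by (metis disjoint_iff power_one_right rangeI)
    then have "\<exists>P. prime_dideal m \<delta> (2 * n) P \<and> \<Gamma> \<union> E \<subseteq> P \<and> ?Hy \<notin> P"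
      using P(1) EP GP by (intro exI[of _ P]) (auto simp: prime_dideal_prime_of)
    moreover have "finite (\<Gamma> \<union> E)" "\<Gamma> \<union> E \<subseteq> dpolys m (2 * n)" "?Hy \<in> dpolys m (2 * n)"
      using \<Gamma>(1) nc(1) EP(2) HyY by (auto simp: E_def dpolys_eq)
    ultimately obtain c where c: "length c = 2 * n" "\<forall>f\<in>\<Gamma> \<union> E. deval m \<delta> c f = 0" "deval m \<delta> c ?Hy \<noteq> 0"
      using dcf unfolding is_DCF0_def by blast
    have "take n c = a"
    proof (rule nth_equalityI)
      fix i assume "i < length (take n c)"
      then have i: "i < n" using c(1) by simp
      then have "Xv (i, \<lambda>_. 0) - cst (a ! i) \<in> E" by (auto simp: E_def)
      then have "deval m \<delta> c (Xv (i, \<lambda>_. 0) - cst (a ! i)) = 0" using c(2) by blast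
      then show "take n c ! i = a ! i" using i by (simp add: deval_diff theta_0)
    qed (use c(1) len in simp)
    then have ca: "c = a @ drop n c" by (metis append_take_drop_id)
    have "deval m \<delta> c ?Hx = deval m \<delta> a ?Hx" using deval_append[OF Hx len] ca by metis
    then have "deval m \<delta> c (H ?lt \<Gamma>) \<noteq> 0" using ah(2) c(3) by (simp add: HH deval_mult)
    then have "\<forall>f\<in>Q. deval m \<delta> c f = 0"
      using char_set_vanishing[OF rk2 com cs Qd, of c] c(2) by blast
    then show "\<exists>b. length b = n \<and> (\<forall>f\<in>Q. deval m \<delta> (a @ b) f = 0)"
      using c(1) ca by (intro exI[of _ "drop n c"]) auto
  qed
qed


section \<open>The geometric axioms\<close>

lemma prime_of_preimage:
  assumes I: "prime_of B E' I" and A: "subring A" "f ` A \<subseteq> B"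
    and f: "\<And>x y. f (x + y) = f x + f y" "\<And>x y. f (x * y) = f x * f y" "f 1 = 1"
    and E: "\<And>e x. e \<in> E \<Longrightarrow> x \<in> A \<Longrightarrow> e x \<in> A \<and> (\<exists>e'\<in>E'. f (e x) = e' (f x))"
  shows "prime_of A E {x \<in> A. f x \<in> I}"
proof -
  have f0: "f 0 = 0" using f(1)[of 0 0] by simp
  have fB: "f x \<in> B" if "x \<in> A" for x using A(2) that by blast
  have id: "0 \<in> I" "\<And>x y. x \<in> I \<Longrightarrow> y \<in> I \<Longrightarrow> x + y \<in> I" "\<And>a x. a \<in> B \<Longrightarrow> x \<in> I \<Longrightarrow> a * x \<in> I"
    "\<And>e x. e \<in> E' \<Longrightarrow> x \<in> I \<Longrightarrow> e x \<in> I"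
    using prime_ideal[OF I] by (simp_all add: ideal_of_def)
  have AA: "0 \<in> A" "\<And>x y. x \<in> A \<Longrightarrow> y \<in> A \<Longrightarrow> x + y \<in> A" "\<And>x y. x \<in> A \<Longrightarrow> y \<in> A \<Longrightarrow> x * y \<in> A"
    using A(1) by (simp_all add: subring_def)
  show ?thesis
    unfolding prime_of_def ideal_of_def
  proof (intro conjI ballI impI)
    show "0 \<in> {x \<in> A. f x \<in> I}" using AA f0 id by simp
    show "1 \<notin> {x \<in> A. f x \<in> I}" using I f(3) by (simp add: prime_of_def)
    fix x assume x: "x \<in> {x \<in> A. f x \<in> I}"
    show "x + y \<in> {x \<in> A. f x \<in> I}" if "y \<in> {x \<in> A. f x \<in> I}" for y
      using x that AA(2) id(2) f(1) by simp
    show "a * x \<in> {x \<in> A. f x \<in> I}" if "a \<in> A" for a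
      using x that AA(3) id(3)[OF fB] f(2) by simp
    show "e x \<in> {x \<in> A. f x \<in> I}" if e: "e \<in> E" for e
    proof -
      obtain e' where "e x \<in> A" "e' \<in> E'" "f (e x) = e' (f x)" using E[OF e, of x] x by auto
      then show ?thesis using x id(4) by simp
    qed
  next
    fix x y assume xy: "x \<in> A" "y \<in> A" "x * y \<in> {x \<in> A. f x \<in> I}"
    then have "f x \<in> I \<or> f y \<in> I" using prime_mult[OF I fB fB, of x y] f(2) by simp
    then show "x \<in> {x \<in> A. f x \<in> I} \<or> y \<in> {x \<in> A. f x \<in> I}" using xy by simp
  qed auto
qed

lemma theta_cong: "(\<And>j. j < m \<Longrightarrow> e j = e' j) \<Longrightarrow> theta m \<delta> e x = theta m \<delta> e' x"
  unfolding theta_def by (rule foldr_cong) auto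

text \<open>\<open>D\<close> has the last index, so \<open>foldr\<close> applies its powers
  first.\<close>

lemma theta_Suc: "theta (Suc m) (\<delta>(m := D)) e x = theta m \<delta> e ((D ^^ e m) x)"
proof -
  have "foldr (\<lambda>j. (\<delta>(m := D)) j ^^ e j) [0..<m] y = foldr (\<lambda>j. \<delta> j ^^ e j) [0..<m] y" for y
    by (rule foldr_cong) auto
  then show ?thesis by (simp add: theta_def)
qed

lemma deval_Suc:
  "p \<in> polys (dvars m n) \<Longrightarrow> deval (Suc m) (\<delta>(m := D)) a p = deval m \<delta> a p"
  unfolding deval_ev by (rule ev_cong) (auto simp: theta_Suc dvars_def)

lemma dvars_Suc: "dvars m n = {u \<in> dvars (Suc m) n. snd u m < Suc 0}"
  unfolding dvars_def by (auto simp: le_Suc_eq Suc_le_eq) (metis le_neq_implies_less)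

lemma dderiv_upd: "j \<noteq> m \<Longrightarrow> dderiv (\<delta>(m := D)) j = dderiv \<delta> j"
  by (simp add: dderiv_der)

lemma dops_Suc: "dops m \<delta> \<subseteq> dops (Suc m) (\<delta>(m := D))"
  by (auto simp: dops_def) (metis dderiv_upd less_SucI less_irrefl)

lemma ev_rename_dderiv:
  assumes "is_derivation (\<delta> j)" "\<And>v. \<rho> (dv j v) = dv j (\<rho> v)"
  shows "ev cst (\<lambda>v. Xv (\<rho> v)) (dderiv \<delta> j p) = dderiv \<delta> j (ev cst (\<lambda>v. Xv (\<rho> v)) p)"
  unfolding dderiv_der
  by (rule ev_der[where Y = UNIV])
    (use assms in \<open>simp_all add: der_add der_mult polys_def\<close>)

lemma deval_rename:
  "p \<in> polys Y \<Longrightarrow> (\<And>v. v \<in> Y \<Longrightarrow> theta m \<delta> (snd (\<rho> v)) (a ! fst (\<rho> v)) = theta k \<epsilon> (snd v) (b ! fst v)) \<Longrightarrow>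
    deval m \<delta> a (ev cst (\<lambda>v. Xv (\<rho> v)) p) = deval k \<epsilon> b p"
  unfolding deval_ev by (subst ev_ev) (auto intro!: ev_cong)

lemma rename_inverse:
  "p \<in> polys Y \<Longrightarrow> (\<And>v. v \<in> Y \<Longrightarrow> \<rho>' (\<rho> v) = v) \<Longrightarrow>
    ev cst (\<lambda>v. Xv (\<rho>' v)) (ev cst (\<lambda>v. Xv (\<rho> v)) p) = p"
  by (subst ev_ev) (auto intro: ev_cst_id)

lemma DCF0_solution:
  assumes "is_DCF0 m \<delta>" "prime_dideal m \<delta> n P" "finite F" "F \<subseteq> P" "g \<in> polys (dvars m n)" "g \<notin> P"
  shows "\<exists>a. length a = n \<and> (\<forall>f\<in>F. deval m \<delta> a f = 0) \<and> deval m \<delta> a g \<noteq> 0"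
proof -
  have "F \<subseteq> dpolys m n" using assms(2,4) by (auto simp: prime_dideal_def)
  then show ?thesis using assms unfolding is_DCF0_def dpolys_eq by blast
qed

section \<open>The two implications for fixed commuting derivations\<close>

context
  fixes m :: nat and \<delta> :: "nat \<Rightarrow> 'a::field_char_0 \<Rightarrow> 'a" and D :: "'a \<Rightarrow> 'a"
  assumes d: "\<forall>j<m. is_derivation (\<delta> j)" and D: "is_derivation D"
    and com: "\<forall>i<m. \<forall>j<m. \<delta> i \<circ> \<delta> j = \<delta> j \<circ> \<delta> i" and comD: "\<forall>j<m. \<delta> j \<circ> D = D \<circ> \<delta> j"
begin

private lemma cd: "commuting_derivations m \<delta>"
  using d com by (simp add: commuting_derivations_def)

private lemma cd_Suc: "commuting_derivations (Suc m) (\<delta>(m := D))"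
  using d D com comD by (auto simp: commuting_derivations_def less_Suc_eq)

private lemma tau_dderiv:
  assumes "j < m"
  shows "tau D n (dderiv \<delta> j p) = dderiv \<delta> j (tau D n p)"
proof -
  have "is_derivation (\<delta> j)" "\<And>x. D (\<delta> j x) = \<delta> j (D x)" using d comD assms by (auto simp: fun_eq_iff)
  then show ?thesis unfolding tau_der dderiv_der
    using D by (intro der_der_commute[where Y = UNIV]) (auto simp: polys_def dv_def)
qed

text \<open>A prime for Delta alone extends to one for Delta and \<open>D\<close> with the same part
  of order 0 in \<open>D\<close>, and on polynomials of that order both evaluations agree.\<close>

lemma DCF0_reduct:
  assumes dcf: "is_DCF0 (Suc m) (\<delta>(m := D))"
  shows "is_DCF0 m \<delta>"
  unfolding is_DCF0_def
proof (intro conjI allI impI)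
  fix n F g assume A: "finite F \<and> F \<subseteq> dpolys m n \<and> g \<in> dpolys m n \<and> (\<exists>P. prime_dideal m \<delta> n P \<and> F \<subseteq> P \<and> g \<notin> P)"
  then obtain P where P: "prime_dideal m \<delta> n P" "F \<subseteq> P" "g \<notin> P" by blast
  have Pp: "prime_of (polys (dvars m n)) (dops m \<delta>) P" using P(1) by (simp add: prime_dideal_prime_of)
  \<comment> \<open>No derivative has order below 0 in \<open>D\<close>, so \<open>q\<close> is a
    constant, and a prime contains no constant but 0.\<close>
  have DP: "dderiv (\<delta>(m := D)) m q \<in> P" if "q \<in> P" "q \<in> polys {u \<in> dvars (Suc m) n. snd u m < 0}" for q
  proof -
    have "vars q = {}" using that(2) by (simp add: polys_def)
    then have "q = 0" by (rule prime_const[OF Pp that(1)])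
    then show ?thesis using that(1) D by (simp add: dderiv_der der_0)
  qed
  obtain R where R: "prime_dideal (Suc m) (\<delta>(m := D)) n R" "R \<inter> polys (dvars m n) = P"
    using extend_derivation[OF d D comD, of n 0 P] Pp DP unfolding dvars_Suc[of m n] by blast
  have sub: "polys (dvars m n) \<subseteq> polys (dvars (Suc m) n)" using polys_mono dvars_Suc by blast
  have gF: "g \<in> polys (dvars m n)" "F \<subseteq> polys (dvars m n)" using A by (simp_all add: dpolys_eq)
  obtain a where "length a = n" "\<forall>f\<in>F. deval (Suc m) (\<delta>(m := D)) a f = 0" "deval (Suc m) (\<delta>(m := D)) a g \<noteq> 0"
    using DCF0_solution[OF dcf R(1), of F g] A P(2,3) R(2) gF sub by blast
  moreover have "deval (Suc m) (\<delta>(m := D)) a f = deval m \<delta> a f" if "f \<in> insert g F" for f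
    using deval_Suc[of f m n \<delta> D a] gF that by blast
  ultimately show "\<exists>a. length a = n \<and> (\<forall>f\<in>F. deval m \<delta> a f = 0) \<and> deval m \<delta> a g \<noteq> 0"
    by (intro exI[of _ a]) simp
qed (rule cd)

lemma DCF0_axiom:
  assumes dcf: "is_DCF0 (Suc m) (\<delta>(m := D))" and rk: "\<forall>n. is_ranking m n (rk n)"
    and P: "prime_dideal m \<delta> n P" and cs: "char_set (rk n) P \<Lambda>" and Ob: "Ob \<noteq> {}" "dopen_in m \<delta> n (dV m \<delta> n \<Lambda>) Ob"
    and OH: "Ob \<inter> dV m \<delta> n {H (rk n) \<Lambda>} = {}" and W: "dclosed m \<delta> (2 * n) W"
      "W \<subseteq> dV m \<delta> (2 * n) (\<Lambda> \<union> tau D n ` \<Lambda>)" "Ob \<subseteq> take n ` W"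
  shows "\<exists>a\<in>Ob. a @ map D a \<in> W"
proof -
  have dcfm: "is_DCF0 m \<delta>" by (rule DCF0_reduct[OF dcf])
  let ?X = "dvars m n" and ?Y = "dvars m (2 * n)"
  have rkn: "is_ranking m n (rk n)" "is_ranking m (2 * n) (rk (2 * n))" using rk by blast+
  have Pp: "prime_of (polys ?X) (dops m \<delta>) P" using P by (simp add: prime_dideal_prime_of)
  note idP = prime_ideal[OF Pp] and subX = subring_polys[of ?X] and subY = subring_polys[of ?Y]
  have PX: "P \<subseteq> polys ?X" using idP by (simp add: ideal_of_def)
  have \<Lambda>: "finite \<Lambda>" "\<Lambda> \<subseteq> P" using cs by (auto simp: char_set_def autoreduced_def)
  have "?X \<subseteq> ?Y" by (auto simp: dvars_def)
  then have XY: "polys ?X \<subseteq> polys ?Y" using polys_mono by blast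
  note Hn = char_set_H_notin[OF rkn(1) cs P]
  obtain S where S: "S \<subseteq> polys ?X" "Ob = dV m \<delta> n \<Lambda> - dV m \<delta> n S"
    using Ob(2) by (auto simp: dopen_in_def dclosed_def dpolys_eq)
  obtain SW where SW: "SW \<subseteq> polys ?Y" "W = dV m \<delta> (2 * n) SW" using W(1) by (auto simp: dclosed_def dpolys_eq)
  have ObP: "length a = n" "\<forall>p\<in>P. deval m \<delta> a p = 0" if "a \<in> Ob" for a
  proof -
    have a: "length a = n" "\<And>f. f \<in> \<Lambda> \<Longrightarrow> deval m \<delta> a f = 0" using that S(2) by (auto simp: dV_def)
    moreover have "deval m \<delta> a (H (rk n) \<Lambda>) \<noteq> 0" using that OH a(1) by (auto simp: dV_def)
    ultimately show "length a = n" "\<forall>p\<in>P. deval m \<delta> a p = 0"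
      using char_set_vanishing[OF rkn(1) cd cs P] by blast+
  qed
  obtain o0 where o0: "o0 \<in> Ob" using Ob(1) by blast
  \<comment> \<open>One equation \<open>c\<close> of the removed closed set suffices: the points of
    V(\<Lambda>) where \<open>c\<close> is nonzero belong to \<open>Ob\<close>.\<close>
  then obtain c where c: "c \<in> S" "deval m \<delta> o0 c \<noteq> 0" using S(2) by (auto simp: dV_def)
  have cP: "c \<in> polys ?X" "c \<notin> P" using c S(1) ObP(2)[OF o0] by auto
  have inOb: "a \<in> Ob" if "length a = n" "\<forall>f\<in>\<Lambda>. deval m \<delta> a f = 0" "deval m \<delta> a c \<noteq> 0" for a
    using that c(1) S(2) by (auto simp: dV_def)
  define W0 where "W0 = {w \<in> W. take n w \<in> Ob}"
  have W0: "length w = 2 * n" if "w \<in> W0" for w using that SW(2) by (auto simp: W0_def dV_def)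
  define J where "J = {p \<in> polys ?Y. \<forall>w\<in>W0. deval m \<delta> w p = 0}"
  have J: "ideal_of (polys ?Y) (dops m \<delta>) J" unfolding J_def by (rule ideal_vanishing[OF cd])
  \<comment> \<open>For \<open>g\<close> outside \<open>P\<close>, the system \<Lambda> with
    \<open>c * g \<noteq> 0\<close> has a solution. It lies in \<open>Ob\<close>, so
    \<open>W\<close> has a point above it, where \<open>g\<close> would have to vanish.\<close>
  have JX: "g \<in> P" if g: "g \<in> J" "g \<in> polys ?X" for g
  proof (rule ccontr)
    assume gP: "g \<notin> P"
    have "c * g \<in> polys ?X" "c * g \<notin> P" using cP g(2) gP prime_mult[OF Pp] by auto
    then obtain a where a: "length a = n" "\<forall>f\<in>\<Lambda>. deval m \<delta> a f = 0" "deval m \<delta> a (c * g) \<noteq> 0"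
      using DCF0_solution[OF dcfm P \<Lambda>] by blast
    then have "a \<in> Ob" using inOb by (simp add: deval_mult)
    then obtain w where w: "w \<in> W" "a = take n w" using W(3) by blast
    then have "w \<in> W0" using \<open>a \<in> Ob\<close> by (simp add: W0_def)
    then have "deval m \<delta> w g = 0" using g(1) by (simp add: J_def)
    then have "deval m \<delta> a g = 0" using deval_take[OF g(2), of w \<delta>] W0[OF \<open>w \<in> W0\<close>] w(2) by simp
    then show False using a(3) by (simp add: deval_mult)
  qed
  have diffY: "diffring (polys ?Y) (dops m \<delta>)" by (rule diffring_dops[OF d]) auto
  obtain Q where Q: "prime_of (polys ?Y) (dops m \<delta>) Q" "J \<subseteq> Q" "Q \<inter> (polys ?X - P) = {}"
  proof (rule prime_avoiding[OF diffY J, of "polys ?X - P"])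
    show "polys ?X - P \<subseteq> polys ?Y" using XY by blast
    show "1 \<in> polys ?X - P" using Pp by (simp add: prime_of_def)
    show "x * y \<in> polys ?X - P" if "x \<in> polys ?X - P" "y \<in> polys ?X - P" for x y
      using that prime_mult[OF Pp, of x y] by auto
    show "J \<inter> (polys ?X - P) = {}" using JX by blast
  qed
  note idQ = prime_ideal[OF Q(1)]
  have QY: "Q \<subseteq> polys ?Y" using idQ by (simp add: ideal_of_def)
  have "P \<subseteq> J"
  proof
    fix p assume p: "p \<in> P"
    have "deval m \<delta> w p = 0" if w: "w \<in> W0" for w
    proof -
      have "deval m \<delta> (take n w) p = 0" using ObP(2) p w by (auto simp: W0_def)
      then show ?thesis using deval_take[of p m n w \<delta>] PX p W0[OF w] by auto
    qed
    then show "p \<in> J" using p PX XY by (auto simp: J_def)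
  qed
  then have PQ: "Q \<inter> polys ?X = P" using Q(2,3) PX by blast
  have tauY: "tau D n p \<in> polys ?Y" if "p \<in> polys ?X" for p
    unfolding tau_der by (rule der_polys[OF D that \<open>?X \<subseteq> ?Y\<close>]) (auto simp: dvars_def)
  have tau_mult: "tau D n (x * y) = x * tau D n y + tau D n x * y" for x y by (simp add: tau_der der_mult[OF D])
  \<comment> \<open>\<open>tau\<close> satisfies the Leibniz rule and commutes with the operators,
    so \<open>N\<close> is a differential ideal. It contains \<Lambda>, and
    \<open>char_set_generates\<close> carries the property from \<Lambda> to all of
    \<open>P\<close>.\<close>
  define N where "N = {p \<in> P. tau D n p \<in> Q}"
  have N: "ideal_of (polys ?X) (dops m \<delta>) N"
    unfolding ideal_of_def
  proof (intro conjI ballI)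
    show "N \<subseteq> polys ?X" using PX by (auto simp: N_def)
    show "0 \<in> N" using ideal_0[OF subX idP] ideal_0[OF subY idQ] by (simp add: N_def tau_der der_0[OF D])
    fix x assume "x \<in> N"
    then have x: "x \<in> P" "tau D n x \<in> Q" by (auto simp: N_def)
    show "x + y \<in> N" if "y \<in> N" for y
      using x that ideal_add[OF subX idP] ideal_add[OF subY idQ] by (simp add: N_def tau_der der_add[OF D])
    show "a * x \<in> N" if a: "a \<in> polys ?X" for a
    proof -
      have "x \<in> Q" using x(1) PQ by blast
      then have "a * tau D n x + tau D n a * x \<in> Q"
        using ideal_add[OF subY idQ ideal_mult[OF subY idQ _ x(2)] ideal_mult[OF subY idQ tauY[OF a]]] a XY by blast
      then show ?thesis using ideal_mult[OF subX idP a x(1)] by (simp add: N_def tau_mult)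
    qed
    show "e x \<in> N" if e: "e \<in> dops m \<delta>" for e
    proof -
      obtain j where j: "j < m" "e = dderiv \<delta> j" using e by (auto simp: dops_def)
      have "e x \<in> P" "e (tau D n x) \<in> Q" using x e idP idQ by (auto simp: ideal_of_def)
      then show ?thesis using tau_dderiv[OF j(1)] j(2) by (simp add: N_def)
    qed
  qed
  have \<Lambda>N: "\<Lambda> \<subseteq> N"
  proof
    fix f assume f: "f \<in> \<Lambda>"
    have "deval m \<delta> w (tau D n f) = 0" if "w \<in> W0" for w using that f W(2) by (auto simp: W0_def dV_def)
    then have "tau D n f \<in> J" using tauY f \<Lambda>(2) PX by (auto simp: J_def)
    then show "f \<in> N" using f \<Lambda>(2) Q(2) by (auto simp: N_def)
  qed
  have tauQ: "tau D n p \<in> Q" if p: "p \<in> P" for p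
  proof -
    obtain h where h: "h \<in> hdiv (rk n) \<Lambda> ?X" "h * p \<in> N"
      using char_set_generates[OF rkn(1) cs Pp d N \<Lambda>N p] by blast
    have hP: "h \<in> polys ?X - P" using hdiv_notin[OF Pp _ h(1)] Hn by blast
    have pQ: "p \<in> Q" using p PQ by blast
    have "h * tau D n p + tau D n h * p \<in> Q" using h(2) by (simp add: N_def tau_mult)
    moreover have "tau D n h * p \<in> Q" using ideal_mult[OF subY idQ tauY pQ] hP by blast
    ultimately have "(h * tau D n p + tau D n h * p) - tau D n h * p \<in> Q" by (rule ideal_diff[OF subY idQ])
    then have "h * tau D n p \<in> Q" by simp
    moreover have "h \<notin> Q" "h \<in> polys ?Y" using hP PQ XY by blast+
    moreover have "tau D n p \<in> polys ?Y" using tauY p PX by blast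
    ultimately show ?thesis using prime_mult[OF Q(1), of h "tau D n p"] by simp
  qed
  let ?Z = "{u \<in> dvars (Suc m) n. snd u m < Suc 1}"
  \<comment> \<open>\<open>\<sigma>\<close> identifies \<open>\<theta>y\<^sub>i\<close> with \<open>\<theta>Dx\<^sub>i\<close>.\<close>
  define \<sigma> where "\<sigma> v = (if fst v < n then v else (fst v - n, (snd v)(m := 1)))" for v :: dvar
  define \<sigma>' where "\<sigma>' u = (if snd u m = 0 then u else (fst u + n, (snd u)(m := 0)))" for u :: dvar
  define R where "R = ev (cst :: 'a \<Rightarrow> _) (\<lambda>v. Xv (\<sigma> v))"
  define R' where "R' = ev (cst :: 'a \<Rightarrow> _) (\<lambda>v. Xv (\<sigma>' v))"
  have \<sigma>Z: "\<sigma> v \<in> ?Z" and \<sigma>\<sigma>: "\<sigma>' (\<sigma> v) = v" if "v \<in> ?Y" for v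
    using that by (auto simp: \<sigma>_def \<sigma>'_def dvars_def fun_upd_idem_iff prod_eq_iff)
  have \<sigma>'Y: "\<sigma>' u \<in> ?Y" if "u \<in> ?Z" for u
  proof -
    have z: "snd u j = 0" if "m \<le> j" "j \<noteq> m" for j using \<open>u \<in> ?Z\<close> that by (auto simp: dvars_def)
    have "snd (\<sigma>' u) j = 0" if "m \<le> j" for j using z[OF that] by (cases "j = m") (auto simp: \<sigma>'_def)
    moreover have "fst (\<sigma>' u) < 2 * n" using that by (auto simp: \<sigma>'_def dvars_def)
    ultimately show ?thesis by (simp add: dvars_def mem_Times_iff)
  qed
  have RZ: "R p \<in> polys ?Z" and R'R: "R' (R p) = p" if "p \<in> polys ?Y" for p
  proof -
    show "R p \<in> polys ?Z" unfolding R_def by (rule ev_polys[OF that], unfold polys_Xv, rule \<sigma>Z)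
    show "R' (R p) = p" unfolding R_def R'_def
      by (rule rename_inverse[where \<rho> = \<sigma> and \<rho>' = \<sigma>', OF that]) (rule \<sigma>\<sigma>)
  qed
  have R'Y: "R' p \<in> polys ?Y" if "p \<in> polys ?Z" for p
    unfolding R'_def by (rule ev_polys[OF that], unfold polys_Xv, rule \<sigma>'Y)
  have R'X: "R' p = p" if "p \<in> polys ?X" for p
    unfolding R'_def by (rule ev_cst_id[OF that]) (auto simp: \<sigma>'_def dvars_def)
  have XZ: "polys ?X \<subseteq> polys ?Z" using polys_mono[of _ ?X ?Z] dvars_Suc[of m n] by fastforce
  \<comment> \<open>\<open>Q\<close> in the variables of order at most 1 in \<open>D\<close>.
    Defined by \<open>R'\<close> instead of as an image under \<open>R\<close>, it is prime as a
    preimage.\<close>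
  define Q2 where "Q2 = {p \<in> polys ?Z. R' p \<in> Q}"
  have Q2: "prime_of (polys ?Z) (dops m \<delta>) Q2"
    unfolding Q2_def
  proof (rule prime_of_preimage[OF Q(1) subring_polys])
    show "R' ` polys ?Z \<subseteq> polys ?Y" using R'Y by blast
    show "R' (x + y) = R' x + R' y" "R' (x * y) = R' x * R' y" "R' 1 = 1" for x y
      by (simp_all add: R'_def ev_add ev_mult)
    fix e and x :: "'a dpoly" assume e: "e \<in> dops m \<delta>" and x: "x \<in> polys ?Z"
    then obtain j where j: "j < m" "e = dderiv \<delta> j" by (auto simp: dops_def)
    have dj: "is_derivation (\<delta> j)" using d j by blast
    have "e x \<in> polys ?Z" unfolding j(2) dderiv_der
      by (rule der_polys[OF dj x]) (use j(1) in \<open>auto simp: dvars_def dv_def\<close>)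
    moreover have "R' (e x) = e (R' x)" unfolding j(2) R'_def
      by (rule ev_rename_dderiv[where \<delta>=\<delta>, OF dj]) (use j(1) in \<open>auto simp: \<sigma>'_def dv_def fun_upd_twist\<close>)
    ultimately show "e x \<in> polys ?Z \<and> (\<exists>e'\<in>dops m \<delta>. R' (e x) = e' (R' x))" using e by blast
  qed
  \<comment> \<open>The compatibility required by \<open>extend_derivation\<close>: under
    \<open>R'\<close>, applying \<open>D\<close> to an element of order 0 becomes
    \<open>tau\<close>, which maps \<open>P\<close> into \<open>Q\<close>.\<close>
  have DQ2: "dderiv (\<delta>(m := D)) m q \<in> Q2" if q: "q \<in> Q2" "q \<in> polys {u \<in> dvars (Suc m) n. snd u m < 1}" for q
  proof -
    have qX: "q \<in> polys ?X" using q(2) dvars_Suc[of m n] by simp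
    then have qP: "q \<in> P" using q(1) R'X PQ by (auto simp: Q2_def)
    have "dderiv (\<delta>(m := D)) m q \<in> polys ?Z" unfolding dderiv_der
      by (rule der_polys[OF _ qX]) (use D in \<open>auto simp: dvars_def dv_def\<close>)
    moreover have "R' (dderiv (\<delta>(m := D)) m q) = tau D n (R' q)"
      unfolding R'_def dderiv_der
    proof (rule ev_der[OF _ rhom_cst qX])
      fix v assume v: "v \<in> ?X"
      then have v0: "snd v m = 0" by (auto simp: dvars_def)
      then have "(snd v)(m := 0) = snd v" by (simp add: fun_upd_idem_iff)
      with v0 show "ev cst (\<lambda>v. Xv (\<sigma>' v)) (Xv (dv m v)) = tau D n (Xv (\<sigma>' v) :: 'a dpoly)"
        by (simp add: tau_der der_Xv[OF D] \<sigma>'_def dv_def fun_upd_idem)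
    qed (use D in \<open>simp_all add: tau_der der_add der_mult\<close>)
    ultimately show ?thesis using tauQ[OF qP] R'X[OF qX] by (simp add: Q2_def)
  qed
  obtain T where T: "prime_dideal (Suc m) (\<delta>(m := D)) n T" "T \<inter> polys ?Z = Q2"
    using extend_derivation[OF d D comD Q2 DQ2] by blast
  obtain \<Gamma> where \<Gamma>: "char_set (rk (2 * n)) Q \<Gamma>" using char_set_exists[OF rkn(2) QY] by blast
  have \<Gamma>': "finite \<Gamma>" "\<Gamma> \<subseteq> Q" using \<Gamma> by (auto simp: char_set_def autoreduced_def)
  have Qd: "prime_dideal m \<delta> (2 * n) Q" using Q(1) by (simp add: prime_dideal_prime_of)
  let ?H = "H (rk (2 * n)) \<Gamma>"
  note H\<Gamma> = char_set_H_notin[OF rkn(2) \<Gamma> Qd]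
  \<comment> \<open>The inequation has two factors: \<open>c\<close> places the solution in
    \<open>Ob\<close>, and \<open>R ?H\<close> turns zeros of \<Gamma> into zeros of all of
    \<open>Q\<close>.\<close>
  have cZ: "c * R ?H \<in> polys ?Z" using cP(1) XZ RZ[OF H\<Gamma>(1)] by blast
  have "R' (c * R ?H) = c * ?H" using R'X[OF cP(1)] R'R[OF H\<Gamma>(1)] by (simp add: R'_def ev_mult)
  moreover have "c * ?H \<notin> Q" using prime_mult[OF Q(1) _ H\<Gamma>(1), of c] H\<Gamma>(2) cP PQ XY by blast
  ultimately have "c * R ?H \<notin> Q2" by (simp add: Q2_def)
  then have nT: "c * R ?H \<notin> T" using T(2) cZ by blast
  have inT: "\<Lambda> \<union> R ` \<Gamma> \<subseteq> T"
  proof -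
    have "\<Lambda> \<subseteq> Q2" using \<Lambda>(2) PX XZ PQ R'X by (auto simp: Q2_def)
    moreover have "R f \<in> Q2" if "f \<in> \<Gamma>" for f
    proof -
      have "f \<in> Q" "f \<in> polys ?Y" using that \<Gamma>'(2) QY by auto
      then show ?thesis using RZ[of f] R'R[of f] by (simp add: Q2_def)
    qed
    ultimately show ?thesis using T(2) by blast
  qed
  have cD: "c * R ?H \<in> polys (dvars (Suc m) n)" using cZ polys_mono[of _ ?Z "dvars (Suc m) n"] by blast
  have "finite (\<Lambda> \<union> R ` \<Gamma>)" using \<Lambda>(1) \<Gamma>'(1) by blast
  from DCF0_solution[OF dcf T(1) this inT cD nT] obtain a where a: "length a = n" "\<forall>f\<in>\<Lambda> \<union> R ` \<Gamma>. deval (Suc m) (\<delta>(m := D)) a f = 0"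
    "deval (Suc m) (\<delta>(m := D)) a (c * R ?H) \<noteq> 0"
    by blast
  have "deval m \<delta> a f = 0" if "f \<in> \<Lambda>" for f
    using a(2) deval_Suc[of f m n \<delta> D a] that \<Lambda>(2) PX by auto
  moreover have "deval m \<delta> a c \<noteq> 0" using a(3) deval_Suc[OF cP(1)] by (simp add: deval_mult)
  ultimately have aOb: "a \<in> Ob" using inOb a(1) by blast
  let ?w = "a @ map D a"
  have ev: "deval (Suc m) (\<delta>(m := D)) a (R q) = deval m \<delta> ?w q" if "q \<in> polys ?Y" for q
    unfolding R_def
  proof (rule deval_rename[OF that])
    fix v assume v: "v \<in> ?Y"
    then have vm: "snd v m = 0" "fst v < 2 * n" by (auto simp: dvars_def)
    show "theta (Suc m) (\<delta>(m := D)) (snd (\<sigma> v)) (a ! fst (\<sigma> v)) = theta m \<delta> (snd v) (?w ! fst v)"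
    proof (cases "fst v < n")
      case True
      then show ?thesis using vm a(1) by (simp add: \<sigma>_def theta_Suc nth_append)
    next
      case False
      then have "theta m \<delta> ((snd v)(m := 1)) (D (a ! (fst v - n))) = theta m \<delta> (snd v) (D (a ! (fst v - n)))"
        by (intro theta_cong) auto
      then show ?thesis using False vm a(1) by (simp add: \<sigma>_def theta_Suc nth_append)
    qed
  qed
  have "deval m \<delta> ?w f = 0" if "f \<in> \<Gamma>" for f using a(2) ev[of f] that \<Gamma>'(2) QY by auto
  moreover have "deval m \<delta> ?w ?H \<noteq> 0" using a(3) ev[OF H\<Gamma>(1)] by (simp add: deval_mult)
  ultimately have van: "deval m \<delta> ?w q = 0" if "q \<in> Q" for q
    using char_set_vanishing[OF rkn(2) cd \<Gamma> Qd] that by blast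
  have "SW \<subseteq> J" using SW by (auto simp: J_def W0_def dV_def)
  then have "?w \<in> W" using van Q(2) a(1) unfolding SW(2) dV_def by auto
  then show ?thesis using aOb by blast
qed

lemma DCF0_from_axiom:
  assumes dcf: "is_DCF0 m \<delta>" and rk: "\<forall>n. is_ranking m n (rk n)"
    and ax: "\<And>n \<Lambda> Ob W P. prime_dideal m \<delta> n P \<Longrightarrow> char_set (rk n) P \<Lambda> \<Longrightarrow> Ob \<noteq> {} \<Longrightarrow>
        dopen_in m \<delta> n (dV m \<delta> n \<Lambda>) Ob \<Longrightarrow> Ob \<inter> dV m \<delta> n {H (rk n) \<Lambda>} = {} \<Longrightarrow> dclosed m \<delta> (2 * n) W \<Longrightarrow>
        W \<subseteq> dV m \<delta> (2 * n) (\<Lambda> \<union> tau D n ` \<Lambda>) \<Longrightarrow> Ob \<subseteq> take n ` W \<Longrightarrow> \<exists>a\<in>Ob. a @ map D a \<in> W"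
  shows "is_DCF0 (Suc m) (\<delta>(m := D))"
  unfolding is_DCF0_def
proof (intro conjI allI impI)
  fix n F g
  assume A: "finite F \<and> F \<subseteq> dpolys (Suc m) n \<and> g \<in> dpolys (Suc m) n \<and>
    (\<exists>P. prime_dideal (Suc m) (\<delta>(m := D)) n P \<and> F \<subseteq> P \<and> g \<notin> P)"
  then obtain P where Pd: "prime_dideal (Suc m) (\<delta>(m := D)) n P" and FP: "F \<subseteq> P" and gP: "g \<notin> P" by blast
  have P: "prime_of (polys (dvars (Suc m) n)) (dops (Suc m) (\<delta>(m := D))) P" using Pd by (simp add: prime_dideal_prime_of)
  have "finite (\<Union>f\<in>insert g F. (\<lambda>u. snd u m) ` vars f)" using A by simp
  then obtain r0 where r0: "\<forall>x\<in>(\<Union>f\<in>insert g F. (\<lambda>u. snd u m) ` vars f). x \<le> r0"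
    using finite_nat_set_iff_bounded_le by blast
  \<comment> \<open>A strict bound on the order in \<open>D\<close>. As a successor it is positive,
    so \<open>n \<le> N\<close> and the original unknowns are among the new ones.\<close>
  define r where "r = Suc r0"
  define N where "N = n * r"
  let ?X = "dvars m N" and ?Y = "dvars m (2 * N)" and ?Z = "{u \<in> dvars (Suc m) n. snd u m < r}"
  have fZ: "f \<in> polys ?Z" if "f \<in> insert g F" for f
  proof -
    have "f \<in> polys (dvars (Suc m) n)" using A that by (auto simp: dpolys_eq)
    moreover have "snd u m < r" if "u \<in> vars f" for u
      using r0 that \<open>f \<in> insert g F\<close> by (auto simp: r_def less_Suc_eq_le)
    ultimately show ?thesis by (auto simp: polys_def)
  qed
  have XY': "?X \<subseteq> ?Y" by (auto simp: dvars_def)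
  then have XY: "polys ?X \<subseteq> polys ?Y" using polys_mono by blast
  \<comment> \<open>The system of order \<open>< r\<close> in \<open>D\<close> becomes one over \<open>N\<close> variables, the one with index \<open>i + n k\<close> standing for \<open>D\<^sup>kx\<^sub>i\<close>.\<close>
  define \<psi> where "\<psi> v = (if fst v < N then (fst v mod n, (snd v)(m := fst v div n))
      else ((fst v - N) mod n, (snd v)(m := Suc ((fst v - N) div n))))" for v :: dvar
  define \<phi> where "\<phi> u = (fst u + n * snd u m, (snd u)(m := 0))" for u :: dvar
  define Psi where "Psi = ev (cst :: 'a \<Rightarrow> _) (\<lambda>v. Xv (\<psi> v))"
  define Phi where "Phi = ev (cst :: 'a \<Rightarrow> _) (\<lambda>v. Xv (\<phi> v))"
  have Psi_hom: "Psi (x + y) = Psi x + Psi y" "Psi (x * y) = Psi x * Psi y" "Psi 1 = 1" "Psi (x - y) = Psi x - Psi y"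
    "Psi (Xv v) = Xv (\<psi> v)" for x y v
    by (simp_all add: Psi_def ev_add ev_mult ev_diff)
  have \<psi>d: "\<psi> v \<in> dvars (Suc m) n" if "v \<in> ?Y" for v
  proof -
    \<comment> \<open>If \<open>n = 0\<close>, then \<open>N = 0\<close> and there are no variables;
      otherwise \<open>mod n\<close> yields an index below \<open>n\<close>.\<close>
    have "0 < n" using that by (cases n) (auto simp: dvars_def N_def)
    then show ?thesis using that by (auto simp: \<psi>_def dvars_def)
  qed
  have \<phi>X: "\<phi> u \<in> ?X" and \<psi>\<phi>: "\<psi> (\<phi> u) = u" if "u \<in> ?Z" for u
  proof -
    have u: "fst u < n" "snd u m < r" "\<And>j. Suc m \<le> j \<Longrightarrow> snd u j = 0" using that by (auto simp: dvars_def)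
    have "fst u + n * snd u m < n + n * snd u m" using u(1) by simp
    also have "\<dots> = n * Suc (snd u m)" by simp
    also have "\<dots> \<le> N" unfolding N_def using u(2) by (intro mult_le_mono) auto
    finally have lt: "fst u + n * snd u m < N" .
    show "\<phi> u \<in> ?X" using lt u(3) by (auto simp: \<phi>_def dvars_def)
    show "\<psi> (\<phi> u) = u" using lt u(1) by (simp add: \<phi>_def \<psi>_def prod_eq_iff)
  qed
  have PhiX: "Phi p \<in> polys ?X" and PsiPhi: "Psi (Phi p) = p" if "p \<in> polys ?Z" for p
  proof -
    show "Phi p \<in> polys ?X" unfolding Phi_def by (rule ev_polys[OF that], unfold polys_Xv, rule \<phi>X)
    show "Psi (Phi p) = p" unfolding Phi_def Psi_def
      by (rule rename_inverse[where \<rho> = \<phi> and \<rho>' = \<psi>, OF that]) (rule \<psi>\<phi>)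
  qed
  have Psid: "Psi p \<in> polys (dvars (Suc m) n)" if "p \<in> polys ?Y" for p
    unfolding Psi_def by (rule ev_polys[OF that], unfold polys_Xv, rule \<psi>d)
  \<comment> \<open>Pulled back along \<open>Psi\<close>, under which the second block of
    \<open>N\<close> variables is the \<open>D\<close>-image of the first: \<open>Q\<close>
    describes a generic solution of \<open>P\<close> together with its derivative.\<close>
  define Q where "Q = {p \<in> polys ?Y. Psi p \<in> P}"
  have dY: "dderiv \<delta> j p \<in> polys (dvars m k)" if "p \<in> polys (dvars m k)" "j < m" for p j k
    unfolding dderiv_der by (rule der_polys[OF _ that(1)]) (use that(2) d in auto)
  have Q: "prime_of (polys ?Y) (dops m \<delta>) Q"
    unfolding Q_def
  proof (rule prime_of_preimage[OF P subring_polys _ Psi_hom(1-3)])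
    show "Psi ` polys ?Y \<subseteq> polys (dvars (Suc m) n)" using Psid by blast
    fix e and x :: "'a dpoly" assume e: "e \<in> dops m \<delta>" and x: "x \<in> polys ?Y"
    then obtain j where j: "j < m" "e = dderiv \<delta> j" by (auto simp: dops_def)
    have "Psi (e x) = e (Psi x)" unfolding j(2) Psi_def
      by (rule ev_rename_dderiv[where \<delta>=\<delta>]) (use d j(1) in \<open>auto simp: \<psi>_def dv_def fun_upd_twist\<close>)
    then show "e x \<in> polys ?Y \<and> (\<exists>e'\<in>dops (Suc m) (\<delta>(m := D)). Psi (e x) = e' (Psi x))"
      using e dops_Suc[of m \<delta> D] dY[OF x j(1)] j(2) by blast
  qed
  then have Qd: "prime_dideal m \<delta> (2 * N) Q" by (simp add: prime_dideal_prime_of)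
  define P' where "P' = Q \<inter> polys ?X"
  have P': "prime_of (polys ?X) (dops m \<delta>) P'"
    unfolding P'_def
  proof (rule prime_of_Int[OF Q subring_polys XY])
    fix e and x :: "'a dpoly" assume "e \<in> dops m \<delta>" "x \<in> polys ?X" "x \<in> Q"
    then show "e x \<in> Q \<inter> polys ?X" using prime_ideal[OF Q] dY by (auto simp: ideal_of_def dops_def)
  qed
  then have P'd: "prime_dideal m \<delta> N P'" by (simp add: prime_dideal_prime_of)
  have rkN: "is_ranking m N (rk N)" using rk by blast
  have P'X: "P' \<subseteq> polys ?X" by (simp add: P'_def)
  obtain \<Lambda> where cs: "char_set (rk N) P' \<Lambda>" using char_set_exists[OF rkN P'X] by blast
  have \<Lambda>: "finite \<Lambda>" "\<Lambda> \<subseteq> P'" using cs by (auto simp: char_set_def autoreduced_def)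
  let ?H = "H (rk N) \<Lambda>"
  note Hn = char_set_H_notin[OF rkN cs P'd]
  obtain h where h: "h \<in> polys ?X" "h \<notin> Q" and proj: "\<And>a. length a = N \<Longrightarrow> \<forall>f\<in>P'. deval m \<delta> a f = 0 \<Longrightarrow>
      deval m \<delta> a h \<noteq> 0 \<Longrightarrow> \<exists>b. length b = N \<and> (\<forall>f\<in>Q. deval m \<delta> (a @ b) f = 0)"
    using differential_projection[OF dcf rkN Qd] unfolding P'_def by blast
  define g' where "g' = Phi g"
  have g': "g' \<in> polys ?X" "g' \<notin> P'"
    using PhiX[OF fZ] PsiPhi[OF fZ] gP by (auto simp: g'_def P'_def Q_def)
  \<comment> \<open>\<open>?H\<close> makes the points of \<open>Ob\<close> zeros of
    \<open>P'\<close>, \<open>g'\<close> carries the inequation of the system, and \<open>h\<close>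
    lets every point of \<open>Ob\<close> lift to \<open>W\<close>.\<close>
  let ?k = "?H * (g' * h)"
  have k: "?k \<in> polys ?X" "?k \<notin> P'"
  proof -
    have "g' * h \<in> polys ?X" "g' * h \<notin> P'" using g' h prime_mult[OF P' g'(1) h(1)] by (auto simp: P'_def)
    then show "?k \<in> polys ?X" "?k \<notin> P'" using Hn prime_mult[OF P' Hn(1)] by auto
  qed
  define Ob where "Ob = dV m \<delta> N \<Lambda> - dV m \<delta> N {?k}"
  have Ob: "length a = N" "\<forall>f\<in>\<Lambda>. deval m \<delta> a f = 0" "deval m \<delta> a ?H \<noteq> 0" "deval m \<delta> a g' \<noteq> 0" "deval m \<delta> a h \<noteq> 0"
    if "a \<in> Ob" for a
    using that by (auto simp: Ob_def dV_def deval_mult)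
  have ObP': "\<forall>p\<in>P'. deval m \<delta> a p = 0" if "a \<in> Ob" for a
    using char_set_vanishing[OF rkN cd cs P'd _ Ob(3)[OF that]] Ob(2)[OF that] by blast
  define W where "W = dV m \<delta> (2 * N) Q"
  have "\<exists>a\<in>Ob. a @ map D a \<in> W"
  proof (rule ax[OF P'd cs])
    obtain a where "length a = N" "\<forall>f\<in>\<Lambda>. deval m \<delta> a f = 0" "deval m \<delta> a ?k \<noteq> 0"
      using DCF0_solution[OF dcf P'd \<Lambda> k] by blast
    then have "a \<in> Ob" by (auto simp: Ob_def dV_def)
    then show "Ob \<noteq> {}" by blast
    show "dopen_in m \<delta> N (dV m \<delta> N \<Lambda>) Ob"
      unfolding dopen_in_def dclosed_def Ob_def using k(1)
      by (intro exI[of _ "dV m \<delta> N {?k}"] conjI exI[of _ "{?k}"]) (auto simp: dpolys_eq)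
    show "Ob \<inter> dV m \<delta> N {?H} = {}" using Ob(3) by (auto simp: dV_def)
    show "dclosed m \<delta> (2 * N) W"
      unfolding dclosed_def W_def by (rule exI[of _ Q]) (auto simp: dpolys_eq Q_def)
    have "tau D N f \<in> Q" if f: "f \<in> \<Lambda>" for f
    proof -
      have fX: "f \<in> polys ?X" "Psi f \<in> P" using f \<Lambda>(2) by (auto simp: P'_def Q_def)
      have "Psi (tau D N f) = dderiv (\<delta>(m := D)) m (Psi f)"
        unfolding Psi_def tau_der
      proof (rule ev_der[OF D rhom_cst fX(1)])
        fix v assume v: "v \<in> ?X"
        then have "fst v < N" by (auto simp: dvars_def)
        then show "ev cst (\<lambda>v. Xv (\<psi> v)) (Xv (fst v + N, snd v)) = dderiv (\<delta>(m := D)) m (Xv (\<psi> v) :: 'a dpoly)"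
          using D by (simp add: dderiv_der der_Xv \<psi>_def dv_def)
      qed (use D in \<open>simp_all add: dderiv_der der_add der_mult\<close>)
      moreover have "dderiv (\<delta>(m := D)) m (Psi f) \<in> P"
        using prime_ideal[OF P] fX(2) by (auto simp: ideal_of_def dops_def)
      moreover have "tau D N f \<in> polys ?Y"
        unfolding tau_der by (rule der_polys[OF D fX(1) XY']) (auto simp: dvars_def)
      ultimately show ?thesis by (simp add: Q_def)
    qed
    moreover have "\<Lambda> \<subseteq> Q" using \<Lambda>(2) by (auto simp: P'_def)
    ultimately show "W \<subseteq> dV m \<delta> (2 * N) (\<Lambda> \<union> tau D N ` \<Lambda>)" by (auto simp: W_def dV_def)
    show "Ob \<subseteq> take N ` W"
    proof
      fix a assume a: "a \<in> Ob"
      obtain b where b: "length b = N" "\<forall>f\<in>Q. deval m \<delta> (a @ b) f = 0"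
        using proj[OF Ob(1)[OF a] ObP'[OF a] Ob(5)[OF a]] by blast
      then have "a @ b \<in> W" using Ob(1)[OF a] by (simp add: W_def dV_def)
      moreover have "take N (a @ b) = a" using Ob(1)[OF a] by simp
      ultimately show "a \<in> take N ` W" by (metis imageI)
    qed
  qed
  then obtain a where a: "a \<in> Ob" "a @ map D a \<in> W" by blast
  note lenN = Ob(1)[OF a(1)]
  have nN: "n \<le> N" by (simp add: N_def r_def)
  \<comment> \<open>\<open>Psi\<close> identifies variable \<open>N + (i + n * k)\<close> with
    variable \<open>i + n * Suc k\<close>, so their difference lies in \<open>Q\<close>. At a point
    of \<open>W\<close> of the form \<open>a @ map D a\<close> this forces the entries of
    \<open>a\<close> to be successive \<open>D\<close>-derivatives.\<close>
  have powD: "a ! (i + n * k) = (D ^^ k) (a ! i)" if i: "i < n" and "k < r" for i k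
    using \<open>k < r\<close>
  proof (induction k)
    case (Suc k)
    have "i + n * Suc k < n * Suc (Suc k)" using i by simp
    also have "\<dots> \<le> N" unfolding N_def using Suc.prems by (intro mult_le_mono) auto
    finally have lt: "i + n * Suc k < N" .
    then have lt': "i + n * k < N" by simp
    let ?u = "(N + (i + n * k), \<lambda>_. 0) :: dvar" and ?v = "(i + n * Suc k, \<lambda>_. 0) :: dvar"
    let ?q = "Xv ?u - Xv ?v :: 'a dpoly"
    have "(i + n * l) mod n = i" "(i + n * l) div n = l" for l using i by simp_all
    then have "\<psi> ?u = \<psi> ?v" using lt by (simp add: \<psi>_def del: mult_Suc_right)
    then have "Psi ?q = 0" by (simp add: Psi_hom)
    moreover have "?u \<in> ?Y" "?v \<in> ?Y" using lt lt' by (auto simp: dvars_def)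
    ultimately have "?q \<in> Q" using ideal_0[OF subring_polys prime_ideal[OF P]] by (auto simp: Q_def)
    then have "deval m \<delta> (a @ map D a) ?q = 0" using a(2) by (simp add: W_def dV_def)
    then have "D (a ! (i + n * k)) = a ! (i + n * Suc k)"
      using lenN lt lt' by (simp add: deval_diff theta_0 nth_append)
    then show ?case using Suc by simp
  qed simp
  have ev: "deval (Suc m) (\<delta>(m := D)) (take n a) f = deval m \<delta> a (Phi f)" if "f \<in> polys ?Z" for f
    unfolding Phi_def
  proof (rule deval_rename[OF that, symmetric])
    fix u assume u: "u \<in> ?Z"
    then have u': "fst u < n" "snd u m < r" by (auto simp: dvars_def)
    have "theta m \<delta> ((snd u)(m := 0)) x = theta m \<delta> (snd u) x" for x by (rule theta_cong) auto
    then show "theta m \<delta> (snd (\<phi> u)) (a ! fst (\<phi> u)) = theta (Suc m) (\<delta>(m := D)) (snd u) (take n a ! fst u)"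
      using u' powD[OF u'] by (simp add: \<phi>_def theta_Suc)
  qed
  show "\<exists>a. length a = n \<and> (\<forall>f\<in>F. deval (Suc m) (\<delta>(m := D)) a f = 0) \<and> deval (Suc m) (\<delta>(m := D)) a g \<noteq> 0"
  proof (intro exI[of _ "take n a"] conjI ballI)
    show "length (take n a) = n" using lenN nN by simp
    show "deval (Suc m) (\<delta>(m := D)) (take n a) g \<noteq> 0" using ev[OF fZ] Ob(4)[OF a(1)] by (simp add: g'_def)
    fix f assume f: "f \<in> F"
    have fz: "f \<in> polys ?Z" using fZ f by blast
    have "Phi f \<in> P'" using PhiX[OF fz] PsiPhi[OF fz] FP f XY by (auto simp: P'_def Q_def)
    then show "deval (Suc m) (\<delta>(m := D)) (take n a) f = 0" using ev[OF fz] ObP'[OF a(1)] by simp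
  qed
qed (rule cd_Suc)

end

theorem theorem4:
  fixes m :: nat and \<delta> :: "nat \<Rightarrow> 'a::field_char_0 \<Rightarrow> 'a" and D :: "'a \<Rightarrow> 'a"
    and rk :: "nat \<Rightarrow> dvar \<Rightarrow> dvar \<Rightarrow> bool"
  assumes "\<forall>j<m. is_derivation (\<delta> j)"
    and "is_derivation D"
    and "\<forall>i<m. \<forall>j<m. \<delta> i \<circ> \<delta> j = \<delta> j \<circ> \<delta> i"
    and "\<forall>j<m. \<delta> j \<circ> D = D \<circ> \<delta> j"
    and "\<forall>n. is_ranking m n (rk n)"
  shows "is_DCF0 (Suc m) (\<delta>(m := D)) \<longleftrightarrow>
     is_DCF0 m \<delta> \<and>
     (\<forall>n \<Lambda> Ob W.
        (\<exists>P. prime_dideal m \<delta> n P \<and> char_set (rk n) P \<Lambda>) \<and>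
        Ob \<noteq> {} \<and> dopen_in m \<delta> n (dV m \<delta> n \<Lambda>) Ob \<and>
        Ob \<inter> dV m \<delta> n {H (rk n) \<Lambda>} = {} \<and>
        dclosed m \<delta> (2 * n) W \<and>
        W \<subseteq> dV m \<delta> (2 * n) (\<Lambda> \<union> tau D n ` \<Lambda>) \<and>
        Ob \<subseteq> take n ` W
        \<longrightarrow> (\<exists>a\<in>Ob. a @ map D a \<in> W))" (is "?L \<longleftrightarrow> ?M \<and> ?A")
proof
  assume L: ?L
  have ?A
  proof (intro allI impI, elim conjE exE)
    fix n \<Lambda> Ob W P
    assume "prime_dideal m \<delta> n P" "char_set (rk n) P \<Lambda>" "Ob \<noteq> {}" "dopen_in m \<delta> n (dV m \<delta> n \<Lambda>) Ob"
      "Ob \<inter> dV m \<delta> n {H (rk n) \<Lambda>} = {}" "dclosed m \<delta> (2 * n) W"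
      "W \<subseteq> dV m \<delta> (2 * n) (\<Lambda> \<union> tau D n ` \<Lambda>)" "Ob \<subseteq> take n ` W"
    then show "\<exists>a\<in>Ob. a @ map D a \<in> W" by (rule DCF0_axiom[OF assms(1-4) L assms(5)])
  qed
  then show "?M \<and> ?A" using DCF0_reduct[OF assms(1-4) L] by blast
next
  assume R: "?M \<and> ?A"
  show ?L
  proof (rule DCF0_from_axiom[OF assms(1-4) conjunct1[OF R] assms(5)])
    fix n \<Lambda> Ob W P
    assume "prime_dideal m \<delta> n P" "char_set (rk n) P \<Lambda>" "Ob \<noteq> {}" "dopen_in m \<delta> n (dV m \<delta> n \<Lambda>) Ob"
      "Ob \<inter> dV m \<delta> n {H (rk n) \<Lambda>} = {}" "dclosed m \<delta> (2 * n) W"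
      "W \<subseteq> dV m \<delta> (2 * n) (\<Lambda> \<union> tau D n ` \<Lambda>)" "Ob \<subseteq> take n ` W"
    then show "\<exists>a\<in>Ob. a @ map D a \<in> W" by (intro conjunct2[OF R, rule_format] conjI exI[of _ P])
  qed
qed

end
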